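(* For convex bodies $B,C\subset\mathbb{R}^n$, consider the inequality $$(|B|\,|C|)^{1/n}+(|B_2^n|\,|B_2^n+B+C|)^{1/n}\leq |B_2^n+B|^{1/n}\,|B_2^n+C|^{1/n}.\qquad( * )$$ In every dimension $n\geq 3$ there are zonoids $B,C\subset\mathbb{R}^n$ for which $( * )$ fails. More precisely: (i) in $\mathbb{R}^3$ there exist an unconditional zonotope $B$ with six generators and a quarter-turn $R$ such that, for every sufficiently large $t$, $( * )$ (with $n=3$) fails for the pair $tB,\,tRB$; (ii) for every $n\geq 4$ there are zonoids $B,C\subset\mathbb{R}^n$ such that $B+C=2B_2^n$ and, for every sufficiently large $t$, $( * )$ fails for the pair $tB,\,tC$.
   Context: A convex body is a (nonempty) compact convex set. $|K|$ is $n$-dimensional Lebesgue measure, $B_2^n$ is the closed Euclidean unit ball of $\mathbb{R}^n$, and $+$ denotes Minkowski sum. A zonotope is a finite Minkowski sum of segments (its generators); a zonoid is a limit of zonotopes in the Hausdorff metric. A set in $\mathbb{R}^n$ is unconditional if it is invariant under the reflections in all coordinate hyperplanes. A quarter-turn of $\mathbb{R}^3$ is a rotation by angle $\pi/2$ about a coordinate axis, e.g. $R(x,y,z)=(-y,x,z)$. *)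

theory Defs
  imports "HOL-Analysis.Analysis"
begin

definition convex_body :: "'a::euclidean_space set \<Rightarrow> bool" where
  "convex_body K \<longleftrightarrow> K \<noteq> {} \<and> compact K \<and> convex K"

(* Minkowski sums, finite sums included, are those of HOL-Library.Set_Algebras; the empty sum is {0}. *)
definition zonotope :: "'a::euclidean_space set \<Rightarrow> bool" where
  "zonotope Z \<longleftrightarrow> (\<exists>(m::nat) a b. Z = (\<Sum>i<m. closed_segment (a i) (b i)))"

(* The generators are nondegenerate and pairwise non-parallel: otherwise a generator could be
   split, or a point added, and the number of generators would not be determined by the zonotope. *)
definition zonotope_with_generators :: "nat \<Rightarrow> 'a::euclidean_space set \<Rightarrow> bool" where
  "zonotope_with_generators m Z \<longleftrightarrow>
     (\<exists>a b. (\<forall>i<m. a i \<noteq> b i) \<and>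
            (\<forall>i<m. \<forall>j<m. i \<noteq> j \<longrightarrow> \<not> collinear {0, b i - a i, b j - a j}) \<and>
            Z = (\<Sum>i<m. closed_segment (a i) (b i)))"

(* Meaningful for nonempty bounded sets, where both suprema are over nonempty bounded sets of reals. *)
definition hausdorff_distance :: "'a::metric_space set \<Rightarrow> 'a set \<Rightarrow> real" where
  "hausdorff_distance A B = max (SUP x\<in>A. infdist x B) (SUP y\<in>B. infdist y A)"

definition zonoid :: "'a::euclidean_space set \<Rightarrow> bool" where
  "zonoid K \<longleftrightarrow> convex_body K \<and>
     (\<exists>Z. (\<forall>k. zonotope (Z k)) \<and> (\<lambda>k::nat. hausdorff_distance (Z k) K) \<longlonglongrightarrow> 0)"

definition coord_reflection :: "'n \<Rightarrow> real ^ 'n \<Rightarrow> real ^ 'n::finite" where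
  "coord_reflection i x = (\<chi> j. if j = i then - x $ j else x $ j)"

definition unconditional :: "(real ^ 'n::finite) set \<Rightarrow> bool" where
  "unconditional K \<longleftrightarrow> (\<forall>i. coord_reflection i ` K = K)"

definition plane_rotation :: "'n \<Rightarrow> 'n \<Rightarrow> real \<Rightarrow> real ^ 'n \<Rightarrow> real ^ 'n::finite" where
  "plane_rotation i j \<theta> x =
     (\<chi> k. if k = i then cos \<theta> * x $ i - sin \<theta> * x $ j
          else if k = j then sin \<theta> * x $ i + cos \<theta> * x $ j
          else x $ k)"

(* In dimension 3 a rotation in the plane of coordinates i, j is one about the remaining axis;
   the order of i and j selects the sense.  plane_rotation 1 2 (pi/2) is (x,y,z) |-> (-y,x,z). *)
definition quarter_turn :: "(real ^ 3 \<Rightarrow> real ^ 3) \<Rightarrow> bool" where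
  "quarter_turn R \<longleftrightarrow> (\<exists>i j. i \<noteq> j \<and> R = plane_rotation i j (pi / 2))"

abbreviation vol :: "'a::euclidean_space set \<Rightarrow> real" where
  "vol K \<equiv> measure lebesgue K"

definition volume_ineq :: "'a::euclidean_space set \<Rightarrow> 'a set \<Rightarrow> bool" where
  "volume_ineq B C \<longleftrightarrow>
     root DIM('a) (vol B * vol C) + root DIM('a) (vol (cball (0::'a) 1) * vol (cball 0 1 + B + C))
       \<le> root DIM('a) (vol (cball 0 1 + B)) * root DIM('a) (vol (cball 0 1 + C))"

end

theory Submission
  imports Defs "HOL-Analysis.Cross3"
begin

text \<open>
  In dimension $n \ge 3$ the bodies $K(a,b)$ with support function $a|u| + b\,u_1^2/|u|$ form a family closed under
  Minkowski sums and dilations that contains the balls. For large $r$ both $K(r + c, 1)$ and $K(r - c, -1)$ are zonoids,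
  because the cosine transform of a density $x + y v_1^2$ on the ball is of the above form. Let $B$ and $C$ be
  these two bodies divided by $r$, let $\kappa$ be the volume of the unit ball and put
  $D(r) = (|K(r + c, 1)|\,|K(r - c, -1)|)^{1/n} - \kappa^{2/n} r^2$. Then the inequality for $tB$, $tC$ says exactly
  that $D(r) \le D(r + r/t)$. Each volume is a polynomial in $r$, whose coefficients are integrals of polynomials against
  $(1-s^2)^{(n-1)/2}$, and for $c = -(n+1)/(n+4)$ one finds $D(r) = L + Q r^{-2} + O(r^{-4})$ with $Q > 0$. So $D$ lies
  above its limit, hence $D'(r) < 0$ for some arbitrarily large $r$, and for such $r$ the inequality fails for all large $t$.

  In dimension three, the second difference of the volume under the addition of two segments is, up to a constant,
  the area of the parallelogram they span times the width of the body in the direction normal to both. Summing these differences gives the volume of a zonotope and of its sum with a ball,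
  and the inequality fails for large $t$ once $64 S^3 < 27 \kappa V W$, where $V$ and $W$ are the sums of
  $|\det|$ over the triples of generators of $B$ and of $B + RB$, and $S$ is the sum of $|v \times w|$ over the
  pairs of generators of $B$.
\<close>

section \<open>Support functions and zonoids\<close>

text \<open>The collapse to one function D comes from the ball lying in the family. Adding the unit
  ball raises the coefficient of |u| by 1; at scale t/r this moves r to r + r/t and leaves c and the
  coefficient of u_1^2/|u| alone. Since B + C is a ball, the term with the sum contributes exactly
  the scaled increment of kappa^(2/n) r^2, and only D remains. The parameter r is fixed before t
  grows, so a single point where D decreases is enough, and no asymptotics of D' are computed. The
  sign of Q depends on the dimension: the fourth-order coefficient behind it carries a factor n - 2,
  so this family gives nothing in the plane. The shift c enlarges that coefficient as far as
  possible. Part (i) asks for a zonotope with few generators and a rotated copy of it, which this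
  family does not supply. Hence the second argument, where the volumes are exact cubic polynomials
  in t and the inequality is decided one order below the leading one.\<close>

text \<open>A point outside \<open>S\<close> is strictly separated from it by some \<open>a\<close>,
  but the constraint at \<open>- a\<close> keeps the point no further out than some point of
  \<open>S\<close>. Only attaining points are required, so inclusions into Minkowski sums follow
  without computing suprema.\<close>

lemma subset_if_support_le:
  fixes S :: "'a::euclidean_space set"
  assumes "closed S" "convex S" and sup: "\<And>u. \<exists>p\<in>S. h u \<le> p \<bullet> u"
  shows "{x. \<forall>u. x \<bullet> u \<le> h u} \<subseteq> S"
proof (rule ccontr)
  assume "\<not> ?thesis"
  then obtain x where x: "\<forall>u. x \<bullet> u \<le> h u" "x \<notin> S" by blast
  obtain a b where ab: "a \<bullet> x < b" "\<forall>y\<in>S. a \<bullet> y > b"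
    using separating_hyperplane_closed_point[OF assms(2,1) x(2)] by blast
  obtain p where "p \<in> S" "h (- a) \<le> p \<bullet> (- a)" using sup by blast
  moreover have "x \<bullet> (- a) \<le> h (- a)" "a \<bullet> p > b" using x(1) ab(2) \<open>p \<in> S\<close> by blast+
  ultimately show False using ab(1) by (simp add: inner_commute)
qed

lemma convex_body_plus:
  fixes A B :: "'a::euclidean_space set"
  assumes "convex_body A" "convex_body B"
  shows "convex_body (A + B)"
proof -
  have "A + B = (\<Union>x\<in>A. \<Union>y\<in>B. {x + y})" by (auto simp: set_plus_def)
  then have "compact (A + B)" using assms compact_sums'[of A B] by (simp add: convex_body_def)
  moreover have "convex (A + B)" using assms by (intro convex_set_plus) (auto simp: convex_body_def)
  moreover have "A + B \<noteq> {}" using assms by (auto simp: convex_body_def)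
  ultimately show ?thesis by (simp add: convex_body_def)
qed

lemma convex_body_cball: "0 \<le> r \<Longrightarrow> convex_body (cball x r)"
  by (auto simp: convex_body_def)

text \<open>Lower side of a squeeze to 0. A real supremum says something only for sets bounded
  above, hence the boundedness; for empty \<open>B\<close> the function \<open>infdist\<close> is
  constantly 0.\<close>

lemma hausdorff_distance_nonneg:
  assumes "A \<noteq> {}" "bounded A" "bounded B"
  shows "0 \<le> hausdorff_distance A B"
proof -
  obtain x where x: "x \<in> A" using assms(1) by blast
  have "bdd_above ((\<lambda>x. infdist x B) ` A)"
  proof (cases "B = {}")
    case False
    then obtain b where b: "b \<in> B" by blast
    obtain e where e: "\<forall>y\<in>A. dist b y \<le> e" using assms(2) bounded_any_center[of A b] by blast
    show ?thesis
    proof (rule bdd_aboveI2)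
      fix y assume "y \<in> A"
      then show "infdist y B \<le> e" using e infdist_le[OF b, of y] by (auto simp: dist_commute)
    qed
  qed (auto simp: infdist_def)
  then have "infdist x B \<le> (SUP x\<in>A. infdist x B)" using x by (rule cSUP_upper2) auto
  then show ?thesis unfolding hausdorff_distance_def using infdist_nonneg[of x B] by linarith
qed

text \<open>The hypotheses make \<open>f\<close> and \<open>g\<close> the support functions, with
  attained maxima. Then \<open>f u \<le> g u + \<eta> * norm u\<close> places \<open>A\<close>
  inside \<open>B + cball 0 \<eta>\<close>, and the roles can be exchanged.\<close>

lemma hausdorff_distance_le_support:
  fixes A B :: "'a::euclidean_space set"
  assumes A: "convex_body A" "\<And>x u. x \<in> A \<Longrightarrow> x \<bullet> u \<le> f u" "\<And>u. \<exists>p\<in>A. f u \<le> p \<bullet> u"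
    and B: "convex_body B" "\<And>x u. x \<in> B \<Longrightarrow> x \<bullet> u \<le> g u" "\<And>u. \<exists>p\<in>B. g u \<le> p \<bullet> u"
    and close: "\<And>u. \<bar>f u - g u\<bar> \<le> \<eta> * norm u" and "0 \<le> \<eta>"
  shows "hausdorff_distance A B \<le> \<eta>"
proof -
  have *: "infdist x Y \<le> \<eta>" if X: "\<And>x u. x \<in> X \<Longrightarrow> x \<bullet> u \<le> k u"
    and Y: "convex_body Y" "\<And>u. \<exists>p\<in>Y. l u \<le> p \<bullet> u"
    and kl: "\<And>u. k u \<le> l u + \<eta> * norm u" and x: "x \<in> X"
    for X Y :: "'a set" and k l x
  proof -
    have "{x. \<forall>u. x \<bullet> u \<le> k u} \<subseteq> Y + cball 0 \<eta>"
    proof (rule subset_if_support_le)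
      show "closed (Y + cball 0 \<eta>)" "convex (Y + cball 0 \<eta>)"
        using convex_body_plus[OF Y(1) convex_body_cball[OF \<open>0 \<le> \<eta>\<close>, of 0]]
        by (auto simp: convex_body_def compact_imp_closed)
      fix u
      obtain p where p: "p \<in> Y" "l u \<le> p \<bullet> u" using Y(2) by blast
      have sgn_u: "sgn u \<bullet> u = norm u"
        by (cases "u = 0") (auto simp: sgn_div_norm dot_square_norm power2_eq_square)
      have "p + \<eta> *\<^sub>R sgn u \<in> Y + cball 0 \<eta>"
        using p \<open>0 \<le> \<eta>\<close> by (intro set_plus_intro) (auto simp: norm_sgn)
      moreover have "k u \<le> (p + \<eta> *\<^sub>R sgn u) \<bullet> u"
        using p(2) kl[of u] sgn_u by (simp add: inner_add_left)
      ultimately show "\<exists>q\<in>Y + cball 0 \<eta>. k u \<le> q \<bullet> u" by blast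
    qed
    with X x have "x \<in> Y + cball 0 \<eta>" by blast
    then obtain y b where "y \<in> Y" "x = y + b" "norm b \<le> \<eta>" by (auto elim!: set_plus_elim)
    then show ?thesis using infdist_le[of y Y x] by (simp add: dist_norm)
  qed
  have "f u \<le> g u + \<eta> * norm u" "g u \<le> f u + \<eta> * norm u" for u
    using close[of u] by linarith+
  then have "infdist x B \<le> \<eta>" if "x \<in> A" for x using *[OF A(2) B(1,3) _ that] by blast
  moreover have "infdist y A \<le> \<eta>" if "y \<in> B" for y
    using *[OF B(2) A(1,3) _ that] \<open>\<And>u. g u \<le> f u + \<eta> * norm u\<close> by blast
  moreover have "A \<noteq> {}" "B \<noteq> {}" using A(1) B(1) by (auto simp: convex_body_def)
  ultimately show ?thesis unfolding hausdorff_distance_def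
    by (intro max.boundedI cSUP_least) auto
qed

abbreviation seg :: "'a::euclidean_space \<Rightarrow> 'a set" where
  "seg v \<equiv> closed_segment (- v) v"

lemma seg_iff: "x \<in> seg v \<longleftrightarrow> (\<exists>t\<in>{-1..1}. x = t *\<^sub>R v)"
proof
  assume "x \<in> seg v"
  then obtain c where c: "0 \<le> c" "c \<le> 1" "x = (1 - c) *\<^sub>R (- v) + c *\<^sub>R v"
    by (auto simp: in_segment)
  then have "x = (2 * c - 1) *\<^sub>R v" by (simp add: algebra_simps flip: scaleR_2)
  then show "\<exists>t\<in>{-1..1}. x = t *\<^sub>R v" using c(1,2) by (intro bexI[of _ "2 * c - 1"]) auto
next
  assume "\<exists>t\<in>{-1..1}. x = t *\<^sub>R v"
  then obtain t where t: "-1 \<le> t" "t \<le> 1" "x = t *\<^sub>R v" by auto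
  have "(1 - (1 + t) / 2) *\<^sub>R (- v) + ((1 + t) / 2) *\<^sub>R v = (((1 + t) / 2) - (1 - (1 + t) / 2)) *\<^sub>R v"
    by (simp only: scaleR_minus_right scaleR_left_diff_distrib) simp
  also have "\<dots> = t *\<^sub>R v" by (simp add: field_simps)
  finally have "(1 - (1 + t) / 2) *\<^sub>R (- v) + ((1 + t) / 2) *\<^sub>R v = t *\<^sub>R v" .
  then show "x \<in> seg v" unfolding in_segment using t by (intro exI[of _ "(1 + t) / 2"]) auto
qed

lemma convex_body_singleton: "convex_body {x}"
  by (simp add: convex_body_def)

lemma convex_body_seg: "convex_body (seg v)"
  by (simp add: convex_body_def)

lemma convex_body_sum:
  assumes "\<And>i. i \<in> I \<Longrightarrow> convex_body (S i)"
  shows "convex_body (sum S I)"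
  using assms
proof (induction I rule: infinite_finite_induct)
  case (insert i I)
  then show ?case by (simp add: convex_body_plus)
qed (auto simp: set_zero convex_body_singleton)

text \<open>Together the two parts identify the support function of a centred zonotope. The maximum
  is reached by picking in each segment the point
  \<open>sgn (y i \<bullet> u) *\<^sub>R y i\<close>.\<close>

lemma sum_seg_support:
  fixes y :: "nat \<Rightarrow> 'a::euclidean_space"
  shows "x \<in> (\<Sum>i<m. seg (y i)) \<Longrightarrow> x \<bullet> u \<le> (\<Sum>i<m. \<bar>y i \<bullet> u\<bar>)"
    and "\<exists>p\<in>(\<Sum>i<m. seg (y i)). (\<Sum>i<m. \<bar>y i \<bullet> u\<bar>) \<le> p \<bullet> u"
proof (induction m arbitrary: x)
  case 0
  { case 1 then show ?case by (simp add: set_zero) }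
  { case 2 then show ?case by (simp add: set_zero) }
next
  case (Suc m)
  { case 1
    then obtain a b where ab: "x = a + b" "a \<in> (\<Sum>i<m. seg (y i))" "b \<in> seg (y m)"
      by (auto elim!: set_plus_elim)
    obtain t where t: "t \<in> {-1..1}" "b = t *\<^sub>R y m" using ab(3) seg_iff by blast
    have "b \<bullet> u \<le> \<bar>t\<bar> * \<bar>y m \<bullet> u\<bar>" using t abs_ge_self[of "t * (y m \<bullet> u)"] by (simp add: abs_mult)
    also have "\<dots> \<le> \<bar>y m \<bullet> u\<bar>" using t by (intro mult_left_le_one_le) auto
    finally show ?case using Suc.IH(1)[OF ab(2)] by (simp add: ab(1) inner_add_left) }
  { case 2
    obtain p where p: "p \<in> (\<Sum>i<m. seg (y i))" "(\<Sum>i<m. \<bar>y i \<bullet> u\<bar>) \<le> p \<bullet> u" using Suc.IH(2) by blast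
    let ?q = "sgn (y m \<bullet> u) *\<^sub>R y m"
    have "?q \<in> seg (y m)" unfolding seg_iff by (intro bexI[of _ "sgn (y m \<bullet> u)"]) (auto simp: sgn_if)
    then have "p + ?q \<in> (\<Sum>i<Suc m. seg (y i))" using p(1) by (auto intro: set_plus_intro)
    moreover have "(\<Sum>i<Suc m. \<bar>y i \<bullet> u\<bar>) \<le> (p + ?q) \<bullet> u"
      using p(2) by (simp add: inner_add_left abs_sgn mult.commute)
    ultimately show ?case by blast }
qed

section \<open>Zonoids from integrals over the unit ball\<close>

definition ball_integral :: "('a::euclidean_space \<Rightarrow> real) \<Rightarrow> real" where
  "ball_integral f = (\<integral>x. indicator (cball 0 1) x * f x \<partial>lborel)"

lemma ball_integrable:
  fixes f :: "'a::euclidean_space \<Rightarrow> real"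
  assumes "continuous_on UNIV f"
  shows "integrable lborel (\<lambda>x. indicator (cball 0 1) x * f x)"
  using borel_integrable_compact[OF compact_cball continuous_on_subset[OF assms subset_UNIV], of 0 1]
  by simp

lemma ball_integral_add:
  assumes "continuous_on UNIV f" "continuous_on UNIV g"
  shows "ball_integral (\<lambda>x. f x + g x) = ball_integral f + ball_integral g"
  unfolding ball_integral_def
  using Bochner_Integration.integral_add[OF ball_integrable[OF assms(1)] ball_integrable[OF assms(2)]]
  by (simp only: distrib_left)

lemma ball_integral_cmult: "ball_integral (\<lambda>x. c * f x) = c * ball_integral f"
  unfolding ball_integral_def integral_mult_right_zero[symmetric]
  by (intro Bochner_Integration.integral_cong) auto

text \<open>A Riemann sum of the integral is the support function of a zonotope.\<close>

lemma zonotope_approx: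
  fixes \<rho> :: "'a::euclidean_space \<Rightarrow> real"
  assumes \<rho>: "continuous_on UNIV \<rho>" "\<And>v. norm v \<le> 1 \<Longrightarrow> 0 \<le> \<rho> v" and "0 < \<delta>"
  shows "\<exists>(m::nat) y. \<forall>u. \<bar>(\<Sum>i<m. \<bar>y i \<bullet> u\<bar>) - ball_integral (\<lambda>v. \<rho> v * \<bar>v \<bullet> u\<bar>)\<bar>
           \<le> \<delta> * ball_integral \<rho> * norm u"
proof -
  obtain k where k: "finite k" "cball (0::'a) 1 \<subseteq> (\<Union>x\<in>k. ball x \<delta>)"
    using compact_eq_totally_bounded[of "cball (0::'a) 1"] \<open>0 < \<delta>\<close> by auto
  obtain c and m :: nat where c: "k = c ` {i. i < m}"
    using finite_imp_nat_seg_image_inj_on[OF k(1)] by blast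
  \<comment> \<open>Each point of the unit ball goes to the first covering ball that contains it,
    which makes the cells disjoint.\<close>
  define P where "P i = (cball 0 1 \<inter> ball (c i) \<delta>) - (\<Union>j<i. ball (c j) \<delta>)" for i
  have P_sets: "P i \<in> sets borel" for i unfolding P_def by measurable
  have P_sum: "indicator (cball 0 1) v = (\<Sum>i<m. indicator (P i) v :: real)" for v
  proof (cases "v \<in> cball 0 1")
    case True
    then have "v \<in> (\<Union>x\<in>k. ball x \<delta>)" using k(2) by blast
    then have ex: "\<exists>i<m. v \<in> ball (c i) \<delta>" using c by blast
    define i where "i = (LEAST i. v \<in> ball (c i) \<delta>)"
    have i: "v \<in> ball (c i) \<delta>" "i < m"
      using ex LeastI_ex[of "\<lambda>i. v \<in> ball (c i) \<delta>"] Least_le[of "\<lambda>i. v \<in> ball (c i) \<delta>"]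
      unfolding i_def by (blast, meson le_less_trans)
    have i': "v \<notin> ball (c j) \<delta>" if "j < i" for j using not_less_Least that unfolding i_def by blast
    have "v \<in> P j \<longleftrightarrow> j = i" for j
      using True i(1) i' unfolding P_def by (cases j i rule: linorder_cases) blast+
    then have "(\<Sum>j<m. indicator (P j) v :: real) = (\<Sum>j<m. if j = i then 1 else 0)"
      by (intro sum.cong) (auto simp: indicator_def)
    then show ?thesis using True i(2) by simp
  next
    case False
    then show ?thesis by (simp add: P_def)
  qed
  have int: "integrable lborel (\<lambda>v. indicator (P i) v * (indicator (cball 0 1) v * f v))"
    if "continuous_on UNIV f" for i and f :: "'a \<Rightarrow> real"
    using integrable_mult_indicator[OF _ ball_integrable[OF that], of "P i"] P_sets by simp
  have split: "ball_integral f = (\<Sum>i<m. \<integral>v. indicator (P i) v * (indicator (cball 0 1) v * f v) \<partial>lborel)"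
    if "continuous_on UNIV f" for f
  proof -
    have "indicator (cball 0 1) v * f v = (\<Sum>i<m. indicator (P i) v * (indicator (cball 0 1) v * f v))" for v
    proof -
      have "indicator (cball 0 1) v * f v = indicator (cball 0 1) v * (indicator (cball 0 1) v * f v)"
        by (simp add: indicator_def)
      also have "\<dots> = (\<Sum>i<m. indicator (P i) v) * (indicator (cball 0 1) v * f v)"
        by (rule arg_cong[OF P_sum, of "\<lambda>x. x * (indicator (cball 0 1) v * f v)"])
      finally show ?thesis by (simp only: sum_distrib_right)
    qed
    then have "ball_integral f = (\<integral>v. (\<Sum>i<m. indicator (P i) v * (indicator (cball 0 1) v * f v)) \<partial>lborel)"
      unfolding ball_integral_def by (rule Bochner_Integration.integral_cong[OF refl])
    also have "\<dots> = (\<Sum>i<m. \<integral>v. indicator (P i) v * (indicator (cball 0 1) v * f v) \<partial>lborel)"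
      by (rule Bochner_Integration.integral_sum) (rule int[OF that])
    finally show ?thesis .
  qed
  \<comment> \<open>The mass of \<open>\<rho>\<close> on a cell; the generator is this mass times
    the centre \<open>c i\<close>. Moving \<open>v\<close> to \<open>c i\<close> within the cell
    changes \<open>\<bar>v \<bullet> u\<bar>\<close> by at most
    \<open>\<delta> * norm u\<close>.\<close>
  define w where "w i = (\<integral>v. indicator (P i) v * (indicator (cball 0 1) v * \<rho> v) \<partial>lborel)" for i
  have w0: "0 \<le> w i" for i unfolding w_def using \<rho>(2)
    by (intro integral_nonneg_AE AE_I2) (auto simp: indicator_def)
  have "\<bar>(\<Sum>i<m. \<bar>(w i *\<^sub>R c i) \<bullet> u\<bar>) - ball_integral (\<lambda>v. \<rho> v * \<bar>v \<bullet> u\<bar>)\<bar> \<le> \<delta> * ball_integral \<rho> * norm u" for u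
  proof -
    have cont: "continuous_on UNIV (\<lambda>v. \<rho> v * \<bar>v \<bullet> u\<bar>)" by (intro continuous_intros \<rho>(1))
    let ?I = "\<lambda>i. \<integral>v. indicator (P i) v * (indicator (cball 0 1) v * (\<rho> v * \<bar>v \<bullet> u\<bar>)) \<partial>lborel"
    have one: "\<bar>w i * \<bar>c i \<bullet> u\<bar> - ?I i\<bar> \<le> w i * (\<delta> * norm u)" for i
    proof -
      have "w i * \<bar>c i \<bullet> u\<bar> - ?I i =
        (\<integral>v. indicator (P i) v * (indicator (cball 0 1) v * \<rho> v) * \<bar>c i \<bullet> u\<bar>
            - indicator (P i) v * (indicator (cball 0 1) v * (\<rho> v * \<bar>v \<bullet> u\<bar>)) \<partial>lborel)"
        unfolding w_def using int[OF \<rho>(1), of i] int[OF cont, of i]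
        by (subst Bochner_Integration.integral_diff) (simp_all only: integrable_mult_left integral_mult_left_zero)
      also have "\<bar>\<dots>\<bar> \<le> (\<integral>v. indicator (P i) v * (indicator (cball 0 1) v * \<rho> v) * (\<delta> * norm u) \<partial>lborel)"
      proof (rule order_trans[OF integral_abs_bound], rule integral_mono)
        fix v :: 'a
        show "\<bar>indicator (P i) v * (indicator (cball 0 1) v * \<rho> v) * \<bar>c i \<bullet> u\<bar>
            - indicator (P i) v * (indicator (cball 0 1) v * (\<rho> v * \<bar>v \<bullet> u\<bar>))\<bar>
          \<le> indicator (P i) v * (indicator (cball 0 1) v * \<rho> v) * (\<delta> * norm u)"
        proof (cases "v \<in> P i")
          case True
          then have v: "norm v \<le> 1" "dist (c i) v < \<delta>" by (auto simp: P_def)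
          have "\<bar>\<bar>c i \<bullet> u\<bar> - \<bar>v \<bullet> u\<bar>\<bar> \<le> \<bar>(c i - v) \<bullet> u\<bar>" by (simp add: inner_diff_left)
          also have "\<dots> \<le> norm (c i - v) * norm u" by (rule Cauchy_Schwarz_ineq2)
          also have "\<dots> \<le> \<delta> * norm u" using v(2) by (intro mult_right_mono) (auto simp: dist_norm)
          finally have "\<rho> v * \<bar>\<bar>c i \<bullet> u\<bar> - \<bar>v \<bullet> u\<bar>\<bar> \<le> \<rho> v * (\<delta> * norm u)"
            using \<rho>(2)[OF v(1)] by (rule mult_left_mono)
          moreover have "\<bar>\<rho> v * \<bar>c i \<bullet> u\<bar> - \<rho> v * \<bar>v \<bullet> u\<bar>\<bar> = \<rho> v * \<bar>\<bar>c i \<bullet> u\<bar> - \<bar>v \<bullet> u\<bar>\<bar>"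
            using \<rho>(2)[OF v(1)] by (simp add: abs_mult flip: right_diff_distrib)
          ultimately have "\<bar>\<rho> v * \<bar>c i \<bullet> u\<bar> - \<rho> v * \<bar>v \<bullet> u\<bar>\<bar> \<le> \<rho> v * (\<delta> * norm u)" by simp
          then show ?thesis using True v(1) by simp
        qed simp
      next
        show "integrable lborel (\<lambda>v. \<bar>indicator (P i) v * (indicator (cball 0 1) v * \<rho> v) * \<bar>c i \<bullet> u\<bar>
            - indicator (P i) v * (indicator (cball 0 1) v * (\<rho> v * \<bar>v \<bullet> u\<bar>))\<bar>)"
          by (intro integrable_abs Bochner_Integration.integrable_diff integrable_mult_left int \<rho>(1) cont)
        show "integrable lborel (\<lambda>v. indicator (P i) v * (indicator (cball 0 1) v * \<rho> v) * (\<delta> * norm u))"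
          by (intro integrable_mult_left int \<rho>(1))
      qed
      also have "\<dots> = w i * (\<delta> * norm u)" unfolding w_def by (rule integral_mult_left_zero)
      finally show ?thesis .
    qed
    have "(\<Sum>i<m. \<bar>(w i *\<^sub>R c i) \<bullet> u\<bar>) - ball_integral (\<lambda>v. \<rho> v * \<bar>v \<bullet> u\<bar>)
        = (\<Sum>i<m. w i * \<bar>c i \<bullet> u\<bar> - ?I i)"
      using w0 by (simp add: split[OF cont] abs_mult sum_subtractf)
    also have "\<bar>\<dots>\<bar> \<le> (\<Sum>i<m. w i * (\<delta> * norm u))"
      by (rule order_trans[OF sum_abs]) (intro sum_mono one)
    also have "\<dots> = \<delta> * ball_integral \<rho> * norm u"
      using split[OF \<rho>(1)] by (simp add: w_def sum_distrib_right sum_distrib_left mult_ac)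
    finally show ?thesis .
  qed
  then show ?thesis by (intro exI[of _ m] exI[of _ "\<lambda>i. w i *\<^sub>R c i"] allI)
qed

text \<open>Riemann sums of mesh 1/(n+1) are support functions of zonotopes and differ from
  \<open>h\<close> by at most a fixed multiple of |u|/(n+1), so the Hausdorff distances tend to
  0.\<close>

lemma zonoidI_ball_integral:
  fixes K :: "'a::euclidean_space set"
  assumes K: "convex_body K" "\<And>x u. x \<in> K \<Longrightarrow> x \<bullet> u \<le> h u" "\<And>u. \<exists>p\<in>K. h u \<le> p \<bullet> u"
    and \<rho>: "continuous_on UNIV \<rho>" "\<And>v. norm v \<le> 1 \<Longrightarrow> 0 \<le> \<rho> v"
    and h: "\<And>u. h u = ball_integral (\<lambda>v. \<rho> v * \<bar>v \<bullet> u\<bar>)"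
  shows "zonoid K"
proof -
  let ?M = "ball_integral \<rho>"
  have M: "0 \<le> ?M" unfolding ball_integral_def using \<rho>(2)
    by (intro integral_nonneg_AE AE_I2) (auto simp: indicator_def)
  have "\<exists>(m::nat) y. \<forall>u. \<bar>(\<Sum>i<m. \<bar>y i \<bullet> u\<bar>) - h u\<bar> \<le> inverse (Suc n) * ?M * norm u" for n
    unfolding h using zonotope_approx[OF \<rho>, of "inverse (Suc n)"] by auto
  then obtain m :: "nat \<Rightarrow> nat" and y where
    my: "\<And>n u. \<bar>(\<Sum>i<m n. \<bar>y n i \<bullet> u\<bar>) - h u\<bar> \<le> inverse (Suc n) * ?M * norm u"
    by metis
  define Z where "Z n = (\<Sum>i<m n. seg (y n i))" for n
  have cb: "convex_body (Z n)" for n unfolding Z_def by (intro convex_body_sum convex_body_seg)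
  have le: "hausdorff_distance (Z n) K \<le> inverse (Suc n) * ?M" for n
    by (rule hausdorff_distance_le_support[OF cb _ _ K my])
       (use sum_seg_support M in \<open>auto simp: Z_def\<close>)
  have ge: "0 \<le> hausdorff_distance (Z n) K" for n
    using cb[of n] K(1) by (intro hausdorff_distance_nonneg) (auto simp: convex_body_def compact_imp_bounded)
  have "(\<lambda>n. hausdorff_distance (Z n) K) \<longlonglongrightarrow> 0"
  proof (rule tendsto_sandwich[OF _ _ tendsto_const])
    show "(\<lambda>n. inverse (Suc n) * ?M) \<longlonglongrightarrow> 0"
      using tendsto_mult_right[OF LIMSEQ_inverse_real_of_nat, of ?M] by simp
  qed (use le ge in auto)
  moreover have "zonotope (Z n)" for n unfolding zonotope_def Z_def
    by (intro exI[of _ "m n"] exI[of _ "\<lambda>i. - y n i"] exI[of _ "y n"] refl)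
  ultimately show ?thesis unfolding zonoid_def using K(1) by blast
qed

text \<open>
  The change of variables theorems of HOL-Analysis need a well-ordered index type. Here Fubini applied to
  $\int\!\int 1_A(Tx)\, 1_B(y - Tx)$, with $B$ the unit ball, compares the image measure of \<open>A\<close> with its Lebesgue measure.
\<close>

lemma lborel_distr_orthogonal:
  fixes T :: "'a::euclidean_space \<Rightarrow> 'a"
  assumes T: "orthogonal_transformation T"
  shows "distr lborel borel T = lborel"
proof (rule measure_eqI)
  have [measurable]: "T \<in> borel_measurable borel"
    by (intro borel_measurable_continuous_onI linear_continuous_on
          orthogonal_transformation_linear[OF T, unfolded linear_conv_bounded_linear])
  have refl: "(\<integral>\<^sup>+x. g (w - x) \<partial>lborel) = (\<integral>\<^sup>+x. g x \<partial>lborel)"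
    if "g \<in> borel_measurable borel" for g :: "'a \<Rightarrow> ennreal" and w
  proof -
    have [measurable]: "(-) w \<in> borel_measurable borel" by measurable
    have "(lborel :: 'a measure) = distr lborel borel (\<lambda>x. w - x)"
      using lborel_affine[of "-1" w] by (simp add: density_1)
    then have "(\<integral>\<^sup>+x. g x \<partial>lborel) = (\<integral>\<^sup>+x. g x \<partial>distr lborel borel (\<lambda>x. w - x))" by simp
    also have "\<dots> = (\<integral>\<^sup>+x. g (w - x) \<partial>lborel)" using that by (subst nn_integral_distr) auto
    finally show ?thesis ..
  qed
  have shift: "(\<integral>\<^sup>+y. g (y - x) \<partial>lborel) = (\<integral>\<^sup>+y. g y \<partial>lborel)"
    if [measurable]: "g \<in> borel_measurable borel" for g :: "'a \<Rightarrow> ennreal" and x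
    using refl[of "\<lambda>y. g (- y)" x] refl[of g 0] by (simp add: that)
  fix A :: "'a set" assume "A \<in> sets (distr lborel borel T)"
  then have [measurable]: "A \<in> sets borel" by simp
  have [measurable]: "ball (0::'a) 1 \<in> sets borel" by simp
  let ?B = "ball (0::'a) 1"
  let ?N = "\<lambda>X. (\<integral>\<^sup>+x. indicator X (T x) \<partial>lborel)"
  let ?L = "\<lambda>X. (\<integral>\<^sup>+x. indicator X x \<partial>lborel)"
  have "?N A * ?L ?B = (\<integral>\<^sup>+x. indicator A (T x) * (\<integral>\<^sup>+y. indicator ?B (y - T x) \<partial>lborel) \<partial>lborel)"
    by (subst shift) (simp_all add: nn_integral_multc borel_measurable_indicator)
  also have "\<dots> = (\<integral>\<^sup>+x. \<integral>\<^sup>+y. indicator A (T x) * indicator ?B (y - T x) \<partial>lborel \<partial>lborel)"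
    by (subst nn_integral_cmult) simp_all
  also have "\<dots> = (\<integral>\<^sup>+y. \<integral>\<^sup>+x. indicator A (T x) * indicator ?B (y - T x) \<partial>lborel \<partial>lborel)"
    by (rule lborel_pair.Fubini') measurable
  also have "\<dots> = (\<integral>\<^sup>+y. \<integral>\<^sup>+x. indicator A (y - T x) * indicator ?B (T x) \<partial>lborel \<partial>lborel)"
  proof (rule nn_integral_cong)
    fix y
    \<comment> \<open>Substituting \<open>w - x\<close> for \<open>x\<close>, where
      \<open>T w = y\<close>, exchanges the arguments \<open>T x\<close> and
      \<open>y - T x\<close>.\<close>
    obtain w where w: "T w = y" using orthogonal_transformation_surj[OF T] by (metis surjD)
    have "T (w - x) = y - T x" for x
      using linear_diff[OF orthogonal_transformation_linear[OF T]] w by simp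
    then show "(\<integral>\<^sup>+x. indicator A (T x) * indicator ?B (y - T x) \<partial>lborel)
        = (\<integral>\<^sup>+x. indicator A (y - T x) * indicator ?B (T x) \<partial>lborel)"
      using refl[of "\<lambda>x. indicator A (T x) * indicator ?B (y - T x)" w] by simp
  qed
  also have "\<dots> = (\<integral>\<^sup>+x. \<integral>\<^sup>+y. indicator A (y - T x) * indicator ?B (T x) \<partial>lborel \<partial>lborel)"
    by (rule lborel_pair.Fubini') measurable
  also have "\<dots> = (\<integral>\<^sup>+x. ?L A * indicator ?B (T x) \<partial>lborel)"
    by (subst nn_integral_multc, simp, subst shift) simp_all
  also have "\<dots> = ?L A * ?N ?B"
    by (subst nn_integral_cmult) simp_all
  also have "?N ?B = ?L ?B"
    using T by (intro nn_integral_cong) (simp add: indicator_def orthogonal_transformation_norm)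
  finally have eq: "?N A * ?L ?B = ?L A * ?L ?B" .
  have "?L ?B = emeasure lborel ?B" by simp
  then have "?L ?B \<noteq> 0" "?L ?B \<noteq> \<infinity>"
    using emeasure_ball[of 1 "0::'a"] unit_ball_vol_pos[of "real DIM('a)"] by (auto simp del: unit_ball_vol_pos)
  moreover have "?L ?B * ?N A = ?L ?B * ?L A" using eq by (simp only: mult.commute)
  ultimately have "?N A = ?L A" unfolding ennreal_mult_cancel_left infinity_ennreal_def by blast
  moreover have "?N A = emeasure (distr lborel borel T) A"
    by (subst nn_integral_distr[symmetric, where M' = borel]) simp_all
  ultimately show "emeasure (distr lborel borel T) A = emeasure lborel A" by simp
qed simp

lemma ball_integral_orthogonal:
  fixes T :: "'a::euclidean_space \<Rightarrow> 'a"
  assumes T: "orthogonal_transformation T" and f: "continuous_on UNIV f"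
  shows "ball_integral (\<lambda>x. f (T x)) = ball_integral f"
proof -
  have [measurable]: "T \<in> borel_measurable borel" "f \<in> borel_measurable borel"
    by (intro borel_measurable_continuous_onI linear_continuous_on f
          orthogonal_transformation_linear[OF T, unfolded linear_conv_bounded_linear])+
  have "ball_integral f = (\<integral>x. indicator (cball 0 1) x * f x \<partial>distr lborel borel T)"
    by (simp add: ball_integral_def lborel_distr_orthogonal[OF T])
  also have "\<dots> = (\<integral>x. indicator (cball 0 1) (T x) * f (T x) \<partial>lborel)"
    by (rule integral_distr) (simp_all add: borel_measurable_indicator borel_measurable_times)
  also have "\<dots> = ball_integral (\<lambda>x. f (T x))"
    unfolding ball_integral_def using T
    by (intro Bochner_Integration.integral_cong) (simp_all add: indicator_def orthogonal_transformation_norm)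
  finally show ?thesis ..
qed

lemma ball_integral_pos:
  fixes f :: "'a::euclidean_space \<Rightarrow> real"
  assumes f: "continuous_on UNIV f" "\<And>x. 0 \<le> f x" and x0: "norm x0 < 1" "0 < f x0"
  shows "0 < ball_integral f"
proof -
  have "isCont f x0" using f(1) continuous_on_eq_continuous_at[OF open_UNIV] by blast
  then have "\<forall>\<^sub>F x in at x0. f x0 / 2 < f x"
    using x0(2) by (intro order_tendstoD(1)[of f "f x0"]) (auto simp: isCont_def)
  then obtain d where d: "d > 0" "\<And>x. x \<noteq> x0 \<Longrightarrow> dist x x0 < d \<Longrightarrow> f x0 / 2 < f x"
    by (auto simp: eventually_at)
  define e where "e = min d (1 - norm x0)"
  have e: "0 < e" using d(1) x0(1) by (simp add: e_def)
  have sub: "x \<in> cball 0 1 \<and> f x0 / 2 \<le> f x" if "x \<in> ball x0 e" for x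
  proof
    have x: "dist x x0 < d" "dist x x0 < 1 - norm x0"
      using that by (auto simp: e_def dist_commute)
    then show "x \<in> cball 0 1" using norm_triangle_ineq2[of x x0] by (simp add: dist_norm)
    show "f x0 / 2 \<le> f x" using d(2)[of x] x x0(2) by (cases "x = x0") auto
  qed
  have "0 < measure lborel (ball x0 e) * (f x0 / 2)" using e x0(2) by (simp add: )
  also have "\<dots> = (\<integral>x. indicator (ball x0 e) x * (f x0 / 2) \<partial>lborel)"
    by simp
  also have "\<dots> \<le> ball_integral f"
    unfolding ball_integral_def
  proof (rule integral_mono)
    show "integrable lborel (\<lambda>x. indicator (ball x0 e) x * (f x0 / 2))"
      using emeasure_lborel_ball_finite[of x0 e] by (intro integrable_mult_left) simp
    show "integrable lborel (\<lambda>x. indicator (cball 0 1) x * f x)" by (rule ball_integrable[OF f(1)])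
    fix x show "indicator (ball x0 e) x * (f x0 / 2) \<le> indicator (cball 0 1) x * f x"
      using sub[of x] f(2)[of x] by (cases "x \<in> ball x0 e") (auto simp: indicator_def)
  qed
  finally show ?thesis .
qed

section \<open>Reflections and moments over the ball\<close>

text \<open>The reflection in the hyperplane orthogonal to \<open>d\<close>. For
  \<open>d = 0\<close> it is the identity by the convention on division by zero, so
  \<open>householder_swap\<close> also covers equal vectors.\<close>

definition householder :: "'a::euclidean_space \<Rightarrow> 'a \<Rightarrow> 'a" where
  "householder d x = x - (2 * (x \<bullet> d) / (d \<bullet> d)) *\<^sub>R d"

lemma orthogonal_householder: "orthogonal_transformation (householder d)"
proof (cases "d = 0")
  case False
  then have "d \<bullet> d \<noteq> 0" by simp
  then have "householder d x \<bullet> householder d y = x \<bullet> y" for x y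
    unfolding householder_def
    by (simp add: inner_diff_left inner_diff_right inner_commute field_simps)
  moreover have "linear (householder d)"
    unfolding householder_def
    by (intro linearI) (auto simp: inner_add_left scaleR_left_distrib algebra_simps add_divide_distrib)
  ultimately show ?thesis by (simp add: orthogonal_transformation_def)
qed (simp add: householder_def[abs_def])

lemma householder_swap:
  assumes "norm a = norm b"
  shows "householder (a - b) a = b"
proof (cases "a = b")
  case False
  have "a \<bullet> a = b \<bullet> b" using assms by (simp add: dot_square_norm)
  then have "2 * (a \<bullet> (a - b)) = (a - b) \<bullet> (a - b)"
    by (simp add: inner_diff_left inner_diff_right inner_commute)
  then show ?thesis using False by (simp add: householder_def)
qed (simp add: householder_def)

lemma householder_fixes: "x \<bullet> d = 0 \<Longrightarrow> householder d x = x"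
  by (simp add: householder_def)

text \<open>Two reflections carry one orthonormal pair to the other: the first takes
  \<open>u\<close> to \<open>u'\<close>, the second takes the image of \<open>w\<close> to
  \<open>w'\<close> and fixes \<open>u'\<close>, since both of these vectors are orthogonal to
  \<open>u'\<close>.\<close>

lemma ball_integral_pair_cong:
  fixes u w u' w' :: "'a::euclidean_space" and \<phi> :: "real \<Rightarrow> real \<Rightarrow> real"
  assumes uw: "norm u = 1" "norm w = 1" "u \<bullet> w = 0" and uw': "norm u' = 1" "norm w' = 1" "u' \<bullet> w' = 0"
    and \<phi>: "continuous_on UNIV (\<lambda>p. \<phi> (fst p) (snd p))"
  shows "ball_integral (\<lambda>v. \<phi> (v \<bullet> u) (v \<bullet> w)) = ball_integral (\<lambda>v. \<phi> (v \<bullet> u') (v \<bullet> w'))"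
proof -
  define S where "S = householder (u - u')"
  have S: "orthogonal_transformation S" "S u = u'"
    unfolding S_def using uw uw' by (auto simp: orthogonal_householder householder_swap)
  have "norm (S w) = 1" using S(1) uw(2) by (simp add: orthogonal_transformation_norm)
  have "u' \<bullet> S w = 0" using S uw(3) unfolding orthogonal_transformation_def by metis
  define T where "T = householder (S w - w')"
  have T: "orthogonal_transformation T" "T (S w) = w'" "T u' = u'"
    unfolding T_def using uw' \<open>norm (S w) = 1\<close> \<open>u' \<bullet> S w = 0\<close>
    by (auto simp: orthogonal_householder householder_swap householder_fixes inner_diff_right)
  have cont: "continuous_on UNIV (\<lambda>v. \<phi> (v \<bullet> a) (v \<bullet> b))" for a b :: 'a
    using continuous_on_compose2[OF \<phi>, of UNIV "\<lambda>v. (v \<bullet> a, v \<bullet> b)"] by (simp add: continuous_intros)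
  have "ball_integral (\<lambda>v. \<phi> (v \<bullet> u') (v \<bullet> w')) = ball_integral (\<lambda>v. \<phi> (T v \<bullet> u') (T v \<bullet> w'))"
    by (rule ball_integral_orthogonal[OF T(1) cont, symmetric])
  also have "\<dots> = ball_integral (\<lambda>v. \<phi> (v \<bullet> u') (v \<bullet> S w))"
    using T unfolding orthogonal_transformation_def by metis
  also have "\<dots> = ball_integral (\<lambda>v. \<phi> (S v \<bullet> u') (S v \<bullet> S w))"
    by (rule ball_integral_orthogonal[OF S(1) cont, symmetric])
  also have "\<dots> = ball_integral (\<lambda>v. \<phi> (v \<bullet> u) (v \<bullet> w))"
    using S unfolding orthogonal_transformation_def by metis
  finally show ?thesis ..
qed

lemma ex_orthogonal_unit:
  assumes "2 \<le> DIM('a)" "norm (u::'a::euclidean_space) = 1"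
  shows "\<exists>w::'a. norm w = 1 \<and> u \<bullet> w = 0"
proof -
  obtain x where x: "x \<noteq> 0" "orthogonal u x" using orthogonal_to_vector_exists[OF assms(1)] by blast
  then show ?thesis by (intro exI[of _ "sgn x"]) (simp add: norm_sgn orthogonal_def sgn_div_norm)
qed

text \<open>
  Split \<open>e\<close> into its components along and orthogonal to \<open>u\<close>; the mixed term vanishes under the
  reflection of \<open>u\<close>, and the other two integrals do not depend on the direction of \<open>u\<close>.
\<close>

lemma ball_integral_quadratic:
  fixes e :: "'a::euclidean_space"
  assumes dim: "2 \<le> DIM('a)" and e: "norm e = 1"
  obtains a c d where "0 < a" "0 < d"
    "\<And>u::'a. ball_integral (\<lambda>v. \<bar>v \<bullet> u\<bar>) = a * norm u"
    "\<And>u. ball_integral (\<lambda>v. (v \<bullet> e)\<^sup>2 * \<bar>v \<bullet> u\<bar>) = c * norm u + d * ((u \<bullet> e)\<^sup>2 / norm u)"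
proof -
  obtain f where f: "norm f = 1" "e \<bullet> f = 0" using ex_orthogonal_unit[OF dim e] by blast
  define a where "a = ball_integral (\<lambda>v. \<bar>v \<bullet> e\<bar>)"
  define b where "b = ball_integral (\<lambda>v. \<bar>v \<bullet> e\<bar> * (v \<bullet> e)\<^sup>2)"
  define c where "c = ball_integral (\<lambda>v. \<bar>v \<bullet> e\<bar> * (v \<bullet> f)\<^sup>2)"
  note pc = ball_integral_pair_cong[OF _ _ _ e f]
  \<comment> \<open>A common test point for the two strict inequalities below.\<close>
  have half: "norm ((1/2) *\<^sub>R e) < 1" "\<bar>((1/2) *\<^sub>R e) \<bullet> e\<bar> > 0" "((1/2) *\<^sub>R e) \<bullet> f = 0"
    using e f by (auto simp: dot_square_norm)
  have a: "0 < a" unfolding a_def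
    by (rule ball_integral_pos[OF _ _ half(1)]) (use half in \<open>auto intro!: continuous_intros\<close>)
  \<comment> \<open>Symmetrising in \<open>e\<close> and \<open>f\<close> turns twice the difference
    into the integral of (|x| - |y|)^2 (|x| + |y|), where x and y are the two coordinates.\<close>
  have bc: "0 < b - c"
  proof -
    have c': "c = ball_integral (\<lambda>v. \<bar>v \<bullet> f\<bar> * (v \<bullet> e)\<^sup>2)" unfolding c_def
      by (rule pc[of f e "\<lambda>x y. \<bar>x\<bar> * y\<^sup>2", symmetric])
         (use e f in \<open>auto simp: inner_commute intro!: continuous_intros\<close>)
    have b': "b = ball_integral (\<lambda>v. \<bar>v \<bullet> f\<bar> * (v \<bullet> f)\<^sup>2)" unfolding b_def
      by (rule pc[of f e "\<lambda>x y. \<bar>x\<bar> * x\<^sup>2", symmetric])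
         (use e f in \<open>auto simp: inner_commute intro!: continuous_intros\<close>)
    have "(b + (-1) * c) + (b + (-1) * c) = ball_integral (\<lambda>v. (\<bar>v \<bullet> e\<bar> * (v \<bullet> e)\<^sup>2 + (-1) * (\<bar>v \<bullet> e\<bar> * (v \<bullet> f)\<^sup>2))
        + (\<bar>v \<bullet> f\<bar> * (v \<bullet> f)\<^sup>2 + (-1) * (\<bar>v \<bullet> f\<bar> * (v \<bullet> e)\<^sup>2)))"
      apply (subst ball_integral_add, (intro continuous_intros)+)+
      unfolding ball_integral_cmult b_def[symmetric] c_def[symmetric] b'[symmetric] c'[symmetric] ..
    also have "\<dots> = ball_integral (\<lambda>v. (\<bar>v \<bullet> e\<bar> - \<bar>v \<bullet> f\<bar>)\<^sup>2 * (\<bar>v \<bullet> e\<bar> + \<bar>v \<bullet> f\<bar>))"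
      by (rule arg_cong[of _ _ ball_integral], rule ext)
         (simp add: abs_if power2_eq_square algebra_simps)
    also have "0 < \<dots>"
      by (rule ball_integral_pos[OF _ _ half(1)]) (use half in \<open>auto intro!: continuous_intros\<close>)
    finally show ?thesis by simp
  qed
  have norm1: "ball_integral (\<lambda>v. \<bar>v \<bullet> u\<bar>) = a \<and>
      ball_integral (\<lambda>v. (v \<bullet> e)\<^sup>2 * \<bar>v \<bullet> u\<bar>) = c + (b - c) * (u \<bullet> e)\<^sup>2" if u: "norm u = 1" for u
  proof -
    define p where "p = u \<bullet> e"
    define r where "r = e - p *\<^sub>R u"
    have uu: "u \<bullet> u = 1" "e \<bullet> e = 1" using u e by (simp_all add: dot_square_norm)
    have ru: "u \<bullet> r = 0" unfolding r_def by (simp add: inner_diff_right uu p_def)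
    obtain w q where w: "norm w = 1" "u \<bullet> w = 0" "r = q *\<^sub>R w"
    proof (cases "r = 0")
      case True
      then show ?thesis using ex_orthogonal_unit[OF dim u] that[of _ 0] by auto
    next
      case False
      then show ?thesis using that[of "sgn r" "norm r"] ru by (simp add: norm_sgn sgn_div_norm)
    qed
    have eq: "e = p *\<^sub>R u + q *\<^sub>R w" using w(3) by (simp add: r_def diff_eq_eq add.commute)
    have "e \<bullet> e = p\<^sup>2 + q\<^sup>2"
    proof -
      have "w \<bullet> w = 1" using w(1) by (simp add: dot_square_norm)
      then have "(p *\<^sub>R u + q *\<^sub>R w) \<bullet> (p *\<^sub>R u + q *\<^sub>R w) = p\<^sup>2 + q\<^sup>2"
        using w(2) uu
        by (simp add: inner_add_left inner_add_right inner_commute[of w u] power2_eq_square del: dot_square_norm)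
      then show ?thesis by (simp flip: eq)
    qed
    then have pq: "q\<^sup>2 = 1 - p\<^sup>2" using uu by simp
    have "ball_integral (\<lambda>v. \<bar>v \<bullet> u\<bar>) = a" unfolding a_def
      by (rule pc[of u w "\<lambda>x y. \<bar>x\<bar>"]) (use u w in \<open>auto intro!: continuous_intros\<close>)
    moreover have "ball_integral (\<lambda>v. (v \<bullet> e)\<^sup>2 * \<bar>v \<bullet> u\<bar>) = c + (b - c) * p\<^sup>2"
    proof -
      have 1: "ball_integral (\<lambda>v. \<bar>v \<bullet> u\<bar> * (v \<bullet> u)\<^sup>2) = b" unfolding b_def
        by (rule pc[of u w "\<lambda>x y. \<bar>x\<bar> * x\<^sup>2"]) (use u w in \<open>auto intro!: continuous_intros\<close>)
      have 2: "ball_integral (\<lambda>v. \<bar>v \<bullet> u\<bar> * (v \<bullet> w)\<^sup>2) = c" unfolding c_def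
        by (rule pc[of u w "\<lambda>x y. \<bar>x\<bar> * y\<^sup>2"]) (use u w in \<open>auto intro!: continuous_intros\<close>)
      have "ball_integral (\<lambda>v. \<bar>v \<bullet> u\<bar> * (v \<bullet> u) * (v \<bullet> w))
          = ball_integral (\<lambda>v. \<bar>v \<bullet> (- u)\<bar> * (v \<bullet> (- u)) * (v \<bullet> w))"
        by (rule ball_integral_pair_cong[of u w "- u" w "\<lambda>x y. \<bar>x\<bar> * x * y"])
           (use u w in \<open>auto intro!: continuous_intros\<close>)
      also have "\<dots> = ball_integral (\<lambda>v. (-1) * (\<bar>v \<bullet> u\<bar> * (v \<bullet> u) * (v \<bullet> w)))" by simp
      also have "\<dots> = (-1) * ball_integral (\<lambda>v. \<bar>v \<bullet> u\<bar> * (v \<bullet> u) * (v \<bullet> w))"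
        by (rule ball_integral_cmult)
      finally have 3: "ball_integral (\<lambda>v. \<bar>v \<bullet> u\<bar> * (v \<bullet> u) * (v \<bullet> w)) = 0" by simp
      have "ball_integral (\<lambda>v. (v \<bullet> e)\<^sup>2 * \<bar>v \<bullet> u\<bar>) = ball_integral (\<lambda>v. p\<^sup>2 * (\<bar>v \<bullet> u\<bar> * (v \<bullet> u)\<^sup>2)
          + (q\<^sup>2 * (\<bar>v \<bullet> u\<bar> * (v \<bullet> w)\<^sup>2) + (2 * p * q) * (\<bar>v \<bullet> u\<bar> * (v \<bullet> u) * (v \<bullet> w))))"
        by (rule arg_cong[of _ _ ball_integral], rule ext)
           (subst eq, simp add: inner_add_right power2_eq_square algebra_simps)
      also have "\<dots> = p\<^sup>2 * b + (q\<^sup>2 * c + (2 * p * q) * 0)"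
        apply (subst ball_integral_add, (intro continuous_intros)+)+
        unfolding ball_integral_cmult 1 2 3 ..
      finally show ?thesis by (simp add: pq algebra_simps)
    qed
    ultimately show ?thesis by (simp add: p_def)
  qed
  have final: "ball_integral (\<lambda>v. \<bar>v \<bullet> u\<bar>) = a * norm u \<and>
      ball_integral (\<lambda>v. (v \<bullet> e)\<^sup>2 * \<bar>v \<bullet> u\<bar>) = c * norm u + (b - c) * ((u \<bullet> e)\<^sup>2 / norm u)" for u
  proof (cases "u = 0")
    case True
    then show ?thesis by (simp add: ball_integral_def)
  next
    case False
    have un: "\<bar>v \<bullet> u\<bar> = norm u * \<bar>v \<bullet> sgn u\<bar>" for v
      using False by (simp add: sgn_div_norm abs_mult)
    have "ball_integral (\<lambda>v. \<bar>v \<bullet> u\<bar>) = norm u * ball_integral (\<lambda>v. \<bar>v \<bullet> sgn u\<bar>)"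
      unfolding un by (rule ball_integral_cmult)
    moreover have "ball_integral (\<lambda>v. (v \<bullet> e)\<^sup>2 * \<bar>v \<bullet> u\<bar>) = norm u * ball_integral (\<lambda>v. (v \<bullet> e)\<^sup>2 * \<bar>v \<bullet> sgn u\<bar>)"
      unfolding un ball_integral_cmult[symmetric] by (simp add: mult_ac)
    moreover have "norm (sgn u) = 1" using False by (simp add: norm_sgn)
    ultimately show ?thesis using norm1[of "sgn u"] False
      by (simp add: sgn_div_norm field_simps power2_eq_square)
  qed
  show ?thesis
  proof (rule that[of a "b - c" c])
    fix u :: 'a
    show "ball_integral (\<lambda>v. \<bar>v \<bullet> u\<bar>) = a * norm u" using final[of u] by (rule conjunct1)
    show "ball_integral (\<lambda>v. (v \<bullet> e)\<^sup>2 * \<bar>v \<bullet> u\<bar>) = c * norm u + (b - c) * ((u \<bullet> e)\<^sup>2 / norm u)"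
      using final[of u] by (rule conjunct2)
  qed (use a bc in simp_all)
qed

section \<open>Bodies of revolution\<close>

text \<open>On unit vectors this is a + b s^2, with s the cosine of the angle to the axis, extended
  to be positively homogeneous. At \<open>u = 0\<close> the quotient is 0, as a support function
  demands.\<close>

definition support_rev :: "'a::euclidean_space \<Rightarrow> real \<Rightarrow> real \<Rightarrow> 'a \<Rightarrow> real" where
  "support_rev e a b u = a * norm u + b * ((u \<bullet> e)\<^sup>2 / norm u)"

definition rev_body :: "'a::euclidean_space \<Rightarrow> real \<Rightarrow> real \<Rightarrow> 'a set" where
  "rev_body e a b = {x. \<forall>u. x \<bullet> u \<le> support_rev e a b u}"

text \<open>
  The boundary point of \<open>rev_body e a b\<close> whose outer normal makes an angle with cosine \<open>s\<close>
  with \<open>e\<close> has height \<open>height a b s\<close> and distance \<open>radius a b s\<close> from the axis.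
\<close>

definition height :: "real \<Rightarrow> real \<Rightarrow> real \<Rightarrow> real" where
  "height a b s = s * (a + 2 * b - b * s\<^sup>2)"

definition radius :: "real \<Rightarrow> real \<Rightarrow> real \<Rightarrow> real" where
  "radius a b s = sqrt (1 - s\<^sup>2) * (a - b * s\<^sup>2)"

lemma abs_mult_sq_le:
  fixes b s :: real assumes "\<bar>s\<bar> \<le> 1" shows "\<bar>b * s\<^sup>2\<bar> \<le> \<bar>b\<bar>"
proof -
  have "s\<^sup>2 \<le> 1" using assms by (simp add: abs_square_le_1)
  then show ?thesis by (simp add: abs_mult mult_left_le)
qed

text \<open>The gap is b (\<sigma> - s)^2 + (a - b s^2) t, where t is one minus the cosine of the
  angle between the two unit normals, and (\<sigma> - s)^2 \<le> 2 t. For negative \<open>b\<close>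
  the second term wins because a - b s^2 \<ge> -2 b.\<close>

lemma profile_support_le:
  assumes s: "\<bar>s\<bar> \<le> 1" and \<sigma>: "\<bar>\<sigma>\<bar> \<le> 1" and ab: "2 * \<bar>b\<bar> \<le> a"
  shows "height a b s * \<sigma> + radius a b s * sqrt (1 - \<sigma>\<^sup>2) \<le> a + b * \<sigma>\<^sup>2"
proof -
  define p where "p = sqrt (1 - s\<^sup>2)"
  define q where "q = sqrt (1 - \<sigma>\<^sup>2)"
  have pq: "p\<^sup>2 = 1 - s\<^sup>2" "q\<^sup>2 = 1 - \<sigma>\<^sup>2"
    using s \<sigma> by (simp_all add: p_def q_def abs_square_le_1)
  define t where "t = 1 - \<sigma> * s - p * q"
  have "(\<sigma> - s)\<^sup>2 + (p - q)\<^sup>2 = 2 * t"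
    using pq by (simp add: t_def power2_diff algebra_simps)
  then have t: "(\<sigma> - s)\<^sup>2 \<le> 2 * t" using zero_le_power2[of "p - q"] by linarith
  have eq: "a + b * \<sigma>\<^sup>2 - (height a b s * \<sigma> + radius a b s * q) = b * (\<sigma> - s)\<^sup>2 + (a - b * s\<^sup>2) * t"
    unfolding height_def radius_def p_def[symmetric] t_def by (simp add: power2_eq_square algebra_simps)
  have t0: "0 \<le> t" using t zero_le_power2[of "\<sigma> - s"] by linarith
  have "0 \<le> b * (\<sigma> - s)\<^sup>2 + (a - b * s\<^sup>2) * t"
  proof (cases "0 \<le> b")
    case True
    then show ?thesis using abs_mult_sq_le[OF s, of b] ab t0 by simp
  next
    case False
    have "(-b) * (\<sigma> - s)\<^sup>2 \<le> (-b) * (2 * t)" using False t by (intro mult_left_mono) auto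
    also have "\<dots> = (- 2 * b) * t" by simp
    also have "\<dots> \<le> (a - b * s\<^sup>2) * t"
      using False ab t0 mult_nonneg_nonneg[of "-b" "s\<^sup>2"] by (intro mult_right_mono) auto
    finally show ?thesis by simp
  qed
  with eq show ?thesis by (simp add: q_def)
qed

locale unit_axis =
  fixes e :: "'a::euclidean_space"
  assumes e: "norm e = 1"
begin

lemma ee: "e \<bullet> e = 1"
  using e by (simp add: dot_square_norm)

definition perp :: "'a \<Rightarrow> 'a" where "perp x = x - (x \<bullet> e) *\<^sub>R e"

lemma perp_e [simp]: "perp x \<bullet> e = 0" "e \<bullet> perp x = 0"
  by (simp_all add: perp_def inner_diff_left inner_diff_right ee inner_commute)

lemma inner_decomp: "x \<bullet> u = (x \<bullet> e) * (u \<bullet> e) + perp x \<bullet> perp u"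
  by (simp add: perp_def inner_diff_left inner_diff_right ee inner_commute)

lemma norm_perp: "(norm (perp u))\<^sup>2 = (norm u)\<^sup>2 - (u \<bullet> e)\<^sup>2"
  using inner_decomp[of u u] by (simp add: dot_square_norm power2_eq_square)

text \<open>Cauchy-Schwarz in the hyperplane orthogonal to \<open>e\<close> reduces the claim to the
  planar inequality \<open>profile_support_le\<close>, with \<open>\<sigma>\<close> the cosine of
  the angle between \<open>u\<close> and \<open>e\<close>.\<close>

lemma rev_bodyI:
  assumes ab: "2 * \<bar>b\<bar> \<le> a" and s: "\<bar>s\<bar> \<le> 1"
    and x: "x \<bullet> e = height a b s" "norm (perp x) \<le> radius a b s"
  shows "x \<in> rev_body e a b"
  unfolding rev_body_def
proof (intro CollectI allI)
  fix u
  show "x \<bullet> u \<le> support_rev e a b u"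
  proof (cases "u = 0")
    case False
    define \<sigma> where "\<sigma> = (u \<bullet> e) / norm u"
    have \<sigma>: "\<bar>\<sigma>\<bar> \<le> 1"
      using Cauchy_Schwarz_ineq2[of u e] e False by (simp add: \<sigma>_def divide_le_eq_1)
    have ue: "u \<bullet> e = norm u * \<sigma>" using False by (simp add: \<sigma>_def)
    have "(norm (perp u))\<^sup>2 = (norm u * sqrt (1 - \<sigma>\<^sup>2))\<^sup>2"
      using \<sigma> by (simp add: norm_perp ue power_mult_distrib abs_square_le_1 algebra_simps)
    then have pu: "norm (perp u) = norm u * sqrt (1 - \<sigma>\<^sup>2)"
      using \<sigma> by (simp add: power2_eq_iff_nonneg abs_square_le_1)
    have "perp x \<bullet> perp u \<le> norm (perp x) * norm (perp u)" by (rule norm_cauchy_schwarz)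
    also have "\<dots> \<le> radius a b s * norm (perp u)" by (intro mult_right_mono x) auto
    finally have "x \<bullet> u \<le> norm u * (height a b s * \<sigma> + radius a b s * sqrt (1 - \<sigma>\<^sup>2))"
      unfolding inner_decomp[of x u] x(1) ue pu by (simp add: algebra_simps)
    also have "\<dots> \<le> norm u * (a + b * \<sigma>\<^sup>2)"
      by (intro mult_left_mono profile_support_le s \<sigma> ab) auto
    also have "\<dots> = support_rev e a b u"
      using False by (simp add: support_rev_def ue power2_eq_square algebra_simps)
    finally show ?thesis .
  qed (simp add: support_rev_def)
qed

lemma rev_body_attains:
  assumes ab: "2 * \<bar>b\<bar> \<le> a"
  shows "\<exists>p\<in>rev_body e a b. support_rev e a b u \<le> p \<bullet> u"
proof (cases "u = 0")
  case True
  have "0 \<in> rev_body e a b"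
    by (rule rev_bodyI[OF ab, of 0]) (use ab in \<open>auto simp: height_def radius_def perp_def\<close>)
  then show ?thesis using True by (intro bexI[of _ 0]) (simp_all add: support_rev_def)
next
  case False
  define s where "s = (u \<bullet> e) / norm u"
  have s: "\<bar>s\<bar> \<le> 1"
    using Cauchy_Schwarz_ineq2[of u e] e False by (simp add: s_def divide_le_eq_1)
  have ue: "u \<bullet> e = norm u * s" using False by (simp add: s_def)
  \<comment> \<open>The gradient of the support function at \<open>u\<close>, split along and
    orthogonal to the axis.\<close>
  define p where "p = height a b s *\<^sub>R e + ((a - b * s\<^sup>2) / norm u) *\<^sub>R perp u"
  have pe: "p \<bullet> e = height a b s" by (simp add: p_def inner_add_left ee)
  then have pp: "perp p = ((a - b * s\<^sup>2) / norm u) *\<^sub>R perp u"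
    unfolding perp_def[of p] pe by (simp add: p_def)
  have nu: "(norm (perp u))\<^sup>2 = (norm u)\<^sup>2 * (1 - s\<^sup>2)"
    by (simp add: norm_perp ue power_mult_distrib algebra_simps)
  have "norm (perp u) = sqrt ((norm (perp u))\<^sup>2)" by simp
  also have "\<dots> = norm u * sqrt (1 - s\<^sup>2)" unfolding nu by (simp add: real_sqrt_mult)
  finally have "norm (perp u) = norm u * sqrt (1 - s\<^sup>2)" .
  moreover have "0 \<le> a - b * s\<^sup>2" using abs_mult_sq_le[OF s, of b] ab by linarith
  ultimately have "norm (perp p) = radius a b s" using False by (simp add: pp radius_def)
  then have "p \<in> rev_body e a b" using rev_bodyI[OF ab s pe] by simp
  moreover have "p \<bullet> u = height a b s * (norm u * s) + ((a - b * s\<^sup>2) / norm u) * ((norm u)\<^sup>2 * (1 - s\<^sup>2))"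
    unfolding inner_decomp[of p u] pe pp ue by (simp add: dot_square_norm nu)
  then have "p \<bullet> u = norm u * (height a b s * s + (a - b * s\<^sup>2) * (1 - s\<^sup>2))"
  proof -
    have "(a - b * s\<^sup>2) / norm u * ((norm u)\<^sup>2 * (1 - s\<^sup>2)) = norm u * ((a - b * s\<^sup>2) * (1 - s\<^sup>2))"
      using False by (simp add: power2_eq_square)
    with \<open>p \<bullet> u = _\<close> show ?thesis by (simp only: distrib_left mult_ac)
  qed
  moreover have "height a b s * s + (a - b * s\<^sup>2) * (1 - s\<^sup>2) = a + b * s\<^sup>2"
    by (simp add: height_def power2_eq_square algebra_simps)
  moreover have "support_rev e a b u = norm u * (a + b * s\<^sup>2)"
    using False by (simp add: support_rev_def ue power2_eq_square algebra_simps)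
  ultimately show ?thesis by (intro bexI[of _ p]) simp_all
qed

lemma rev_body_radius:
  assumes ab: "2 * \<bar>b\<bar> \<le> a" and s: "\<bar>s\<bar> < 1" and x: "x \<in> rev_body e a b" "x \<bullet> e = height a b s"
  shows "norm (perp x) \<le> radius a b s"
proof (cases "perp x = 0")
  case True
  have "0 \<le> a - b * s\<^sup>2" using abs_mult_sq_le[of s b] s ab by linarith
  then show ?thesis using True s by (simp add: radius_def abs_square_le_1)
next
  case False
  define c where "c = sqrt (1 - s\<^sup>2)"
  have c: "c > 0" "c\<^sup>2 = 1 - s\<^sup>2" using s by (auto simp: c_def abs_square_less_1 abs_square_le_1)
  \<comment> \<open>The outer normal at parameter \<open>s\<close>, turned towards \<open>x\<close>.
    Its constraint is the radius bound multiplied by \<open>c\<close>, and \<open>c\<close> is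
    positive because \<open>\<bar>s\<bar> < 1\<close>.\<close>
  define u where "u = s *\<^sub>R e + c *\<^sub>R sgn (perp x)"
  have sg: "sgn (perp x) \<bullet> sgn (perp x) = 1" "sgn (perp x) \<bullet> e = 0" "e \<bullet> sgn (perp x) = 0"
    using False by (simp_all add: dot_square_norm norm_sgn) (simp_all add: sgn_div_norm)
  have "u \<bullet> u = 1"
    using c(2) by (simp add: u_def inner_add_left inner_add_right ee sg power2_eq_square)
  then have nu: "norm u = 1" by (simp add: norm_eq_1)
  have ue: "u \<bullet> e = s" by (simp add: u_def inner_add_left ee sg)
  have "perp x \<bullet> sgn (perp x) = norm (perp x)"
    using False by (simp add: sgn_div_norm dot_square_norm power2_eq_square)
  then have "perp x \<bullet> perp u = c * norm (perp x)"
    by (simp add: perp_def[of u] ue inner_diff_right) (simp add: u_def inner_add_right)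
  then have "x \<bullet> u = height a b s * s + c * norm (perp x)"
    using inner_decomp[of x u] x(2) ue by simp
  moreover have "x \<bullet> u \<le> a + b * s\<^sup>2" using x(1) by (auto simp: rev_body_def support_rev_def nu ue dest: spec[of _ u])
  ultimately have "c * norm (perp x) \<le> a + b * s\<^sup>2 - height a b s * s" by linarith
  also have "\<dots> = c * radius a b s"
  proof -
    have "c * radius a b s = c\<^sup>2 * (a - b * s\<^sup>2)"
      unfolding radius_def c_def[symmetric] by (simp add: power2_eq_square)
    moreover have "a + b * s\<^sup>2 - height a b s * s = (1 - s\<^sup>2) * (a - b * s\<^sup>2)"
      by (simp add: height_def power2_eq_square algebra_simps)
    ultimately show ?thesis by (simp add: c(2))
  qed
  finally show ?thesis using c(1) by simp
qed

lemma rev_body_height: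
  assumes "x \<in> rev_body e a b" shows "\<bar>x \<bullet> e\<bar> \<le> a + b"
proof -
  have "x \<bullet> e \<le> support_rev e a b e" "x \<bullet> (- e) \<le> support_rev e a b (- e)"
    using assms by (simp_all only: rev_body_def mem_Collect_eq)
  then show ?thesis by (simp add: support_rev_def e ee)
qed

lemma support_rev_le: "support_rev e a b u \<le> (a + \<bar>b\<bar>) * norm u"
proof (cases "u = 0")
  case False
  have "\<bar>u \<bullet> e\<bar> \<le> norm u" using Cauchy_Schwarz_ineq2[of u e] e by simp
  then have "(u \<bullet> e)\<^sup>2 \<le> (norm u)\<^sup>2" by (metis abs_norm_cancel abs_le_square_iff)
  then have "(u \<bullet> e)\<^sup>2 / norm u \<le> norm u" using False by (simp add: divide_le_eq power2_eq_square)
  then have "b * ((u \<bullet> e)\<^sup>2 / norm u) \<le> \<bar>b\<bar> * norm u" by (intro mult_mono) auto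
  then show ?thesis by (simp add: support_rev_def algebra_simps)
qed (simp add: support_rev_def)

lemma convex_body_rev_body:
  assumes ab: "2 * \<bar>b\<bar> \<le> a"
  shows "convex_body (rev_body e a b)"
proof -
  have eq: "rev_body e a b = (\<Inter>u. {x. u \<bullet> x \<le> support_rev e a b u})"
    by (auto simp: rev_body_def inner_commute)
  have "closed (rev_body e a b)" unfolding eq by (intro closed_INT ballI closed_halfspace_le)
  moreover have "convex (rev_body e a b)" unfolding eq by (intro convex_INT convex_halfspace_le)
  moreover have "norm x \<le> a + \<bar>b\<bar>" if "x \<in> rev_body e a b" for x
  proof (cases "x = 0")
    case False
    have "x \<bullet> x \<le> (a + \<bar>b\<bar>) * norm x"
      using that support_rev_le[of a b x] unfolding rev_body_def by (blast intro: order_trans)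
    then have "norm x * norm x \<le> (a + \<bar>b\<bar>) * norm x" by (simp add: dot_square_norm power2_eq_square)
    then show ?thesis using False by simp
  qed (use ab in simp)
  then have "bounded (rev_body e a b)" unfolding bounded_iff by blast
  moreover have "rev_body e a b \<noteq> {}" using rev_body_attains[OF ab] by blast
  ultimately show ?thesis by (simp add: convex_body_def compact_eq_bounded_closed)
qed

text \<open>Support functions add. For the inclusion into the sum, points of the two summands
  attaining their support values in the same direction are added.\<close>

lemma rev_body_plus:
  assumes "2 * \<bar>b\<bar> \<le> a" "2 * \<bar>b'\<bar> \<le> a'"
  shows "rev_body e a b + rev_body e a' b' = rev_body e (a + a') (b + b')"
proof
  have eq: "support_rev e (a + a') (b + b') u = support_rev e a b u + support_rev e a' b' u" for u
    by (simp add: support_rev_def algebra_simps add_divide_distrib)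
  show "rev_body e a b + rev_body e a' b' \<subseteq> rev_body e (a + a') (b + b')"
    by (auto simp: rev_body_def eq inner_add_left add_mono elim!: set_plus_elim)
  have cb: "convex_body (rev_body e a b + rev_body e a' b')"
    by (intro convex_body_plus convex_body_rev_body assms)
  show "rev_body e (a + a') (b + b') \<subseteq> rev_body e a b + rev_body e a' b'"
    unfolding rev_body_def[of e "a + a'"]
  proof (rule subset_if_support_le)
    fix u
    obtain p q where "p \<in> rev_body e a b" "support_rev e a b u \<le> p \<bullet> u"
      "q \<in> rev_body e a' b'" "support_rev e a' b' u \<le> q \<bullet> u"
      using rev_body_attains assms by meson
    then show "\<exists>p\<in>rev_body e a b + rev_body e a' b'. support_rev e (a + a') (b + b') u \<le> p \<bullet> u"
      by (intro bexI[of _ "p + q"] set_plus_intro) (simp_all add: eq inner_add_left)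
  qed (use cb in \<open>auto simp: convex_body_def compact_imp_closed\<close>)
qed

lemma rev_body_scaleR:
  assumes "0 < t"
  shows "(*\<^sub>R) t ` rev_body e a b = rev_body e (t * a) (t * b)"
proof -
  have eq: "support_rev e (t * a) (t * b) u = t * support_rev e a b u" for u
    by (simp add: support_rev_def algebra_simps)
  have "x \<in> rev_body e (t * a) (t * b)" if "inverse t *\<^sub>R x \<in> rev_body e a b" for x
    using that assms unfolding rev_body_def mem_Collect_eq eq
    by (simp add: inverse_eq_divide divide_le_eq mult.commute)
  moreover have "inverse t *\<^sub>R x \<in> rev_body e a b" if "x \<in> rev_body e (t * a) (t * b)" for x
    using that assms unfolding rev_body_def mem_Collect_eq eq
    by (simp add: inverse_eq_divide divide_le_eq mult.commute)
  ultimately have iff: "inverse t *\<^sub>R x \<in> rev_body e a b \<longleftrightarrow> x \<in> rev_body e (t * a) (t * b)" for x by blast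
  show ?thesis
  proof (intro equalityI subsetI)
    fix x assume "x \<in> (*\<^sub>R) t ` rev_body e a b"
    then show "x \<in> rev_body e (t * a) (t * b)" using assms by (auto simp flip: iff)
  next
    fix x assume "x \<in> rev_body e (t * a) (t * b)"
    then show "x \<in> (*\<^sub>R) t ` rev_body e a b"
      using assms by (intro image_eqI[of _ _ "inverse t *\<^sub>R x"]) (simp_all add: iff)
  qed
qed

lemma rev_body_cball:
  assumes "0 \<le> r" shows "rev_body e r 0 = cball (0::'a) r"
proof (intro equalityI subsetI)
  fix x assume "x \<in> rev_body e r 0"
  then have "x \<bullet> x \<le> r * norm x" by (simp add: rev_body_def support_rev_def)
  then have "norm x * norm x \<le> r * norm x" by (simp add: dot_square_norm power2_eq_square)
  then show "x \<in> cball 0 r" using assms by (cases "x = 0") simp_all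
next
  fix x :: 'a assume "x \<in> cball 0 r"
  then have "norm x * norm u \<le> r * norm u" for u :: 'a by (intro mult_right_mono) simp_all
  then have "x \<bullet> u \<le> r * norm u" for u using norm_cauchy_schwarz[of x u] order_trans by blast
  then show "x \<in> rev_body e r 0" by (simp add: rev_body_def support_rev_def)
qed

text \<open>The density x + y (v . e)^2 has the support function with parameters x A + y c and y d.
  Solving for x and y, it is nonnegative on the ball once |y| \<le> x, which M = (A + |c|) / d
  ensures. This \<open>M\<close> is the same for all \<open>a\<close> and \<open>b\<close>.\<close>

lemma zonoid_rev_body:
  assumes dim: "2 \<le> DIM('a)"
  obtains M where "\<And>a b. 2 * \<bar>b\<bar> \<le> a \<Longrightarrow> M * \<bar>b\<bar> \<le> a \<Longrightarrow> zonoid (rev_body e a b)"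
proof -
  obtain A c d where A: "0 < A" "0 < d"
    "\<And>u::'a. ball_integral (\<lambda>v. \<bar>v \<bullet> u\<bar>) = A * norm u"
    "\<And>u. ball_integral (\<lambda>v. (v \<bullet> e)\<^sup>2 * \<bar>v \<bullet> u\<bar>) = c * norm u + d * ((u \<bullet> e)\<^sup>2 / norm u)"
    by (rule ball_integral_quadratic[OF dim e]) (rule that)
  have "zonoid (rev_body e a b)" if ab: "2 * \<bar>b\<bar> \<le> a" "((A + \<bar>c\<bar>) / d) * \<bar>b\<bar> \<le> a" for a b
  proof -
    define y where "y = b / d"
    define x where "x = (a - y * c) / A"
    have "((A + \<bar>c\<bar>) / d) * \<bar>b\<bar> = A * \<bar>y\<bar> + \<bar>y\<bar> * \<bar>c\<bar>"
      using A(2) by (simp add: y_def field_simps)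
    then have "\<bar>y\<bar> * A \<le> a - y * c"
      using ab(2) abs_ge_self[of "y * c"] by (simp add: abs_mult algebra_simps)
    then have xy: "\<bar>y\<bar> \<le> x" using A(1) by (simp add: x_def le_divide_eq)
    show ?thesis
    proof (rule zonoidI_ball_integral[OF convex_body_rev_body[OF ab(1)]])
      show "z \<bullet> u \<le> support_rev e a b u" if "z \<in> rev_body e a b" for z u
        using that by (simp add: rev_body_def)
      show "\<exists>p\<in>rev_body e a b. support_rev e a b u \<le> p \<bullet> u" for u by (rule rev_body_attains[OF ab(1)])
      show "continuous_on UNIV (\<lambda>v. x + y * (v \<bullet> e)\<^sup>2)" by (intro continuous_intros)
      show "0 \<le> x + y * (v \<bullet> e)\<^sup>2" if "norm v \<le> 1" for v
      proof -
        have "\<bar>v \<bullet> e\<bar> \<le> 1" using Cauchy_Schwarz_ineq2[of v e] e that by simp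
        then show ?thesis using abs_mult_sq_le[of "v \<bullet> e" y] xy by linarith
      qed
      show "support_rev e a b u = ball_integral (\<lambda>v. (x + y * (v \<bullet> e)\<^sup>2) * \<bar>v \<bullet> u\<bar>)" for u
      proof -
        have "ball_integral (\<lambda>v. (x + y * (v \<bullet> e)\<^sup>2) * \<bar>v \<bullet> u\<bar>)
            = ball_integral (\<lambda>v. x * \<bar>v \<bullet> u\<bar> + y * ((v \<bullet> e)\<^sup>2 * \<bar>v \<bullet> u\<bar>))"
          by (simp add: algebra_simps)
        also have "\<dots> = x * (A * norm u) + y * (c * norm u + d * ((u \<bullet> e)\<^sup>2 / norm u))"
          unfolding A(3,4)[symmetric] ball_integral_cmult[symmetric]
          by (rule ball_integral_add) (intro continuous_intros)+
        also have "\<dots> = (x * A + y * c) * norm u + (y * d) * ((u \<bullet> e)\<^sup>2 / norm u)"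
          by (simp add: algebra_simps)
        also have "\<dots> = support_rev e a b u"
          using A(1,2) by (simp add: x_def y_def support_rev_def)
        finally show ?thesis ..
      qed
    qed
  qed
  then show ?thesis by (rule that)
qed

end

section \<open>Volume of a body of revolution\<close>

context unit_axis begin

text \<open>Fubini along the axis: the section at height \<open>height a b s\<close> is a ball of
  radius \<open>radius a b s\<close> in one dimension less, and the last factor is the derivative of
  the height. Using the direction of the normal as parameter keeps the integrand explicit in
  \<open>a\<close> and \<open>b\<close>.\<close>

lemma emeasure_rev_body:
  assumes eB: "e \<in> Basis" and ab: "2 * \<bar>b\<bar> \<le> a" and a: "0 < a"
  shows "emeasure lborel (rev_body e a b) =
    (\<integral>\<^sup>+s. ennreal (unit_ball_vol (real (DIM('a) - 1)) * (radius a b s ^ (DIM('a) - 1) * (a + 2 * b - 3 * b * s\<^sup>2)))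
        * indicator {-1..1} s \<partial>lborel)"
proof -
  \<comment> \<open>The product measure over these coordinates stands for Lebesgue measure on the
    hyperplane orthogonal to \<open>e\<close>.\<close>
  define B' where "B' = Basis - {e}"
  have B': "finite B'" "e \<notin> B'" "Basis = insert e B'" "card B' = DIM('a) - 1"
    using eB by (auto simp: B'_def)
  define K where "K = rev_body e a b"
  have K: "closed K" using convex_body_rev_body[OF ab] by (simp add: K_def convex_body_def compact_imp_closed)
  then have [measurable]: "K \<in> sets borel" by simp
  define F where "F f = (\<Sum>i\<in>Basis. f i *\<^sub>R i)" for f :: "'a \<Rightarrow> real"
  have F_meas [measurable]: "F \<in> measurable (Pi\<^sub>M (insert e B') (\<lambda>_. lborel)) borel"
    unfolding F_def[abs_def] B'(3) by measurable
  interpret product_sigma_finite "\<lambda>_::'a. lborel :: real measure" by standard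
  define \<phi> where "\<phi> y = (\<integral>\<^sup>+x. indicator K (F (x(e := y))) \<partial>Pi\<^sub>M B' (\<lambda>_. lborel))" for y
  have [measurable]: "\<phi> \<in> borel_measurable borel"
  proof -
    have "(\<lambda>y. \<integral>\<^sup>+x. indicator K (F (x(e := y))) \<partial>Pi\<^sub>M B' (\<lambda>_. lborel)) \<in> borel_measurable lborel"
      by (rule sigma_finite_measure.borel_measurable_nn_integral[OF sigma_finite[OF B'(1)]]) measurable
    then show ?thesis unfolding \<phi>_def[abs_def] by simp
  qed
  have "emeasure lborel K = (\<integral>\<^sup>+x. indicator K x \<partial>distr (Pi\<^sub>M Basis (\<lambda>_. lborel)) borel F)"
    unfolding F_def[abs_def] by (subst lborel_eq[symmetric]) simp
  also have "\<dots> = (\<integral>\<^sup>+f. indicator K (F f) \<partial>Pi\<^sub>M (insert e B') (\<lambda>_. lborel))"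
    unfolding B'(3) by (rule nn_integral_distr) measurable
  also have "\<dots> = (\<integral>\<^sup>+y. \<phi> y \<partial>lborel)"
    unfolding \<phi>_def by (rule product_nn_integral_insert_rev[OF B'(1,2)])
      (rule measurable_compose[OF F_meas borel_measurable_indicator], simp add: K)
  finally have em: "emeasure lborel K = (\<integral>\<^sup>+y. \<phi> y \<partial>lborel)" .
  have Fe: "F (x(e := y)) \<bullet> e = y" and Fp: "norm (perp (F (x(e := y)))) = sqrt (\<Sum>i\<in>B'. (x i)\<^sup>2)" for x y
  proof -
    have F: "F (x(e := y)) = y *\<^sub>R e + (\<Sum>i\<in>B'. x i *\<^sub>R i)"
      unfolding F_def B'(3) using B'(1,2) by (simp, intro sum.cong) auto
    have ort: "i \<bullet> e = 0" if "i \<in> B'" for i using that eB by (auto simp: B'_def inner_not_same_Basis)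
    show Fe: "F (x(e := y)) \<bullet> e = y"
      using ort by (simp add: F inner_add_left ee inner_sum_left)
    have p: "perp (F (x(e := y))) = (\<Sum>i\<in>B'. x i *\<^sub>R i)" by (simp add: perp_def Fe) (simp add: F)
    have "(\<Sum>i\<in>B'. x i *\<^sub>R i) \<bullet> (\<Sum>i\<in>B'. x i *\<^sub>R i) = (\<Sum>i\<in>B'. (x i)\<^sup>2)"
    proof -
      have "(\<Sum>j\<in>B'. x i *\<^sub>R i \<bullet> x j *\<^sub>R j) = (x i)\<^sup>2" if "i \<in> B'" for i
      proof -
        have "(\<Sum>j\<in>B'. x i *\<^sub>R i \<bullet> x j *\<^sub>R j) = (\<Sum>j\<in>B'. if j = i then (x i)\<^sup>2 else 0)"
          using that by (intro sum.cong) (auto simp: B'_def inner_Basis power2_eq_square)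
        then show ?thesis using that B'(1) by simp
      qed
      then have "(\<Sum>i\<in>B'. \<Sum>j\<in>B'. x i *\<^sub>R i \<bullet> x j *\<^sub>R j) = (\<Sum>i\<in>B'. (x i)\<^sup>2)"
        by (rule sum.cong[OF refl])
      then show ?thesis 
        unfolding inner_sum_left[of _ B'] inner_sum_right[of _ _ B'] by (subst sum.swap)
    qed
    then show "norm (perp (F (x(e := y)))) = sqrt (\<Sum>i\<in>B'. (x i)\<^sup>2)"
      unfolding p norm_eq_sqrt_inner by simp
  qed
  have slice: "\<phi> (height a b s) = ennreal (unit_ball_vol (real (DIM('a) - 1)) * radius a b s ^ (DIM('a) - 1))"
    if s: "\<bar>s\<bar> < 1" for s
  proof -
    have "0 < a - b * s\<^sup>2" using abs_mult_sq_le[of s b] s ab a by linarith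
    then have r: "0 < radius a b s" using s by (simp add: radius_def abs_square_less_1)
    have iff: "F (x(e := height a b s)) \<in> K \<longleftrightarrow> sqrt (\<Sum>i\<in>B'. (x i)\<^sup>2) \<le> radius a b s" for x
      using rev_body_radius[OF ab s, of "F (x(e := height a b s))"]
        rev_bodyI[OF ab less_imp_le[OF s], of "F (x(e := height a b s))"]
      unfolding Fe Fp K_def by blast
    have "\<phi> (height a b s) = (\<integral>\<^sup>+x. indicator ({f. sqrt (\<Sum>i\<in>B'. (f i)\<^sup>2) \<le> radius a b s} \<inter> space (Pi\<^sub>M B' (\<lambda>_. lborel))) x \<partial>Pi\<^sub>M B' (\<lambda>_. lborel))"
      unfolding \<phi>_def by (rule nn_integral_cong) (simp add: indicator_def iff)
    also have "\<dots> = emeasure (Pi\<^sub>M B' (\<lambda>_. lborel)) ({f. sqrt (\<Sum>i\<in>B'. (f i)\<^sup>2) \<le> radius a b s} \<inter> space (Pi\<^sub>M B' (\<lambda>_. lborel)))"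
      using B'(1) by (subst nn_integral_indicator) auto
    also have "\<dots> = ennreal (unit_ball_vol (real (DIM('a) - 1)) * radius a b s ^ (DIM('a) - 1))"
      using emeasure_cball_aux[OF B'(1) r] by (simp add: B'(4))
    finally show ?thesis .
  qed
  have out: "\<phi> y = 0" if "a + b < \<bar>y\<bar>" for y
  proof -
    have "F (x(e := y)) \<notin> K" for x
      using rev_body_height[of "F (x(e := y))" a b] that unfolding Fe K_def by linarith
    then show ?thesis unfolding \<phi>_def by simp
  qed
  have h1: "height a b (-1) = - (a + b)" "height a b 1 = a + b" by (simp_all add: height_def)
  \<comment> \<open>The height is nondecreasing in \<open>s\<close>, as the substitution rule
    requires.\<close>
  have h'0: "0 \<le> a + 2 * b - 3 * b * s\<^sup>2" if "s \<in> {-1..1}" for s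
  proof -
    have "s\<^sup>2 \<le> 1" "0 \<le> s\<^sup>2" using that by (auto simp: abs_square_le_1)
    then show ?thesis
      using ab mult_left_mono[of "s\<^sup>2" 1 b] mult_left_mono_neg[of "s\<^sup>2" 1 "b"] mult_left_mono_neg[of 0 "s\<^sup>2" "b"]
      by (cases "0 \<le> b") auto
  qed
  have "emeasure lborel K = (\<integral>\<^sup>+y. \<phi> y * indicator {height a b (-1)..height a b 1} y \<partial>lborel)"
    unfolding em by (intro nn_integral_cong) (use out in \<open>auto simp: indicator_def h1 abs_if split: if_splits\<close>)
  also have "\<dots> = (\<integral>\<^sup>+s. \<phi> (height a b s) * ennreal (a + 2 * b - 3 * b * s\<^sup>2) * indicator {-1..1} s \<partial>lborel)"
  proof (rule nn_integral_substitution_aux)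
    show "(height a b has_real_derivative a + 2 * b - 3 * b * s\<^sup>2) (at s)" for s
      unfolding height_def[abs_def]
      by (auto intro!: derivative_eq_intros simp: power2_eq_square algebra_simps)
    show "continuous_on {-1..1} (\<lambda>s. a + 2 * b - 3 * b * s\<^sup>2)" by (intro continuous_intros)
  qed (use h'0 in auto)
  also have "\<dots> = (\<integral>\<^sup>+s. ennreal (unit_ball_vol (real (DIM('a) - 1)) * (radius a b s ^ (DIM('a) - 1) * (a + 2 * b - 3 * b * s\<^sup>2)))
        * indicator {-1..1} s \<partial>lborel)"
  proof (rule nn_integral_cong_AE)
    \<comment> \<open>The sections were identified only for \<open>\<bar>s\<bar> < 1\<close>; the
      two poles form a null set.\<close>
    have "AE s in lborel. s \<notin> {-1, 1::real}"
      by (intro AE_not_in countable_imp_null_set_lborel) auto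
    then show "AE s in lborel. \<phi> (height a b s) * ennreal (a + 2 * b - 3 * b * s\<^sup>2) * indicator {-1..1} s
      = ennreal (unit_ball_vol (real (DIM('a) - 1)) * (radius a b s ^ (DIM('a) - 1) * (a + 2 * b - 3 * b * s\<^sup>2)))
        * indicator {-1..1} s"
    proof eventually_elim
      case (elim s)
      show ?case
      proof (cases "s \<in> {-1..1}")
        case True
        with elim have s: "\<bar>s\<bar> < 1" by auto
        show ?thesis using slice[OF s] h'0[OF True]
          by (simp add: ennreal_mult' ennreal_mult'' mult_ac)
      qed simp
    qed
  qed
  finally show ?thesis by (simp only: K_def)
qed

lemma measure_rev_body:
  assumes eB: "e \<in> Basis" and ab: "2 * \<bar>b\<bar> \<le> a" and a: "0 < a"
  shows "measure lebesgue (rev_body e a b) = unit_ball_vol (real (DIM('a) - 1)) *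
    integral {-1..1} (\<lambda>s. radius a b s ^ (DIM('a) - 1) * (a + 2 * b - 3 * b * s\<^sup>2))"
proof -
  let ?f = "\<lambda>s. radius a b s ^ (DIM('a) - 1) * (a + 2 * b - 3 * b * s\<^sup>2)"
  let ?c = "unit_ball_vol (real (DIM('a) - 1))"
  have f0: "0 \<le> ?c * ?f s" if "s \<in> {-1..1}" for s
  proof -
    have s: "\<bar>s\<bar> \<le> 1" using that by auto
    then have "0 \<le> radius a b s"
      using abs_mult_sq_le[OF s, of b] ab unfolding radius_def
      by (intro mult_nonneg_nonneg) (auto simp: abs_square_le_1)
    moreover have "s\<^sup>2 \<le> 1" "0 \<le> s\<^sup>2" using s by (auto simp: abs_square_le_1)
    then have "0 \<le> a + 2 * b - 3 * b * s\<^sup>2"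
      using ab mult_left_mono[of "s\<^sup>2" 1 b] mult_left_mono_neg[of "s\<^sup>2" 1 "b"] mult_left_mono_neg[of 0 "s\<^sup>2" "b"]
      by (cases "0 \<le> b") auto
    ultimately show ?thesis by simp
  qed
  have "continuous_on {-1..1} ?f" unfolding radius_def by (intro continuous_intros)
  then have "(?f has_integral integral {-1..1} ?f) {-1..1}"
    by (intro integrable_integral integrable_continuous_real)
  then have hi: "((\<lambda>s. ?c * ?f s) has_integral ?c * integral {-1..1} ?f) {-1..1}"
    by (rule has_integral_mult_right)
  then have "(\<integral>\<^sup>+s. ennreal (indicator {-1..1} s * (?c * ?f s)) \<partial>lborel) = ennreal (?c * integral {-1..1} ?f)"
    by (rule nn_integral_has_integral_lebesgue[rotated]) (rule f0)
  moreover have "(\<integral>\<^sup>+s. ennreal (?c * ?f s) * indicator {-1..1} s \<partial>lborel)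
      = (\<integral>\<^sup>+s. ennreal (indicator {-1..1} s * (?c * ?f s)) \<partial>lborel)"
    by (intro nn_integral_cong) (simp add: indicator_def)
  ultimately have "emeasure lborel (rev_body e a b) = ennreal (?c * integral {-1..1} ?f)"
    unfolding emeasure_rev_body[OF assms] by (rule trans[rotated])
  moreover have "0 \<le> ?c * integral {-1..1} ?f"
    using hi by (rule has_integral_nonneg) (rule f0)
  ultimately have "measure lborel (rev_body e a b) = ?c * integral {-1..1} ?f"
    by (rule measure_eq_emeasure_eq_ennreal[rotated])
  moreover have "closed (rev_body e a b)"
    using convex_body_rev_body[OF ab] unfolding convex_body_def by (blast intro: compact_imp_closed)
  then have "rev_body e a b \<in> sets lborel" by simp
  ultimately show ?thesis by (simp only: measure_completion)
qed

end

section \<open>Expansion of the volume at infinity\<close>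

text \<open>After division by the k-th power of the variable, the polynomial is positive at 0 and
  hence nearby.\<close>

lemma poly_pos_at_right_0:
  fixes p :: "real poly"
  assumes "\<And>i. i < k \<Longrightarrow> coeff p i = 0" "0 < coeff p k"
  shows "\<forall>\<^sub>F x in at_right 0. 0 < poly p x"
proof -
  have "monom 1 k dvd p" using assms(1) by (simp add: monom_1_dvd_iff')
  then obtain q where q: "p = monom 1 k * q" by (elim dvdE)
  have "coeff p k = coeff q 0" by (simp add: q coeff_monom_mult)
  then have "0 < poly q 0" using assms(2) by (simp add: poly_0_coeff_0)
  moreover have "(poly q \<longlongrightarrow> poly q 0) (at_right 0)"
    using poly_isCont[of 0 q] unfolding isCont_def by (rule filterlim_mono[OF _ order_refl at_le]) simp
  ultimately have "\<forall>\<^sub>F x in at_right 0. 0 < poly q x" by (rule order_tendstoD(1)[rotated])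
  moreover have "\<forall>\<^sub>F x in at_right (0::real). 0 < x" by (simp add: eventually_at_right_less)
  ultimately show ?thesis by eventually_elim (simp add: q poly_monom)
qed

text \<open>If the derivative were nonnegative beyond \<open>r0\<close>, then \<open>D\<close> would
  never again fall below some value exceeding \<open>l\<close>, contrary to the upper bounds
  \<open>l + \<eta>\<close>.\<close>

lemma decreasing_above_limit:
  fixes D :: "real \<Rightarrow> real"
  assumes deriv: "\<And>r. r0 < r \<Longrightarrow> D differentiable at r"
    and above: "\<forall>\<^sub>F r in at_top. l < D r" and limit: "\<And>\<eta>. 0 < \<eta> \<Longrightarrow> \<forall>\<^sub>F r in at_top. D r < l + \<eta>"
  shows "\<exists>r>r0. \<exists>d>0. \<forall>h. 0 < h \<longrightarrow> h < d \<longrightarrow> D (r + h) < D r"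
proof -
  obtain D' where D': "\<And>r. r0 < r \<Longrightarrow> (D has_real_derivative D' r) (at r)"
    using deriv unfolding real_differentiable_def by metis
  have "\<exists>r>r0. D' r < 0"
  proof (rule ccontr)
    assume "\<not> ?thesis"
    then have nonneg: "0 \<le> D' r" if "r0 < r" for r using that by force
    obtain r1 where r1: "r0 < r1" "l < D r1"
      using eventually_happens[OF eventually_conj[OF above eventually_gt_at_top[of r0]]] by auto
    have "D r1 \<le> D r" if "r1 \<le> r" for r
    proof (rule DERIV_nonneg_imp_nondecreasing[OF that])
      fix x assume "r1 \<le> x"
      then show "\<exists>y. (D has_real_derivative y) (at x) \<and> 0 \<le> y"
        using r1(1) D'[of x] nonneg[of x] by force
    qed
    moreover obtain r where "r1 \<le> r" "D r < l + (D r1 - l)"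
      using eventually_happens[OF eventually_conj[OF limit[of "D r1 - l"] eventually_ge_at_top[of r1]]] r1(2)
      by auto
    ultimately show False by force
  qed
  then obtain r where r: "r0 < r" "D' r < 0" by blast
  then show ?thesis using DERIV_neg_dec_right[OF D'[OF r(1)] r(2)] by blast
qed

section \<open>Moments and the expansion in powers of 1/r\<close>

text \<open>Up to a constant the weight is the volume of the section of the unit ball of dimension
  \<open>m + 1\<close> at height \<open>s\<close>; normalised values are therefore means over that
  ball.\<close>

definition weighted_integral :: "nat \<Rightarrow> (real \<Rightarrow> real) \<Rightarrow> real" where
  "weighted_integral m f = integral {-1..1} (\<lambda>s. sqrt (1 - s\<^sup>2) ^ m * f s)"

lemma weighted_integrable:
  "continuous_on {-1..1} f \<Longrightarrow> (\<lambda>s. sqrt (1 - s\<^sup>2) ^ m * f s) integrable_on {-1..1::real}"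
  by (intro integrable_continuous_real continuous_intros)

lemma weighted_integral_sum:
  assumes "finite I" "\<And>i. i \<in> I \<Longrightarrow> continuous_on {-1..1} (f i)"
  shows "weighted_integral m (\<lambda>s. \<Sum>i\<in>I. c i * f i s) = (\<Sum>i\<in>I. c i * weighted_integral m (f i))"
proof -
  have "weighted_integral m (\<lambda>s. \<Sum>i\<in>I. c i * f i s)
      = integral {-1..1} (\<lambda>s. \<Sum>i\<in>I. c i * (sqrt (1 - s\<^sup>2) ^ m * f i s))"
    unfolding weighted_integral_def
    by (intro Henstock_Kurzweil_Integration.integral_cong) (simp only: sum_distrib_left, intro sum.cong, auto)
  also have "\<dots> = (\<Sum>i\<in>I. integral {-1..1} (\<lambda>s. c i * (sqrt (1 - s\<^sup>2) ^ m * f i s)))"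
    using assms by (intro Henstock_Kurzweil_Integration.integral_sum integrable_on_mult_right weighted_integrable)
  finally show ?thesis unfolding weighted_integral_def by simp
qed

lemma weighted_integral_cmult: "weighted_integral m (\<lambda>s. c * f s) = c * weighted_integral m f"
  unfolding weighted_integral_def mult.left_commute[of _ c] by (rule integral_mult_right)

text \<open>In closed form 1 * 3 * ... * (2j - 1) / ((d + 2) (d + 4) ... (d + 2j)), the mean of the
  2j-th power of a coordinate over the unit ball of dimension d.\<close>

fun even_moment :: "real \<Rightarrow> nat \<Rightarrow> real" where
  "even_moment d 0 = 1"
| "even_moment d (Suc j) = (2 * real j + 1) / (d + 2 * real j + 2) * even_moment d j"

text \<open>Integration by parts: \<open>G\<close> vanishes at both endpoints and its derivative
  \<open>g\<close> combines two consecutive moments. The square root is not differentiable at the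
  endpoints, hence the interior form of the fundamental theorem.\<close>

lemma weighted_integral_even_power:
  "weighted_integral m (\<lambda>s. s ^ (2 * j)) = weighted_integral m (\<lambda>s. 1) * even_moment (real m + 1) j"
proof (induction j)
  case (Suc j)
  let ?W = "\<lambda>j. weighted_integral m (\<lambda>s. s ^ (2 * j))"
  define G where "G s = s ^ (2 * j + 1) * sqrt (1 - s\<^sup>2) ^ (m + 2)" for s :: real
  define g where "g s = sqrt (1 - s\<^sup>2) ^ m * ((2 * real j + 1) * s ^ (2 * j) - (real m + 2 * real j + 3) * s ^ (2 * Suc j))" for s :: real
  have "(g has_integral G 1 - G (-1)) {-1..1}"
  proof (rule fundamental_theorem_of_calculus_interior)
    show "continuous_on {-1..1} G" unfolding G_def by (intro continuous_intros)
    fix s :: real assume s: "s \<in> {-1<..<1}"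
    define w where "w = sqrt (1 - s\<^sup>2)"
    have pos: "0 < 1 - s\<^sup>2" using s abs_square_less_1[of s] by auto
    then have w: "0 < w" "w\<^sup>2 = 1 - s\<^sup>2" by (simp_all add: w_def)
    have h: "((\<lambda>s. sqrt (1 - s\<^sup>2)) has_real_derivative - s / w) (at s)"
      using pos unfolding w_def by (auto intro!: derivative_eq_intros simp: field_simps)
    have "(G has_real_derivative s ^ (2 * j + 1) * (real (m + 2) * w ^ (m + 1) * (- s / w))
        + real (2 * j + 1) * s ^ (2 * j) * w ^ (m + 2)) (at s)"
      unfolding G_def[abs_def]
      by (rule DERIV_cong[OF DERIV_mult[OF DERIV_pow[of "2 * j + 1"] DERIV_power[OF h, of "m + 2"]]])
         (simp flip: w_def)
    moreover have "s ^ (2 * j + 1) * (real (m + 2) * w ^ (m + 1) * (- s / w))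
        + real (2 * j + 1) * s ^ (2 * j) * w ^ (m + 2) = g s"
    proof -
      have 1: "s ^ (2 * j + 1) * (real (m + 2) * w ^ (m + 1) * (- s / w)) = w ^ m * (- (real m + 2) * s ^ (2 * Suc j))"
        using w(1) by (simp add: algebra_simps)
      have 2: "w ^ (m + 2) = w ^ m * (1 - s\<^sup>2)" by (simp only: power_add w(2))
      have 3: "s ^ (2 * Suc j) = s\<^sup>2 * s ^ (2 * j)" by (simp add: power2_eq_square)
      have "P * (- (a + 2) * (t * B)) + (2 * b + 1) * B * (P * (1 - t)) = P * ((2 * b + 1) * B - (a + 2 * b + 3) * (t * B))"
        for P a b t B :: real by (simp add: algebra_simps)
      then show ?thesis
        unfolding g_def w_def[symmetric] 1 2 3 unfolding of_nat_add of_nat_mult of_nat_numeral of_nat_1 .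
    qed
    ultimately show "(G has_vector_derivative g s) (at s)"
      by (simp add: has_real_derivative_iff_has_vector_derivative)
  qed simp
  moreover have "G 1 = 0" "G (-1) = 0" by (simp_all add: G_def)
  ultimately have "(g has_integral 0) {-1..1}" by simp
  moreover have "(g has_integral (2 * real j + 1) * ?W j - (real m + 2 * real j + 3) * ?W (Suc j)) {-1..1}"
  proof -
    let ?f = "\<lambda>j s. sqrt (1 - s\<^sup>2) ^ m * (s::real) ^ (2 * j)"
    have f: "(?f j has_integral ?W j) {-1..1}" for j
      unfolding weighted_integral_def by (intro integrable_integral weighted_integrable continuous_intros)
    have "g = (\<lambda>s. (2 * real j + 1) * ?f j s - (real m + 2 * real j + 3) * ?f (Suc j) s)"
      by (rule ext) (simp only: g_def right_diff_distrib mult.left_commute)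
    then show ?thesis by (simp only:) (intro has_integral_diff has_integral_mult_right f)
  qed
  ultimately have "0 = (2 * real j + 1) * ?W j - (real m + 2 * real j + 3) * ?W (Suc j)"
    by (rule has_integral_unique)
  then have "(real m + 2 * real j + 3) * ?W (Suc j) = (2 * real j + 1) * ?W j" by simp
  then have "?W (Suc j) = (2 * real j + 1) * ?W j / (real m + 2 * real j + 3)"
    by (simp add: nonzero_eq_divide_eq mult.commute add_pos_nonneg add_nonneg_eq_0_iff)
  then show ?case using Suc.IH by (simp add: algebra_simps)
qed simp

lemma weighted_integral_quartic:
  "weighted_integral m (\<lambda>s. a0 + a1 * s\<^sup>2 + a2 * (s\<^sup>2)\<^sup>2 + a3 * (s\<^sup>2) ^ 3 + a4 * (s\<^sup>2) ^ 4)
     = weighted_integral m (\<lambda>s. 1) * (a0 + a1 * even_moment (real m + 1) 1 + a2 * even_moment (real m + 1) 2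
          + a3 * even_moment (real m + 1) 3 + a4 * even_moment (real m + 1) 4)"
proof -
  define a where "a i = (if i = 0 then a0 else if i = 1 then a1 else if i = 2 then a2 else if i = 3 then a3 else a4)" for i :: nat
  have five: "{..<5::nat} = {0,1,2,3,4}" by auto
  have "(\<lambda>s::real. a0 + a1 * s\<^sup>2 + a2 * (s\<^sup>2)\<^sup>2 + a3 * (s\<^sup>2) ^ 3 + a4 * (s\<^sup>2) ^ 4) = (\<lambda>s. \<Sum>i<5. a i * s ^ (2 * i))"
    by (rule ext) (simp add: five a_def flip: power_mult)
  then have "weighted_integral m (\<lambda>s. a0 + a1 * s\<^sup>2 + a2 * (s\<^sup>2)\<^sup>2 + a3 * (s\<^sup>2) ^ 3 + a4 * (s\<^sup>2) ^ 4)
      = weighted_integral m (\<lambda>s. \<Sum>i<5. a i * s ^ (2 * i))" by (rule arg_cong)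
  also have "\<dots> = (\<Sum>i<5. a i * weighted_integral m (\<lambda>s. s ^ (2 * i)))"
    by (rule weighted_integral_sum) (auto intro!: continuous_intros)
  also have "\<dots> = weighted_integral m (\<lambda>s. 1) * (\<Sum>i<5. a i * even_moment (real m + 1) i)"
    unfolding weighted_integral_even_power sum_distrib_left by (simp only: mult_ac)
  finally show ?thesis by (simp add: five a_def algebra_simps)
qed

text \<open>The coefficient of \<epsilon>^k in (1 + \<epsilon> (c - x))^m (1 + \<epsilon> (c + 2 -
  3x)), where x stands for s^2. The case \<open>k = 0\<close> is separate because
  \<open>k - 1\<close> would truncate to 0.\<close>

definition expansion_term :: "nat \<Rightarrow> real \<Rightarrow> nat \<Rightarrow> real \<Rightarrow> real" where
  "expansion_term m c k x = real (m choose k) * (c - x) ^ k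
     + (if k = 0 then 0 else real (m choose (k - 1)) * (c - x) ^ (k - 1) * (c + 2 - 3 * x))"

lemma expansion_sum:
  "(1 + \<epsilon> * (c - x)) ^ m * (1 + \<epsilon> * (c + 2 - 3 * x)) = (\<Sum>k\<le>Suc m. \<epsilon> ^ k * expansion_term m c k x)"
proof -
  let ?p = "c - x" and ?q = "c + 2 - 3 * x"
  have 1: "(1 + \<epsilon> * ?p) ^ m = (\<Sum>k\<le>m. \<epsilon> ^ k * (real (m choose k) * ?p ^ k))"
    unfolding add.commute[of 1] binomial_ring by (simp add: power_mult_distrib mult_ac)
  have "(\<Sum>k\<le>Suc m. \<epsilon> ^ k * expansion_term m c k x)
      = (\<Sum>k\<le>Suc m. \<epsilon> ^ k * (real (m choose k) * ?p ^ k))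
        + (\<Sum>k\<le>Suc m. \<epsilon> ^ k * (if k = 0 then 0 else real (m choose (k - 1)) * ?p ^ (k - 1) * ?q))"
    by (simp only: expansion_term_def distrib_left sum.distrib)
  also have "(\<Sum>k\<le>Suc m. \<epsilon> ^ k * (real (m choose k) * ?p ^ k)) = (1 + \<epsilon> * ?p) ^ m"
    by (simp add: 1)
  also have "(\<Sum>k\<le>Suc m. \<epsilon> ^ k * (if k = 0 then 0 else real (m choose (k - 1)) * ?p ^ (k - 1) * ?q))
      = (\<Sum>k\<le>m. \<epsilon> ^ k * (real (m choose k) * ?p ^ k)) * (\<epsilon> * ?q)"
    unfolding sum.atMost_Suc_shift sum_distrib_right by (simp add: mult_ac)
  finally show ?thesis unfolding 1[symmetric] by (simp add: algebra_simps)
qed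

text \<open>
  \<open>expansion_coeff m c k\<close> is the coefficient of $r^{m+1-k}$ in the volume of the body of revolution
  with support function $(r + c)|u| + u_1^2/|u|$, relative to the volume of the ball.
\<close>

definition expansion_coeff :: "nat \<Rightarrow> real \<Rightarrow> nat \<Rightarrow> real" where
  "expansion_coeff m c k = weighted_integral m (\<lambda>s. expansion_term m c k (s\<^sup>2)) / weighted_integral m (\<lambda>s. 1)"

text \<open>The variable stands for 1/r. Evaluation at -1/r gives the companion body, with
  \<open>r - c\<close> in place of \<open>r + c\<close> and the opposite sign before
  u_1^2/|u|.\<close>

definition expansion_poly :: "nat \<Rightarrow> real \<Rightarrow> real poly" where
  "expansion_poly m c = (\<Sum>k\<le>Suc m. monom (expansion_coeff m c k) k)"

lemma coeff_expansion_poly: "coeff (expansion_poly m c) k = expansion_coeff m c k"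
proof (cases "k \<le> Suc m")
  case False
  then have "expansion_term m c k x = 0" for x by (simp add: expansion_term_def binomial_eq_0)
  then show ?thesis using False
    by (simp add: expansion_poly_def coeff_sum expansion_coeff_def weighted_integral_def)
qed (simp add: expansion_poly_def coeff_sum)

lemma poly_expansion_poly:
  "poly (expansion_poly m c) \<epsilon> = weighted_integral m (\<lambda>s. (1 + \<epsilon> * (c - s\<^sup>2)) ^ m * (1 + \<epsilon> * (c + 2 - 3 * s\<^sup>2)))
     / weighted_integral m (\<lambda>s. 1)"
proof -
  have "continuous_on {-1..1} (\<lambda>s. expansion_term m c k (s\<^sup>2))" for k
    by (cases "k = 0") (auto simp: expansion_term_def intro!: continuous_intros)
  then show ?thesis
    unfolding expansion_sum expansion_poly_def expansion_coeff_def
    by (subst weighted_integral_sum) (simp_all add: poly_sum poly_monom sum_divide_distrib add_divide_distrib mult_ac)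
qed

lemma choose_real:
  "real (m choose 2) = real m * (real m - 1) / 2"
  "real (m choose 3) = real m * (real m - 1) * (real m - 2) / 6"
  "real (m choose 4) = real m * (real m - 1) * (real m - 2) * (real m - 3) / 24"
proof -
  show two: "real (m choose 2) = real m * (real m - 1) / 2" for m
    by (induction m) (auto simp: numeral_2_eq_2 field_simps)
  show three: "real (m choose 3) = real m * (real m - 1) * (real m - 2) / 6" for m
  proof (induction m)
    case (Suc m)
    have "Suc m choose 3 = (m choose 2) + (m choose 3)" by (simp add: numeral_3_eq_3 numeral_2_eq_2)
    then show ?case using Suc two[of m] by (simp add: field_simps)
  qed simp
  show "real (m choose 4) = real m * (real m - 1) * (real m - 2) * (real m - 3) / 24"
  proof (induction m)
    case (Suc m)
    have "Suc m choose 4 = (m choose 3) + (m choose 4)" by (simp add: numeral_3_eq_3 eval_nat_numeral)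
    then show ?case using Suc three[of m] by (simp add: field_simps)
  qed simp
qed

text \<open>Integration replaces each x^j by the moment \<open>M j\<close>. The list stops at four
  because the comparison of volumes is decided at order \<epsilon>^4.\<close>

lemma expansion_coeffs:
  fixes m :: nat and c :: real
  assumes W: "weighted_integral m (\<lambda>s. 1) \<noteq> 0"
  defines "M \<equiv> even_moment (real m + 1)"
  shows "expansion_coeff m c 0 = 1"
    and "expansion_coeff m c 1 = real m * (c - M 1) + (c + 2 - 3 * M 1)"
    and "expansion_coeff m c 2 = real (m choose 2) * (c\<^sup>2 - 2 * c * M 1 + M 2)
           + real m * (c * (c + 2) - (4 * c + 2) * M 1 + 3 * M 2)"
    and "expansion_coeff m c 3 = real (m choose 3) * (c ^ 3 - 3 * c\<^sup>2 * M 1 + 3 * c * M 2 - M 3)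
           + real (m choose 2) * (c\<^sup>2 * (c + 2) - (3 * c\<^sup>2 + 2 * c * (c + 2)) * M 1 + (7 * c + 2) * M 2 - 3 * M 3)"
    and "expansion_coeff m c 4 = real (m choose 4) * (c ^ 4 - 4 * c ^ 3 * M 1 + 6 * c\<^sup>2 * M 2 - 4 * c * M 3 + M 4)
           + real (m choose 3) * (c ^ 3 * (c + 2) - (3 * c ^ 3 + 3 * c\<^sup>2 * (c + 2)) * M 1
               + (9 * c\<^sup>2 + 3 * c * (c + 2)) * M 2 - (10 * c + 2) * M 3 + 3 * M 4)"
proof -
  have *: "expansion_coeff m c k = a0 + a1 * M 1 + a2 * M 2 + a3 * M 3 + a4 * M 4"
    if "\<And>x. expansion_term m c k x = a0 + a1 * x + a2 * x\<^sup>2 + a3 * x ^ 3 + a4 * x ^ 4" for k a0 a1 a2 a3 a4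
    unfolding expansion_coeff_def that weighted_integral_quartic M_def using W by simp
  have "expansion_term m c 0 x = 1 + 0 * x + 0 * x\<^sup>2 + 0 * x ^ 3 + 0 * x ^ 4" for x
    by (simp add: expansion_term_def)
  from *[OF this] show "expansion_coeff m c 0 = 1" by simp
  let ?b = "\<lambda>k. real (m choose k)"
  have "expansion_term m c 1 x = (real m * c + (c + 2)) + (- real m - 3) * x + 0 * x\<^sup>2 + 0 * x ^ 3 + 0 * x ^ 4" for x
    by (simp add: expansion_term_def algebra_simps)
  from *[OF this] show "expansion_coeff m c 1 = real m * (c - M 1) + (c + 2 - 3 * M 1)"
    by (simp add: algebra_simps)
  have "expansion_term m c 2 x = (?b 2 * c\<^sup>2 + real m * (c * (c + 2))) + (- ?b 2 * 2 * c - real m * (4 * c + 2)) * x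
      + (?b 2 + 3 * real m) * x\<^sup>2 + 0 * x ^ 3 + 0 * x ^ 4" for x
    by (simp add: expansion_term_def) algebra
  from *[OF this] show "expansion_coeff m c 2 = ?b 2 * (c\<^sup>2 - 2 * c * M 1 + M 2)
           + real m * (c * (c + 2) - (4 * c + 2) * M 1 + 3 * M 2)"
    by algebra
  have "expansion_term m c 3 x = (?b 3 * c ^ 3 + ?b 2 * (c\<^sup>2 * (c + 2)))
      + (- ?b 3 * 3 * c\<^sup>2 - ?b 2 * (3 * c\<^sup>2 + 2 * c * (c + 2))) * x
      + (?b 3 * 3 * c + ?b 2 * (7 * c + 2)) * x\<^sup>2 + (- ?b 3 - 3 * ?b 2) * x ^ 3 + 0 * x ^ 4" for x
    by (simp add: expansion_term_def) algebra
  from *[OF this] show "expansion_coeff m c 3 = ?b 3 * (c ^ 3 - 3 * c\<^sup>2 * M 1 + 3 * c * M 2 - M 3)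
           + ?b 2 * (c\<^sup>2 * (c + 2) - (3 * c\<^sup>2 + 2 * c * (c + 2)) * M 1 + (7 * c + 2) * M 2 - 3 * M 3)"
    by algebra
  have "expansion_term m c 4 x = (?b 4 * c ^ 4 + ?b 3 * (c ^ 3 * (c + 2)))
      + (- ?b 4 * 4 * c ^ 3 - ?b 3 * (3 * c ^ 3 + 3 * c\<^sup>2 * (c + 2))) * x
      + (?b 4 * 6 * c\<^sup>2 + ?b 3 * (9 * c\<^sup>2 + 3 * c * (c + 2))) * x\<^sup>2
      + (- ?b 4 * 4 * c - ?b 3 * (10 * c + 2)) * x ^ 3 + (?b 4 + 3 * ?b 3) * x ^ 4" for x
    by (simp add: expansion_term_def) algebra
  from *[OF this] show "expansion_coeff m c 4 = ?b 4 * (c ^ 4 - 4 * c ^ 3 * M 1 + 6 * c\<^sup>2 * M 2 - 4 * c * M 3 + M 4)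
           + ?b 3 * (c ^ 3 * (c + 2) - (3 * c ^ 3 + 3 * c\<^sup>2 * (c + 2)) * M 1
               + (9 * c\<^sup>2 + 3 * c * (c + 2)) * M 2 - (10 * c + 2) * M 3 + 3 * M 4)"
    by algebra
qed

text \<open>Here \<open>d\<close> is the dimension of the space. Moments and binomial coefficients
  are rational in \<open>d\<close>, so clearing denominators leaves polynomial identities.\<close>

lemma expansion_coeffs_explicit:
  fixes m :: nat
  assumes W: "weighted_integral m (\<lambda>s. 1) \<noteq> 0"
  defines "d \<equiv> real m + 1"
  defines "c \<equiv> - (d + 1) / (d + 4)"
  shows "expansion_coeff m c 1 = (4 - d\<^sup>2) / (d + 4)"
    and "expansion_coeff m c 2 = (16 + d - 12 * d\<^sup>2 - 6 * d ^ 3 + d ^ 4 / 2 + d ^ 5 / 2) / ((d + 2) * (d + 4)\<^sup>2)"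
    and "expansion_coeff m c 3 = (20 - 40 / 3 * d - 9 * d\<^sup>2 - 2 / 3 * d ^ 3 + 8 / 3 * d ^ 4 + d ^ 5 / 2 - d ^ 6 / 6) / (d + 4) ^ 3"
    and "expansion_coeff m c 4 = (720 - 91 * d - 3739 / 6 * d\<^sup>2 - 541 / 3 * d ^ 3 + 286 / 3 * d ^ 4 + 151 / 2 * d ^ 5
           + 25 / 2 * d ^ 6 - 27 / 4 * d ^ 7 - 53 / 24 * d ^ 8 + d ^ 9 / 12 + d ^ 10 / 24) / ((d + 2) * (d + 4) ^ 4 * (d + 6))"
proof -
  have d: "d \<ge> 1" "real m = d - 1" by (simp_all add: d_def)
  then have nz: "d + 2 \<noteq> 0" "d + 4 \<noteq> 0" "d + 6 \<noteq> 0" "d + 8 \<noteq> 0" by auto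
  have M: "even_moment d 1 = 1 / (d + 2)" "even_moment d 2 = 3 / ((d + 2) * (d + 4))"
    "even_moment d 3 = 15 / ((d + 2) * (d + 4) * (d + 6))"
    "even_moment d 4 = 105 / ((d + 2) * (d + 4) * (d + 6) * (d + 8))"
    by (simp_all add: eval_nat_numeral mult_ac add_ac)
  note expand = expansion_coeffs[OF W, folded d_def] M choose_real d(2)
  show "expansion_coeff m c 1 = (4 - d\<^sup>2) / (d + 4)"
    unfolding expand c_def using nz by (simp add: divide_simps) algebra
  show "expansion_coeff m c 2 = (16 + d - 12 * d\<^sup>2 - 6 * d ^ 3 + d ^ 4 / 2 + d ^ 5 / 2) / ((d + 2) * (d + 4)\<^sup>2)"
    unfolding expand c_def using nz by (simp add: divide_simps) algebra
  show "expansion_coeff m c 3 = (20 - 40 / 3 * d - 9 * d\<^sup>2 - 2 / 3 * d ^ 3 + 8 / 3 * d ^ 4 + d ^ 5 / 2 - d ^ 6 / 6) / (d + 4) ^ 3"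
    unfolding expand c_def using nz by (simp add: divide_simps) algebra
  show "expansion_coeff m c 4 = (720 - 91 * d - 3739 / 6 * d\<^sup>2 - 541 / 3 * d ^ 3 + 286 / 3 * d ^ 4 + 151 / 2 * d ^ 5
           + 25 / 2 * d ^ 6 - 27 / 4 * d ^ 7 - 53 / 24 * d ^ 8 + d ^ 9 / 12 + d ^ 10 / 24) / ((d + 2) * (d + 4) ^ 4 * (d + 6))"
    unfolding expand c_def using nz by (simp add: divide_simps) algebra
qed

text \<open>Comparing the product of volumes with powers of 1 + l \<epsilon>^2 replaces an expansion
  of its n-th root.\<close>

lemma coeff_quadratic_power:
  fixes l :: real
  shows "coeff ([:1, 0, l:] ^ n) 0 = 1" "coeff ([:1, 0, l:] ^ n) 1 = 0" "coeff ([:1, 0, l:] ^ n) 2 = real n * l"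
    "coeff ([:1, 0, l:] ^ n) 3 = 0" "coeff ([:1, 0, l:] ^ n) 4 = real n * (real n - 1) / 2 * l\<^sup>2"
proof -
  have "coeff ([:1, 0, l:] ^ n) 0 = 1 \<and> coeff ([:1, 0, l:] ^ n) 1 = 0 \<and> coeff ([:1, 0, l:] ^ n) 2 = real n * l
    \<and> coeff ([:1, 0, l:] ^ n) 3 = 0 \<and> coeff ([:1, 0, l:] ^ n) 4 = real n * (real n - 1) / 2 * l\<^sup>2"
  proof (induction n)
    case (Suc n)
    have "coeff ([:1, 0, l:] * p) 0 = coeff p 0" "coeff ([:1, 0, l:] * p) 1 = coeff p 1"
      "coeff ([:1, 0, l:] * p) 2 = coeff p 2 + l * coeff p 0" "coeff ([:1, 0, l:] * p) 3 = coeff p 3 + l * coeff p 1"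
      "coeff ([:1, 0, l:] * p) 4 = coeff p 4 + l * coeff p 2" for p
      by (simp_all add: coeff_pCons numeral_eq_Suc)
    then show ?case unfolding power_Suc
      by (simp only: Suc.IH) (simp add: power2_eq_square field_simps)
  qed (simp add: coeff_1)
  then show "coeff ([:1, 0, l:] ^ n) 0 = 1" "coeff ([:1, 0, l:] ^ n) 1 = 0" "coeff ([:1, 0, l:] ^ n) 2 = real n * l"
    "coeff ([:1, 0, l:] ^ n) 3 = 0" "coeff ([:1, 0, l:] ^ n) 4 = real n * (real n - 1) / 2 * l\<^sup>2"
    by blast+
qed

text \<open>The product p(\<epsilon>) p(-\<epsilon>) is even, so after order two the next order that
  can decide is four.\<close>

lemma coeff_mult_reflect:
  fixes p :: "real poly"
  shows "coeff (p * pcompose p [:0, -1:]) 0 = (coeff p 0)\<^sup>2"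
    "coeff (p * pcompose p [:0, -1:]) 1 = 0"
    "coeff (p * pcompose p [:0, -1:]) 2 = 2 * coeff p 0 * coeff p 2 - (coeff p 1)\<^sup>2"
    "coeff (p * pcompose p [:0, -1:]) 3 = 0"
    "coeff (p * pcompose p [:0, -1:]) 4 = 2 * coeff p 0 * coeff p 4 - 2 * coeff p 1 * coeff p 3 + (coeff p 2)\<^sup>2"
proof -
  have "{..1::nat} = {0,1}" "{..2::nat} = {0,1,2}" "{..3::nat} = {0,1,2,3}" "{..4::nat} = {0,1,2,3,4}" by auto
  then show "coeff (p * pcompose p [:0, -1:]) 0 = (coeff p 0)\<^sup>2"
    "coeff (p * pcompose p [:0, -1:]) 1 = 0"
    "coeff (p * pcompose p [:0, -1:]) 2 = 2 * coeff p 0 * coeff p 2 - (coeff p 1)\<^sup>2"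
    "coeff (p * pcompose p [:0, -1:]) 3 = 0"
    "coeff (p * pcompose p [:0, -1:]) 4 = 2 * coeff p 0 * coeff p 4 - 2 * coeff p 1 * coeff p 3 + (coeff p 2)\<^sup>2"
    by (simp_all add: coeff_mult coeff_pcompose_linear power2_eq_square poly_0_coeff_0)
qed

text \<open>
  The shift \<open>c\<close> is the maximiser of the coefficient of $\varepsilon^4$ in the difference of the two sides
  of the first comparison.
\<close>

lemma expansion_product:
  fixes m :: nat
  assumes W: "weighted_integral m (\<lambda>s. 1) \<noteq> 0" and m: "2 \<le> m"
  defines "c \<equiv> - (real m + 2) / (real m + 5)"
  obtains l where
    "\<forall>\<^sub>F \<epsilon> in at_right 0. (1 + l * \<epsilon>\<^sup>2) ^ Suc m < poly (expansion_poly m c) \<epsilon> * poly (expansion_poly m c) (- \<epsilon>)"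
    "\<And>\<eta>. 0 < \<eta> \<Longrightarrow>
      \<forall>\<^sub>F \<epsilon> in at_right 0. poly (expansion_poly m c) \<epsilon> * poly (expansion_poly m c) (- \<epsilon>) < (1 + (l + \<eta>) * \<epsilon>\<^sup>2) ^ Suc m"
proof -
  let ?G = "expansion_poly m c"
  define d where "d = real m + 1"
  have c: "c = - (d + 1) / (d + 4)" by (simp add: c_def d_def algebra_simps)
  have d: "3 \<le> d" "real (Suc m) = d" using m by (simp_all add: d_def)
  define P where "P = ?G * pcompose ?G [:0, -1:]"
  have poly_P: "poly P \<epsilon> = poly ?G \<epsilon> * poly ?G (- \<epsilon>)" for \<epsilon> by (simp add: P_def poly_pcompose)
  have poly_Q: "poly ([:1, 0, l:] ^ Suc m) \<epsilon> = (1 + l * \<epsilon>\<^sup>2) ^ Suc m" for l \<epsilon> :: real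
    unfolding poly_power by (simp add: power2_eq_square algebra_simps)
  define g where "g = expansion_coeff m c"
  have g0: "g 0 = 1" unfolding g_def by (rule expansion_coeffs(1)[OF W])
  note g = expansion_coeffs_explicit[OF W, folded d_def, folded c g_def]
  \<comment> \<open>Chosen so that the coefficients of \<epsilon>^2 on the two sides agree.\<close>
  define l where "l = (2 * g 2 - (g 1)\<^sup>2) / d"
  have dl: "d * l = 2 * g 2 - (g 1)\<^sup>2" using d by (simp add: l_def)
  note cP = coeff_mult_reflect[of ?G, folded P_def, unfolded coeff_expansion_poly, folded g_def, unfolded g0]
  note cQ = coeff_quadratic_power[of _ "Suc m", unfolded d(2)]
  have lower: "i = 0 \<or> i = 1 \<or> i = 2 \<or> i = 3" if "i < 4" for i :: nat using that by auto
  have nz: "d \<noteq> 0" "d + 2 \<noteq> 0" "d + 4 \<noteq> 0" "d + 6 \<noteq> 0" using d by auto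
  \<comment> \<open>The difference of the coefficients of \<epsilon>^4. The factor
    \<open>d - 2\<close> is where dimension at least three enters.\<close>
  have "2 * g 4 - 2 * g 1 * g 3 + (g 2)\<^sup>2 - d * (d - 1) / 2 * l\<^sup>2
      = 6 * (d\<^sup>2 - 1) * (d - 2) * (d + 3) / ((d + 2)\<^sup>2 * (d + 4)\<^sup>2 * (d + 6))"
    unfolding l_def g using nz by (simp add: divide_simps) algebra
  also have "0 < \<dots>"
  proof -
    have "1 < d\<^sup>2" using d by (simp add: one_less_power)
    then show ?thesis using d by (intro divide_pos_pos mult_pos_pos) auto
  qed
  finally have "0 < coeff (P - [:1, 0, l:] ^ Suc m) 4" by (simp only: coeff_diff cP cQ mult_1_right)
  moreover have "coeff (P - [:1, 0, l:] ^ Suc m) i = 0" if "i < 4" for i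
    using lower[OF that] by (elim disjE) (simp_all only: coeff_diff cP cQ dl mult_1_right power_one)
  ultimately have "\<forall>\<^sub>F \<epsilon> in at_right 0. 0 < poly (P - [:1, 0, l:] ^ Suc m) \<epsilon>"
    by (intro poly_pos_at_right_0) auto
  then have 1: "\<forall>\<^sub>F \<epsilon> in at_right 0. (1 + l * \<epsilon>\<^sup>2) ^ Suc m < poly ?G \<epsilon> * poly ?G (- \<epsilon>)"
    by (simp only: poly_diff poly_P poly_Q diff_gt_0_iff_gt)
  \<comment> \<open>With \<open>l\<close> increased by \<open>\<eta>\<close>, order \<epsilon>^2
    already decides.\<close>
  have 2: "\<forall>\<^sub>F \<epsilon> in at_right 0. poly ?G \<epsilon> * poly ?G (- \<epsilon>) < (1 + (l + \<eta>) * \<epsilon>\<^sup>2) ^ Suc m" if "0 < \<eta>" for \<eta>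
  proof -
    have "coeff ([:1, 0, l + \<eta>:] ^ Suc m - P) 2 = d * \<eta>"
      by (simp only: coeff_diff cP cQ distrib_left dl)
    then have "0 < coeff ([:1, 0, l + \<eta>:] ^ Suc m - P) 2" using that d by simp
    moreover have "coeff ([:1, 0, l + \<eta>:] ^ Suc m - P) i = 0" if "i < 2" for i
    proof -
      have "i = 0 \<or> i = 1" using that by auto
      then show ?thesis by (elim disjE) (simp_all only: coeff_diff cP cQ power_one diff_self)
    qed
    ultimately have "\<forall>\<^sub>F \<epsilon> in at_right 0. 0 < poly ([:1, 0, l + \<eta>:] ^ Suc m - P) \<epsilon>"
      by (intro poly_pos_at_right_0) auto
    then show ?thesis by (simp only: poly_diff poly_P poly_Q diff_gt_0_iff_gt)
  qed
  show ?thesis by (rule that[OF 1 2])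
qed

section \<open>Failure of the inequality for bodies of revolution\<close>

context unit_axis begin

lemma vol_rev_body:
  assumes eB: "e \<in> Basis" and dim: "DIM('a) = Suc m" and ab: "2 * \<bar>b\<bar> \<le> a" "0 < a"
  shows "vol (rev_body e a b) = unit_ball_vol (real m) *
    weighted_integral m (\<lambda>s. (a - b * s\<^sup>2) ^ m * (a + 2 * b - 3 * b * s\<^sup>2))"
  unfolding measure_rev_body[OF eB ab] dim weighted_integral_def radius_def
  by (simp add: power_mult_distrib mult_ac)

text \<open>The volume formula applied to the ball itself. It provides the normalisation and shows
  that the total weight is nonzero.\<close>

lemma unit_ball_vol_weighted_integral:
  assumes eB: "e \<in> Basis" and dim: "DIM('a) = Suc m"
  shows "unit_ball_vol (real (Suc m)) = unit_ball_vol (real m) * weighted_integral m (\<lambda>s. 1)"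
proof -
  have "vol (rev_body e 1 0) = unit_ball_vol (real (Suc m))"
    using content_cball[of 1 "0::'a"] by (simp add: rev_body_cball dim measure_completion)
  then show ?thesis using vol_rev_body[OF eB dim, of 0 1] by simp
qed

text \<open>Factoring \<open>T * r\<close> out of each factor of the integrand leaves an expression
  in \<epsilon> = \<beta>/r; the signs \<beta> = 1 and \<beta> = -1 treat both bodies at once. The
  bounds on \<open>r\<close> and \<open>c\<close> keep the first parameter at least twice the
  second.\<close>

lemma vol_rev_body_shift:
  fixes c r T \<beta> :: real
  assumes eB: "e \<in> Basis" and dim: "DIM('a) = Suc m"
    and \<beta>: "\<bar>\<beta>\<bar> = 1" and c: "\<bar>c\<bar> \<le> 1" and r: "3 \<le> r" and T: "0 < T"
  shows "vol (rev_body e (T * (r + c * \<beta>)) (T * \<beta>))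
    = unit_ball_vol (real (Suc m)) * (T * r) ^ Suc m * poly (expansion_poly m c) (\<beta> / r)"
proof -
  have "\<bar>c * \<beta>\<bar> \<le> 1" using \<beta> c by (simp add: abs_mult)
  then have "2 \<le> r + c * \<beta>" using r by linarith
  then have ab: "2 * \<bar>T * \<beta>\<bar> \<le> T * (r + c * \<beta>)" "0 < T * (r + c * \<beta>)"
    using T \<beta> by (auto simp: abs_mult)
  have eq: "T * (r + c * \<beta>) - (T * \<beta>) * s\<^sup>2 = (T * r) * (1 + (\<beta> / r) * (c - s\<^sup>2))"
    "T * (r + c * \<beta>) + 2 * (T * \<beta>) - 3 * (T * \<beta>) * s\<^sup>2 = (T * r) * (1 + (\<beta> / r) * (c + 2 - 3 * s\<^sup>2))" for s
    using r by (simp_all add: field_simps)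
  let ?g = "\<lambda>s. (1 + (\<beta> / r) * (c - s\<^sup>2)) ^ m * (1 + (\<beta> / r) * (c + 2 - 3 * s\<^sup>2))"
  have W: "weighted_integral m (\<lambda>s. 1) \<noteq> 0"
    using unit_ball_vol_weighted_integral[OF eB dim] unit_ball_vol_pos[of "real (Suc m)"]
    by (auto simp del: unit_ball_vol_pos)
  have "vol (rev_body e (T * (r + c * \<beta>)) (T * \<beta>))
      = unit_ball_vol (real m) * weighted_integral m (\<lambda>s. (T * r) ^ Suc m * ?g s)"
    unfolding vol_rev_body[OF eB dim ab] eq by (simp only: power_mult_distrib power_Suc mult_ac)
  also have "weighted_integral m (\<lambda>s. (T * r) ^ Suc m * ?g s) = (T * r) ^ Suc m * weighted_integral m ?g"
    by (rule weighted_integral_cmult)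
  also have "weighted_integral m ?g = weighted_integral m (\<lambda>s. 1) * poly (expansion_poly m c) (\<beta> / r)"
    using W by (simp add: poly_expansion_poly)
  finally show ?thesis
    unfolding unit_ball_vol_weighted_integral[OF eB dim] by (simp only: mult_ac)
qed

text \<open>All positive dilates are asserted to be zonoids, so that a single violating pair can
  later be taken at some large \<open>t\<close>.\<close>

lemma eventually_violated:
  assumes eB: "e \<in> Basis" and dim: "3 \<le> DIM('a)"
  shows "\<exists>B C. (\<forall>t>0. zonoid ((*\<^sub>R) t ` B) \<and> zonoid ((*\<^sub>R) t ` C)) \<and> B + C = (*\<^sub>R) 2 ` cball 0 1 \<and>
    (\<forall>\<^sub>F t in at_top. \<not> volume_ineq ((*\<^sub>R) t ` B) ((*\<^sub>R) t ` C :: 'a set))"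
proof -
  obtain m where dim_m: "DIM('a) = Suc m" and m: "2 \<le> m" using dim by (cases "DIM('a)") auto
  define n where "n = Suc m"
  have n: "0 < n" "DIM('a) = n" by (simp_all add: n_def dim_m)
  define c where "c = - (real m + 2) / (real m + 5)"
  have c: "\<bar>c\<bar> \<le> 1" by (simp add: c_def)
  define \<kappa> where "\<kappa> = unit_ball_vol (real n)"
  have \<kappa>: "0 < \<kappa>" by (simp add: \<kappa>_def)
  have W: "weighted_integral m (\<lambda>s. 1) \<noteq> 0"
    using unit_ball_vol_weighted_integral[OF eB dim_m] unit_ball_vol_pos[of "real (Suc m)"]
    by (auto simp del: unit_ball_vol_pos)
  \<comment> \<open>The product of the two volumes, each relative to the ball of radius
    \<open>r\<close>.\<close>
  define q where "q r = poly (expansion_poly m c) (1 / r) * poly (expansion_poly m c) (- (1 / r))" for r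
  obtain l where l: "\<forall>\<^sub>F r in at_top. (1 + l * (1 / r)\<^sup>2) ^ n < q r"
    "\<And>\<eta>. 0 < \<eta> \<Longrightarrow> \<forall>\<^sub>F r in at_top. q r < (1 + (l + \<eta>) * (1 / r)\<^sup>2) ^ n"
  proof (rule expansion_product[OF W m, folded c_def n_def])
    fix l
    assume *: "\<forall>\<^sub>F \<epsilon> in at_right 0. (1 + l * \<epsilon>\<^sup>2) ^ n < poly (expansion_poly m c) \<epsilon> * poly (expansion_poly m c) (- \<epsilon>)"
      "\<And>\<eta>. 0 < \<eta> \<Longrightarrow>
      \<forall>\<^sub>F \<epsilon> in at_right 0. poly (expansion_poly m c) \<epsilon> * poly (expansion_poly m c) (- \<epsilon>) < (1 + (l + \<eta>) * \<epsilon>\<^sup>2) ^ n"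
    show thesis
      by (rule that[of l]; unfold q_def; use * in \<open>simp add: eventually_at_right_to_top inverse_eq_divide\<close>)
  qed
  have small: "\<forall>\<^sub>F r in at_top. 0 < 1 + a * (1 / r)\<^sup>2" for a :: real
  proof -
    have "((\<lambda>r::real. 1 + a * (1 / r)\<^sup>2) \<longlongrightarrow> 1 + a * 0\<^sup>2) at_top"
      by (intro tendsto_intros) (simp add: tendsto_inverse_0_at_top filterlim_ident flip: inverse_eq_divide)
    then show ?thesis by (rule order_tendstoD(1)) simp
  qed
  define \<kappa>2 where "\<kappa>2 = root n \<kappa> * root n \<kappa>"
  have \<kappa>2: "0 < \<kappa>2" using \<kappa> n by (simp add: \<kappa>2_def)
  \<comment> \<open>The n-th root of the product of volumes minus kappa^(2/n) r^2, with
    \<open>\<kappa>2\<close> = kappa^(2/n) factored out.\<close>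
  define D where "D r = \<kappa>2 * (r\<^sup>2 * (root n (q r) - 1))" for r
  have D_eq: "\<kappa>2 * (r\<^sup>2 * ((1 + a * (1 / r)\<^sup>2) - 1)) = \<kappa>2 * a" if "0 < r" for a r :: real
    using that by (simp add: power2_eq_square)
  have above: "\<forall>\<^sub>F r in at_top. \<kappa>2 * l < D r"
    using l(1) small[of l] eventually_gt_at_top[of 0]
  proof eventually_elim
    case (elim r)
    then have "1 + l * (1 / r)\<^sup>2 < root n (q r)"
      using real_root_less_mono[OF n(1), of "(1 + l * (1 / r)\<^sup>2) ^ n"] n(1) by (simp add: real_root_power_cancel)
    then show ?case
      unfolding D_def D_eq[OF elim(3), of l, symmetric] using \<kappa>2 elim(3) by simp
  qed
  have limit: "\<forall>\<^sub>F r in at_top. D r < \<kappa>2 * l + \<eta>" if "0 < \<eta>" for \<eta>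
  proof -
    let ?a = "l + \<eta> / \<kappa>2"
    have "0 < \<eta> / \<kappa>2" using that \<kappa>2 by simp
    from l(2)[OF this] small[of ?a] eventually_gt_at_top[of 0] show ?thesis
    proof eventually_elim
      case (elim r)
      then have "root n (q r) < 1 + ?a * (1 / r)\<^sup>2"
        using real_root_less_mono[OF n(1), of _ "(1 + ?a * (1 / r)\<^sup>2) ^ n"] n(1) by (simp add: real_root_power_cancel)
      then have "D r < \<kappa>2 * ?a"
        unfolding D_def D_eq[OF elim(3), of ?a, symmetric] using \<kappa>2 elim(3) by simp
      then show ?case using \<kappa>2 by (simp add: distrib_left)
    qed
  qed
  obtain M where M: "\<And>a b. 2 * \<bar>b\<bar> \<le> a \<Longrightarrow> M * \<bar>b\<bar> \<le> a \<Longrightarrow> zonoid (rev_body e a b)"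
    using zonoid_rev_body dim by (metis One_nat_def Suc_1 Suc_leD numeral_3_eq_3)
  have "\<forall>\<^sub>F r in at_top. 0 < q r"
    using l(1) small[of l] by eventually_elim (meson less_trans zero_less_power)
  then obtain r1 where r1: "\<And>r. r1 \<le> r \<Longrightarrow> 0 < q r" unfolding eventually_at_top_linorder by blast
  \<comment> \<open>Beyond \<open>r0\<close> both bodies are admissible, the zonoid condition
    survives the shift by \<open>c\<close>, and the root is taken at a positive argument, where it
    is differentiable.\<close>
  define r0 where "r0 = max r1 (\<bar>M\<bar> + 3)"
  have r0: "3 \<le> r" "M + 1 \<le> r" "0 < q r" if "r0 < r" for r using that r1[of r] by (auto simp: r0_def)
  have "D differentiable at r" if r: "r0 < r" for r
  proof -
    have "((\<lambda>r. 1 / r) has_real_derivative - (1 / r\<^sup>2)) (at r)" "((\<lambda>r. - (1 / r)) has_real_derivative 1 / r\<^sup>2) (at r)"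
      using r0[OF r] by (auto intro!: derivative_eq_intros simp: power2_eq_square)
    from DERIV_mult[OF DERIV_chain2[OF poly_DERIV this(1)] DERIV_chain2[OF poly_DERIV this(2)]]
    obtain q' where "(q has_real_derivative q') (at r)" unfolding q_def[abs_def] by blast
    then have "((\<lambda>r. root n (q r)) has_real_derivative inverse (real n * root n (q r) ^ (n - Suc 0)) * q') (at r)"
      by (rule DERIV_chain2[where f = "root n" and g = q and x = r, OF DERIV_real_root[OF n(1) r0(3)[OF r]]])
    then show ?thesis unfolding D_def[abs_def]
      by (intro differentiable_mult differentiable_diff differentiable_const differentiable_power differentiable_ident)
         (auto simp: real_differentiable_def)
  qed
  \<comment> \<open>From here on \<open>r\<close> is fixed, and with it \<open>B\<close> and
    \<open>C\<close>; only \<open>t\<close> still varies.\<close>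
  from decreasing_above_limit[OF this above limit] obtain r \<delta> where r: "r0 < r" and "0 < \<delta>"
    and dec: "\<And>h. 0 < h \<Longrightarrow> h < \<delta> \<Longrightarrow> D (r + h) < D r" by blast
  have r3: "3 \<le> r" using r0[OF r] by simp
  have le2: "2 \<le> r + h + c" "2 \<le> r + h - c" if "0 \<le> h" for h using r3 c that by linarith+
  define B where "B = rev_body e ((r + c) / r) (1 / r)"
  define C where "C = rev_body e ((r - c) / r) (- 1 / r)"
  have tB: "(*\<^sub>R) t ` B = rev_body e (t / r * (r + c)) (t / r)"
    and tC: "(*\<^sub>R) t ` C = rev_body e (t / r * (r - c)) (- (t / r))" if "0 < t" for t
    using rev_body_scaleR[OF that] by (simp_all add: B_def C_def)
  have ok: "2 * \<bar>T\<bar> \<le> T * (r + h + c)" "2 * \<bar>- T\<bar> \<le> T * (r + h - c)" if "0 < T" "0 \<le> h" for T h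
    using le2[OF that(2)] that(1) by auto
  have zon: "zonoid ((*\<^sub>R) t ` B) \<and> zonoid ((*\<^sub>R) t ` C)" if "0 < t" for t
  proof -
    have T: "0 < t / r" using that r3 by simp
    have "M \<le> r + c" "M \<le> r - c" using r0(2)[OF r] c by linarith+
    then have "M * \<bar>t / r\<bar> \<le> t / r * (r + c)" "M * \<bar>- (t / r)\<bar> \<le> t / r * (r - c)"
      unfolding abs_minus_cancel abs_of_pos[OF T] mult.commute[of M]
      using T by (intro mult_left_mono; simp)+
    then show ?thesis unfolding tB[OF that] tC[OF that]
      using ok[OF T, of 0] by (intro conjI M) auto
  qed
  have "B + C = rev_body e ((r + c) / r + (r - c) / r) (1 / r + - 1 / r)"
    unfolding B_def C_def using ok[of "1 / r" 0] r3 by (intro rev_body_plus) auto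
  also have "\<dots> = rev_body e (2 * 1) (2 * 0)" using r3 by (simp flip: add_divide_distrib)
  also have "\<dots> = (*\<^sub>R) 2 ` rev_body e 1 0" by (rule rev_body_scaleR[symmetric]) simp
  finally have BC: "B + C = (*\<^sub>R) 2 ` cball 0 1" by (simp add: rev_body_cball)
  \<comment> \<open>Used with \<open>h = 0\<close> for the dilates and with \<open>h = r / t\<close>
    for their sums with the unit ball.\<close>
  have prod: "root n (vol (rev_body e (T * (r + h + c)) T) * vol (rev_body e (T * (r + h - c)) (- T)))
      = T\<^sup>2 * (D (r + h) + \<kappa>2 * (r + h)\<^sup>2)" if T: "0 < T" and h: "0 \<le> h" for T h
  proof -
    have rh: "3 \<le> r + h" using r3 h by simp
    have "vol (rev_body e (T * (r + h + c)) T) * vol (rev_body e (T * (r + h - c)) (- T))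
        = \<kappa> * \<kappa> * (T * (r + h)) ^ n * (T * (r + h)) ^ n * q (r + h)"
      using vol_rev_body_shift[OF eB dim_m _ c rh T, of 1] vol_rev_body_shift[OF eB dim_m _ c rh T, of "-1"]
      by (simp add: \<kappa>_def n_def q_def)
    then have "root n (vol (rev_body e (T * (r + h + c)) T) * vol (rev_body e (T * (r + h - c)) (- T)))
        = \<kappa>2 * (T * (r + h)) * (T * (r + h)) * root n (q (r + h))"
      using T rh n(1) by (simp add: real_root_mult \<kappa>2_def real_root_power_cancel)
    also have "\<dots> = T\<^sup>2 * (D (r + h) + \<kappa>2 * (r + h)\<^sup>2)"
      by (simp add: D_def power2_eq_square algebra_simps)
    finally show ?thesis .
  qed
  have "\<not> volume_ineq ((*\<^sub>R) t ` B) ((*\<^sub>R) t ` C)" if t: "0 < t" "r / \<delta> < t" for t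
  proof
    \<comment> \<open>Since \<open>T * h = 1\<close>, adding the unit ball replaces \<open>r\<close>
      by \<open>r + h\<close> at the same scale \<open>T\<close>. The bound on \<open>t\<close> puts
      \<open>h\<close> below \<open>\<delta>\<close>.\<close>
    define T where "T = t / r"
    define h where "h = r / t"
    have T: "0 < T" and h: "0 < h" and Th: "T * h = 1" using t r3 by (simp_all add: T_def h_def)
    have "h < \<delta>" using t \<open>0 < \<delta>\<close> by (simp add: h_def divide_less_eq mult.commute)
    have ball: "cball (0::'a) 1 = rev_body e 1 0" by (simp add: rev_body_cball)
    have okT: "2 * \<bar>T\<bar> \<le> T * (r + c)" "2 * \<bar>- T\<bar> \<le> T * (r - c)" using ok[OF T, of 0] by simp_all
    have "1 + T * (r + c) = T * (r + h + c)" "1 + T * (r - c) = T * (r + h - c)"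
      using Th by (simp_all add: algebra_simps)
    then have plus: "cball 0 1 + (*\<^sub>R) t ` B = rev_body e (T * (r + h + c)) T"
      "cball 0 1 + (*\<^sub>R) t ` C = rev_body e (T * (r + h - c)) (- T)"
      unfolding tB[OF t(1)] tC[OF t(1)] ball T_def[symmetric]
      using rev_body_plus[of 0 1 T] rev_body_plus[of 0 1 "- T"] okT by simp_all
    have "T * (r + h + c) + T * (r - c) = 1 + 2 * T * r" using Th by (simp add: algebra_simps)
    then have "cball 0 1 + (*\<^sub>R) t ` B + (*\<^sub>R) t ` C = rev_body e (1 + 2 * T * r) 0"
      unfolding plus tC[OF t(1)] T_def[symmetric]
      using rev_body_plus[of T "T * (r + h + c)" "- T" "T * (r - c)"] okT ok[OF T, of h] h by simp
    also have "\<dots> = cball 0 (1 + 2 * T * r)" using T r3 by (intro rev_body_cball) simp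
    finally have "vol (cball 0 1 + (*\<^sub>R) t ` B + (*\<^sub>R) t ` C) = \<kappa> * (1 + 2 * T * r) ^ n"
      using content_cball[of "1 + 2 * T * r" "0::'a"] T r3 by (simp add: measure_completion \<kappa>_def n)
    moreover have "vol (cball (0::'a) 1) = \<kappa>"
      using content_cball[of 1 "0::'a"] by (simp add: measure_completion \<kappa>_def n)
    moreover have "0 \<le> 1 + 2 * T * r" using T r3 by simp
    ultimately have sum: "root n (vol (cball (0::'a) 1) * vol (cball 0 1 + (*\<^sub>R) t ` B + (*\<^sub>R) t ` C)) = \<kappa>2 * (1 + 2 * T * r)"
      using n(1) by (simp add: real_root_mult real_root_power_cancel \<kappa>2_def)
    have prod0: "root n (vol ((*\<^sub>R) t ` B) * vol ((*\<^sub>R) t ` C)) = T\<^sup>2 * (D r + \<kappa>2 * r\<^sup>2)"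
      unfolding tB[OF t(1)] tC[OF t(1)] T_def[symmetric] using prod[OF T, of 0] by simp
    have prodh: "root n (vol (cball 0 1 + (*\<^sub>R) t ` B)) * root n (vol (cball 0 1 + (*\<^sub>R) t ` C))
        = T\<^sup>2 * (D (r + h) + \<kappa>2 * (r + h)\<^sup>2)"
      unfolding plus real_root_mult[symmetric] using prod[OF T, of h] h by simp
    assume "volume_ineq ((*\<^sub>R) t ` B) ((*\<^sub>R) t ` C)"
    then have "T\<^sup>2 * (D r + \<kappa>2 * r\<^sup>2) + \<kappa>2 * (1 + 2 * T * r) \<le> T\<^sup>2 * (D (r + h) + \<kappa>2 * (r + h)\<^sup>2)"
      unfolding volume_ineq_def n(2) prod0 prodh sum .
    \<comment> \<open>The squares differ by \<open>1 + 2 * T * r\<close>, the radius of the ball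
      that is the full Minkowski sum; what remains compares two values of \<open>D\<close>.\<close>
    moreover have "T\<^sup>2 * (r + h)\<^sup>2 = (T * r + T * h)\<^sup>2" by (simp add: power2_eq_square algebra_simps)
    then have "T\<^sup>2 * (r + h)\<^sup>2 = T\<^sup>2 * r\<^sup>2 + 2 * T * r + 1"
      unfolding Th by (simp add: power2_eq_square algebra_simps)
    then have "T\<^sup>2 * (D (r + h) + \<kappa>2 * (r + h)\<^sup>2) = T\<^sup>2 * D (r + h) + \<kappa>2 * (T\<^sup>2 * r\<^sup>2 + 2 * T * r + 1)"
      by (metis distrib_left mult.left_commute)
    ultimately have "T\<^sup>2 * D r \<le> T\<^sup>2 * D (r + h)" by (simp add: algebra_simps)
    then have "D r \<le> D (r + h)" using T by simp
    then show False using dec[OF h \<open>h < \<delta>\<close>] by simp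
  qed
  then have "\<forall>\<^sub>F t in at_top. \<not> volume_ineq ((*\<^sub>R) t ` B) ((*\<^sub>R) t ` C)"
    using eventually_conj[OF eventually_gt_at_top[of 0] eventually_gt_at_top[of "r / \<delta>"]]
    by (elim eventually_mono) blast
  with zon BC show ?thesis by blast
qed

end

section \<open>Volumes of zonotopes in dimension three\<close>

lemma linear_image_set_plus:
  assumes "linear f" shows "f ` (A + B) = f ` A + f ` B"
proof -
  have "f ` (A + B) = (\<lambda>(x, y). f x + f y) ` (A \<times> B)"
    unfolding set_plus_image image_image by (intro image_cong) (auto simp: linear_add[OF assms])
  then show ?thesis unfolding set_plus_image by (auto simp: image_iff) 
qed

lemma linear_image_seg: "linear f \<Longrightarrow> f ` seg v = seg (f v)"
  by (simp add: linear_neg flip: closed_segment_linear_image)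

lemma convex_body_linear_image:
  fixes f :: "'a::euclidean_space \<Rightarrow> 'b::euclidean_space"
  assumes "convex_body K" "linear f" shows "convex_body (f ` K)"
  using assms linear_continuous_on[OF assms(2)[unfolded linear_conv_bounded_linear], of K]
  by (auto simp: convex_body_def convex_linear_image intro: compact_continuous_image)

lemma convex_body_real:
  fixes S :: "real set" assumes "convex_body S" obtains a b where "a \<le> b" "S = {a..b}"
proof -
  have "connected S" "compact S" "S \<noteq> {}" using assms by (auto simp: convex_body_def convex_connected)
  then show ?thesis using connected_compact_interval_1[of S] that by (metis atLeastatMost_empty_iff box_real(2))
qed

lemma seg_real: "seg (d::real) = {- \<bar>d\<bar>..\<bar>d\<bar>}"
  by (auto simp: closed_segment_eq_real_ivl abs_if)

lemma Icc_plus_seg: "a \<le> b \<Longrightarrow> {a..b} + seg d = {a - \<bar>d\<bar>..b + \<bar>d :: real\<bar>}"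
proof (intro equalityI subsetI)
  fix x assume *: "a \<le> b" "x \<in> {a - \<bar>d\<bar>..b + \<bar>d\<bar>}"
  \<comment> \<open>The point of the interval nearest to \<open>x\<close>.\<close>
  define y where "y = max a (min b x)"
  have "y \<in> {a..b}" "x - y \<in> seg d" using * by (auto simp: y_def seg_real max_def min_def)
  then have "y + (x - y) \<in> {a..b} + seg d" by (rule set_plus_intro)
  then show "x \<in> {a..b} + seg d" by simp
qed (auto simp: seg_real elim!: set_plus_elim)

lemma convex_body_sets: "convex_body K \<Longrightarrow> K \<in> sets borel"
  by (simp add: convex_body_def borel_compact)

lemma convex_body_finite: "convex_body K \<Longrightarrow> emeasure lborel K < \<infinity>"
  using emeasure_compact_finite[of K] by (simp add: convex_body_def)

lemma convex_body_emeasure: "convex_body K \<Longrightarrow> emeasure lborel K = ennreal (vol K)"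
  using emeasure_eq_ennreal_measure[of lborel K] convex_body_finite[of K] convex_body_sets[of K]
  by (simp add: measure_completion less_top)

lemma convex_body_lmeasurable: "convex_body K \<Longrightarrow> K \<in> lmeasurable"
  by (simp add: convex_body_def lmeasurable_compact)

text \<open>Adding a vertical segment lengthens every nonempty vertical section by the same amount.\<close>

lemma vol_plus_vertical_seg:
  fixes K :: "('a::euclidean_space \<times> real) set"
  assumes K: "convex_body K"
  shows "vol (K + seg (0, d)) = vol K + 2 * \<bar>d\<bar> * vol (fst ` K)"
proof -
  let ?K' = "K + seg (0, d)"
  have K': "convex_body ?K'" by (intro convex_body_plus K convex_body_seg)
  have fK: "convex_body (fst ` K)" by (intro convex_body_linear_image K linear_fst)
  have pair_sets: "S \<in> sets ((lborel :: 'a measure) \<Otimes>\<^sub>M (lborel :: real measure))"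
    if "convex_body S" for S :: "('a \<times> real) set"
    unfolding lborel_prod using convex_body_sets[OF that] by simp
  have em: "emeasure lborel S = (\<integral>\<^sup>+x. emeasure lborel (Pair x -` S) \<partial>lborel)"
    if "convex_body S" for S :: "('a \<times> real) set"
    using sigma_finite_measure.emeasure_pair_measure_alt[OF sigma_finite_lborel pair_sets[OF that]]
    unfolding lborel_prod .
  have seg: "seg (0::'a, d) = {0} \<times> seg d"
  proof -
    have "linear (Pair (0::'a) :: real \<Rightarrow> _)" by (intro linearI) auto
    from linear_image_seg[OF this, of d] show ?thesis by auto
  qed
  \<comment> \<open>Empty sections stay empty, which is why the indicator of the projection
    appears.\<close>
  have slice: "emeasure lborel (Pair x -` ?K') = emeasure lborel (Pair x -` K) + ennreal (2 * \<bar>d\<bar>) * indicator (fst ` K) x" for x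
  proof -
    have eq: "Pair x -` ?K' = Pair x -` K + seg d"
      unfolding seg by (auto simp: set_plus_def; force)
    show ?thesis
    proof (cases "x \<in> fst ` K")
      case True
      have 1: "Pair x -` K = snd ` (K \<inter> ({x} \<times> UNIV))" by force
      have "closed ({x} \<times> (UNIV :: real set))" by (intro closed_Times) auto
      then have "compact (K \<inter> ({x} \<times> UNIV))" using K by (auto simp: convex_body_def intro: compact_Int_closed)
      moreover have "convex (K \<inter> ({x} \<times> UNIV))" using K by (intro convex_Int convex_Times) (auto simp: convex_body_def)
      moreover have "K \<inter> ({x} \<times> UNIV) \<noteq> {}" using True by auto
      ultimately have "convex_body (K \<inter> ({x} \<times> UNIV))" by (simp add: convex_body_def)
      then have "convex_body (Pair x -` K)" unfolding 1 by (rule convex_body_linear_image) (rule linear_snd)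
      then obtain a b where "a \<le> b" "Pair x -` K = {a..b}" by (rule convex_body_real)
      then show ?thesis using True unfolding eq by (simp add: Icc_plus_seg flip: ennreal_plus)
    next
      case False
      then have "Pair x -` K = {}" by force
      then show ?thesis using False unfolding eq by (simp add: set_plus_def)
    qed
  qed
  have [measurable]: "(\<lambda>x. emeasure lborel (Pair x -` K)) \<in> borel_measurable borel" "fst ` K \<in> sets borel"
    using sigma_finite_measure.measurable_emeasure_Pair[OF sigma_finite_lborel pair_sets[OF K]]
      convex_body_sets[OF fK] by simp_all
  have "emeasure lborel ?K' = emeasure lborel K + ennreal (2 * \<bar>d\<bar>) * emeasure lborel (fst ` K)"
    unfolding em[OF K'] slice em[OF K] by (subst nn_integral_add) (simp_all add: nn_integral_cmult)
  then have "ennreal (vol ?K') = ennreal (vol K) + ennreal (2 * \<bar>d\<bar>) * ennreal (vol (fst ` K))"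
    unfolding convex_body_emeasure[OF K] convex_body_emeasure[OF K'] convex_body_emeasure[OF fK] .
  also have "\<dots> = ennreal (vol K + 2 * \<bar>d\<bar> * vol (fst ` K))"
    by (simp add: ennreal_plus ennreal_mult'')
  finally show ?thesis by (subst (asm) ennreal_inj) simp_all
qed

lemma box_Pair: "box (a, c) (b, d) = box a b \<times> box c d"
  by (auto simp: box_def Basis_prod_def ball_Un)

section \<open>Coordinate frames and second differences of the volume\<close>

unbundle cross3_syntax

text \<open>The pairs are nested so that \<open>vol_plus_vertical_seg\<close> applies twice: to the
  last coordinate, and then to the middle one after projection by \<open>fst\<close>.\<close>

type_synonym coords = "(real \<times> real) \<times> real"

definition frame :: "real^3 \<Rightarrow> real^3 \<Rightarrow> real^3 \<Rightarrow> coords \<Rightarrow> real^3" where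
  "frame u v w p = fst (fst p) *\<^sub>R u + snd (fst p) *\<^sub>R v + snd p *\<^sub>R w"

lemma linear_frame: "linear (frame u v w)"
  by (intro linearI) (auto simp: frame_def algebra_simps)

text \<open>Identifies Lebesgue measure on the nested product with that on \<open>real^3\<close>.
  Both give boxes the product of the side lengths, which determines the measure.\<close>

lemma distr_frame_axes:
  "distr (lborel :: coords measure) borel (frame (axis 1 1) (axis 2 1) (axis 3 1)) = lborel"
proof (rule lborel_eqI[symmetric])
  let ?f = "frame (axis 1 1) (axis 2 1) (axis 3 1)"
  fix l u :: "real^3" assume lu: "\<And>b. b \<in> Basis \<Longrightarrow> l \<bullet> b \<le> u \<bullet> b"
  have le: "l $ i \<le> u $ i" for i using lu[of "axis i 1"] by (simp add: axis_in_Basis_iff inner_axis)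
  have comp: "?f p $ 1 = fst (fst p)" "?f p $ 2 = snd (fst p)" "?f p $ 3 = snd p" for p
    by (simp_all add: frame_def axis_def)
  have vim: "?f -` box l u = box ((l $ 1, l $ 2), l $ 3) ((u $ 1, u $ 2), u $ 3)"
    by (auto simp: mem_box_cart forall_3 comp box_Pair)
  have [measurable]: "?f \<in> borel_measurable borel"
    by (intro borel_measurable_continuous_onI linear_continuous_on linear_frame[unfolded linear_conv_bounded_linear])
  have "emeasure (distr lborel borel ?f) (box l u) = emeasure lborel (box ((l $ 1, l $ 2), l $ 3) ((u $ 1, u $ 2), u $ 3))"
    by (subst emeasure_distr) (simp_all add: vim)
  also have "\<dots> = emeasure lborel {l $ 1<..<u $ 1} * emeasure lborel {l $ 2<..<u $ 2} * emeasure lborel {l $ 3<..<u $ 3}"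
    unfolding box_Pair lborel_prod[symmetric] box_real
    by (simp only: lborel.emeasure_pair_measure_Times pair_measureI sets_lborel borel_open open_greaterThanLessThan)
  also have "\<dots> = ennreal ((u $ 1 - l $ 1) * (u $ 2 - l $ 2) * (u $ 3 - l $ 3))"
    using le[of 1] le[of 2] le[of 3] by (simp add: ennreal_mult)
  also have "(u $ 1 - l $ 1) * (u $ 2 - l $ 2) * (u $ 3 - l $ 3) = (\<Prod>b\<in>Basis. (u - l) \<bullet> b)"
  proof -
    have Basis3: "(Basis :: (real^3) set) = {axis 1 1, axis 2 1, axis 3 1}" by (auto simp: Basis_vec_def UNIV_3)
    show ?thesis unfolding Basis3 by (simp add: axis_eq_axis inner_axis)
  qed
  finally show "emeasure (distr lborel borel ?f) (box l u) = (\<Prod>b\<in>Basis. (u - l) \<bullet> b)" by simp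
qed simp

text \<open>The map is the coordinate identification followed by an endomorphism of
  \<open>real^3\<close>, whose determinant is the triple product.\<close>

lemma vol_frame:
  assumes K: "convex_body K"
  shows "vol (frame u v w ` K) = \<bar>u \<bullet> (v \<times> w)\<bar> * vol K"
proof -
  let ?E = "frame (axis 1 1) (axis 2 1) (axis 3 1)"
  define f where "f x = x $ 1 *\<^sub>R u + x $ 2 *\<^sub>R v + x $ 3 *\<^sub>R w" for x :: "real^3"
  have f: "linear f" by (intro linearI) (auto simp: f_def algebra_simps)
  have "frame u v w p = f (?E p)" for p by (simp add: f_def frame_def axis_def)
  then have im: "frame u v w ` K = f ` ?E ` K" by (simp add: image_image)
  have EK: "convex_body (?E ` K)" by (rule convex_body_linear_image[OF K linear_frame])
  have "det (matrix f) = u \<bullet> (v \<times> w)"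
    by (simp add: matrix_def f_def axis_def det_3 cross3_simps)
  then have "vol (frame u v w ` K) = \<bar>u \<bullet> (v \<times> w)\<bar> * vol (?E ` K)"
    unfolding im using measure_linear_image[OF f convex_body_lmeasurable[OF EK]] by simp
  also have "vol (?E ` K) = vol K"
  proof -
    have "inj ?E" by (intro injI) (auto simp: frame_def vec_eq_iff forall_3 axis_def)
    have [measurable]: "?E \<in> borel_measurable borel"
      by (intro borel_measurable_continuous_onI linear_continuous_on linear_frame[unfolded linear_conv_bounded_linear])
    have "emeasure lborel (?E ` K) = emeasure (distr lborel borel ?E) (?E ` K)" by (simp add: distr_frame_axes)
    also have "\<dots> = emeasure lborel K"
      using convex_body_sets[OF EK] by (subst emeasure_distr) (simp_all add: inj_vimage_image_eq[OF \<open>inj ?E\<close>])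
    finally show ?thesis using K EK by (simp add: convex_body_emeasure ennreal_inj)
  qed
  finally show ?thesis .
qed

text \<open>The three coordinates of (x . (v x w)) u + (x . (w x u)) v + (x . (u x v)) w = (u . (v x
  w)) x.\<close>

lemma cramer3:
  fixes x1 :: real
  shows "((x1 * (v2 * w3 - w2 * v3) + x2 * (v3 * w1 - w3 * v1) + x3 * (v1 * w2 - w1 * v2)) * u1
      + (x1 * (w2 * u3 - u2 * w3) + x2 * (w3 * u1 - u3 * w1) + x3 * (w1 * u2 - u1 * w2)) * v1)
      + (x1 * (u2 * v3 - v2 * u3) + x2 * (u3 * v1 - v3 * u1) + x3 * (u1 * v2 - v1 * u2)) * w1
      = (u1 * (v2 * w3 - w2 * v3) + u2 * (v3 * w1 - w3 * v1) + u3 * (v1 * w2 - w1 * v2)) * x1"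
    "((x1 * (v2 * w3 - w2 * v3) + x2 * (v3 * w1 - w3 * v1) + x3 * (v1 * w2 - w1 * v2)) * u2
      + (x1 * (w2 * u3 - u2 * w3) + x2 * (w3 * u1 - u3 * w1) + x3 * (w1 * u2 - u1 * w2)) * v2)
      + (x1 * (u2 * v3 - v2 * u3) + x2 * (u3 * v1 - v3 * u1) + x3 * (u1 * v2 - v1 * u2)) * w2
      = (u1 * (v2 * w3 - w2 * v3) + u2 * (v3 * w1 - w3 * v1) + u3 * (v1 * w2 - w1 * v2)) * x2"
    "((x1 * (v2 * w3 - w2 * v3) + x2 * (v3 * w1 - w3 * v1) + x3 * (v1 * w2 - w1 * v2)) * u3
      + (x1 * (w2 * u3 - u2 * w3) + x2 * (w3 * u1 - u3 * w1) + x3 * (w1 * u2 - u1 * w2)) * v3)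
      + (x1 * (u2 * v3 - v2 * u3) + x2 * (u3 * v1 - v3 * u1) + x3 * (u1 * v2 - v1 * u2)) * w3
      = (u1 * (v2 * w3 - w2 * v3) + u2 * (v3 * w1 - w3 * v1) + u3 * (v1 * w2 - w1 * v2)) * x3"
  by algebra+

text \<open>Cramer's rule inverts the frame: the coordinates of \<open>x\<close> are its inner
  products with the three cross products, divided by the determinant.\<close>

lemma frame_coords:
  fixes K :: "(real^3) set"
  assumes K: "convex_body K" and D: "u \<bullet> (v \<times> w) \<noteq> 0"
  obtains L where "convex_body L" "K = frame u v w ` L"
proof -
  let ?D = "u \<bullet> (v \<times> w)"
  define g where "g x = ((x \<bullet> (v \<times> w) / ?D, x \<bullet> (w \<times> u) / ?D), x \<bullet> (u \<times> v) / ?D)" for x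
  have g: "linear g" by (intro linearI) (auto simp: g_def inner_add_left add_divide_distrib)
  have "?D *\<^sub>R frame u v w (g x) = (x \<bullet> (v \<times> w)) *\<^sub>R u + (x \<bullet> (w \<times> u)) *\<^sub>R v + (x \<bullet> (u \<times> v)) *\<^sub>R w" for x
    using D by (simp add: frame_def g_def scaleR_add_right)
  also have "\<dots> x = ?D *\<^sub>R x" for x
  proof -
    show ?thesis by (simp add: vec_eq_iff forall_3 cross_components inner_vec_def sum_3 cramer3)
  qed
  finally have "frame u v w (g x) = x" for x using D by simp
  then have "K = frame u v w ` g ` K" by (simp add: image_image)
  with convex_body_linear_image[OF K g] show ?thesis by (rule that)
qed

text \<open>For a unit vector the usual width, in general |c| times the width in direction
  \<open>c\<close>. With \<open>c = w \<times> v\<close> this factor is the area of the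
  parallelogram spanned by \<open>w\<close> and \<open>v\<close>.\<close>

definition width :: "real^3 \<Rightarrow> (real^3) set \<Rightarrow> real" where
  "width c K = vol ((\<lambda>x. x \<bullet> c) ` K)"

text \<open>In a frame whose last two vectors are \<open>w\<close> and \<open>v\<close>, both
  segments are parallel to coordinate axes. The increment due to \<open>seg v\<close> is twice the
  area of the projection along \<open>v\<close>, and \<open>seg w\<close> enlarges that area by
  twice the length of the double projection.\<close>

lemma vol_plus_seg_twice:
  assumes K: "convex_body K" and vw: "v \<times> w \<noteq> 0"
  shows "vol (K + seg w + seg v) = vol (K + seg w) + (vol (K + seg v) - vol K) + 4 * width (w \<times> v) K"
proof -
  define u where "u = w \<times> v"
  have wv: "w \<times> v \<noteq> 0" using vw cross_skew[of w v] by simp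
  let ?D = "u \<bullet> (w \<times> v)"
  have D: "?D > 0" using wv by (simp add: u_def)
  obtain L where L: "convex_body L" "K = frame u w v ` L" using frame_coords[OF K, of u w v] D by auto
  have lin: "linear (fst :: coords \<Rightarrow> _)" "linear (fst :: real \<times> real \<Rightarrow> _)" by (rule linear_fst)+
  have sv: "seg v = frame u w v ` seg (0, 1)" and sw: "seg w = frame u w v ` seg ((0, 1), 0)"
    unfolding linear_image_seg[OF linear_frame] by (simp_all add: frame_def)
  note L' = convex_body_plus[OF L(1) convex_body_seg]
  note L'' = convex_body_plus[OF L' convex_body_seg]
  have eqs: "K + seg v = frame u w v ` (L + seg (0, 1))" "K + seg w = frame u w v ` (L + seg ((0, 1), 0))"
    "K + seg w + seg v = frame u w v ` (L + seg ((0, 1), 0) + seg (0, 1))"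
    by (simp_all only: L(2) sv sw linear_image_set_plus[OF linear_frame])
  have vols: "vol K = ?D * vol L" "vol (K + seg v) = ?D * vol (L + seg (0, 1))"
    "vol (K + seg w) = ?D * vol (L + seg ((0, 1), 0))"
    "vol (K + seg w + seg v) = ?D * vol (L + seg ((0, 1), 0) + seg (0, 1))"
    unfolding eqs(3) unfolding eqs(1,2) unfolding L(2) vol_frame[OF L''] vol_frame[OF L'] vol_frame[OF L(1)] abs_of_pos[OF D]
    by (rule refl)+
  have one: "vol (L + seg (0, 1)) = vol L + 2 * vol (fst ` L)"
    using vol_plus_vertical_seg[OF L(1), of 1] by simp
  have "vol (L + seg ((0, 1), 0) + seg (0, 1)) = vol (L + seg ((0, 1), 0)) + 2 * vol (fst ` (L + seg ((0, 1), 0)))"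
    unfolding vol_plus_vertical_seg[OF L', of _ 1] by simp
  also have "fst ` (L + seg ((0, 1), 0)) = fst ` L + seg (0, 1)"
    unfolding linear_image_set_plus[OF lin(1)] linear_image_seg[OF lin(1)] by simp
  also have "vol (fst ` L + seg (0, 1)) = vol (fst ` L) + 2 * vol (fst ` fst ` L)"
    unfolding vol_plus_vertical_seg[OF convex_body_linear_image[OF L(1) lin(1)], of 1] by simp
  finally have "vol (K + seg w + seg v) = vol (K + seg w) + (vol (K + seg v) - vol K) + 4 * (?D * vol (fst ` fst ` L))"
    unfolding vols one by (simp add: algebra_simps)
  \<comment> \<open>Taking the inner product with \<open>w \<times> v\<close> annihilates
    \<open>w\<close> and \<open>v\<close>, so it sees only the first coordinate.\<close>
  moreover have "width (w \<times> v) K = ?D * vol (fst ` fst ` L)"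
  proof -
    have "frame u w v p \<bullet> (w \<times> v) = ?D * fst (fst p)" for p
      by (simp add: frame_def inner_add_left dot_cross_self)
    then have "(\<lambda>x. x \<bullet> (w \<times> v)) ` K = (\<lambda>r. ?D * r) ` fst ` fst ` L"
      unfolding L(2) image_image by simp
    moreover obtain a b where ab: "a \<le> b" "fst ` fst ` L = {a..b}"
      by (rule convex_body_real[OF convex_body_linear_image[OF convex_body_linear_image[OF L(1) lin(1)] lin(2)]])
    ultimately have "(\<lambda>x. x \<bullet> (w \<times> v)) ` K = {?D * a..?D * b}"
      using image_mult_atLeastAtMost[OF D, of a b] by simp
    then have "width (w \<times> v) K = ?D * b - ?D * a"
      using ab(1) D unfolding width_def by (simp add: mult_left_mono)
    then show ?thesis using ab by (simp add: algebra_simps)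
  qed
  ultimately show ?thesis by simp
qed

lemma vol_plus_scaled_seg:
  fixes K :: "(real^3) set"
  assumes K: "convex_body K" and v: "v \<noteq> 0"
  shows "vol (K + seg (t *\<^sub>R v)) = vol K + \<bar>t\<bar> * (vol (K + seg v) - vol K)"
proof -
  \<comment> \<open>An auxiliary direction, to complete \<open>v\<close> to a frame in which it is
    vertical.\<close>
  obtain w where w: "v \<times> w \<noteq> 0"
    using orthogonal_to_vector_exists[of v] v norm_and_cross_eq_0[of v] by (auto simp: orthogonal_def)
  define u where "u = w \<times> v"
  let ?D = "u \<bullet> (w \<times> v)"
  have D: "?D > 0" using w cross_skew[of w v] by (simp add: u_def)
  obtain L where L: "convex_body L" "K = frame u w v ` L" using frame_coords[OF K, of u w v] D by auto
  have "seg (s *\<^sub>R v) = frame u w v ` seg (0, s)" for s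
    unfolding linear_image_seg[OF linear_frame] by (simp add: frame_def)
  then have "K + seg (s *\<^sub>R v) = frame u w v ` (L + seg (0, s))" for s
    by (simp only: L(2) linear_image_set_plus[OF linear_frame])
  then have "vol (K + seg (s *\<^sub>R v)) = ?D * (vol L + 2 * \<bar>s\<bar> * vol (fst ` L))" for s
    using D by (simp only: vol_frame[OF convex_body_plus[OF L(1) convex_body_seg]] vol_plus_vertical_seg[OF L(1)] abs_of_pos)
  from this[of t] this[of 1] show ?thesis unfolding L(2) using D by (simp add: vol_frame L(1) algebra_simps)
qed

lemma width_plus_seg:
  assumes "convex_body K" shows "width c (K + seg u) = width c K + 2 * \<bar>u \<bullet> c\<bar>"
proof -
  have lin: "linear (\<lambda>x. x \<bullet> c)" by (intro linearI) (simp_all add: inner_add_left)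
  obtain a b where ab: "a \<le> b" "(\<lambda>x. x \<bullet> c) ` K = {a..b}"
    using convex_body_real[OF convex_body_linear_image[OF assms lin]] by blast
  have "(\<lambda>x. x \<bullet> c) ` (K + seg u) = {a - \<bar>u \<bullet> c\<bar>..b + \<bar>u \<bullet> c\<bar>}"
    by (simp only: linear_image_set_plus[OF lin] linear_image_seg[OF lin] ab Icc_plus_seg)
  then show ?thesis using ab by (simp add: width_def)
qed

section \<open>The volume polynomial of a ball plus a zonotope\<close>

definition zsum :: "(real^3) list \<Rightarrow> (real^3) set" where
  "zsum vs = sum_list (map seg vs)"

lemma zsum_simps [simp]: "zsum [] = {0}" "zsum (v # vs) = seg v + zsum vs"
  by (simp_all add: zsum_def set_zero)

lemma zsum_append: "zsum (vs @ ws) = zsum vs + zsum ws"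
  by (simp add: zsum_def)

lemma convex_body_zsum: "convex_body (zsum vs)"
  by (induction vs) (simp_all add: convex_body_singleton convex_body_plus convex_body_seg)

lemma linear_image_zsum: "linear f \<Longrightarrow> f ` zsum vs = zsum (map f vs)"
  by (induction vs) (simp_all add: linear_0 linear_image_set_plus linear_image_seg)

fun pairwise_independent :: "(real^3) list \<Rightarrow> bool" where
  "pairwise_independent [] = True"
| "pairwise_independent (v # vs) = (v \<noteq> 0 \<and> (\<forall>w\<in>set vs. v \<times> w \<noteq> 0) \<and> pairwise_independent vs)"

fun cross_sum :: "(real^3) list \<Rightarrow> real" where
  "cross_sum [] = 0"
| "cross_sum (v # vs) = cross_sum vs + (\<Sum>w\<leftarrow>vs. norm (w \<times> v))"

text \<open>Collects the triples that contain \<open>v\<close>, so that \<open>det_sum\<close>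
  counts every unordered triple once.\<close>

fun pair_det_sum :: "real^3 \<Rightarrow> (real^3) list \<Rightarrow> real" where
  "pair_det_sum v [] = 0"
| "pair_det_sum v (w # ws) = pair_det_sum v ws + (\<Sum>u\<leftarrow>ws. \<bar>u \<bullet> (w \<times> v)\<bar>)"

fun det_sum :: "(real^3) list \<Rightarrow> real" where
  "det_sum [] = 0"
| "det_sum (v # vs) = det_sum vs + pair_det_sum v vs"

lemma width_plus_zsum:
  "convex_body K \<Longrightarrow> width c (K + zsum vs) = width c K + 2 * (\<Sum>u\<leftarrow>vs. \<bar>u \<bullet> c\<bar>)"
proof (induction vs arbitrary: K)
  case (Cons v vs)
  have "width c (K + zsum (v # vs)) = width c (K + seg v + zsum vs)" by (simp add: add.assoc)
  then show ?case
    using Cons.IH[OF convex_body_plus[OF Cons.prems convex_body_seg]] width_plus_seg[OF Cons.prems] by simp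
qed simp

text \<open>Each further \<open>w\<close> raises the increment due to \<open>v\<close> by 4 times a
  width of the body built so far. Every segment already present contributes 2 |u . (w x v)| to that
  width, hence the factor 8.\<close>

lemma vol_plus_zsum_seg:
  assumes K: "convex_body K"
  shows "(\<forall>w\<in>set ws. v \<times> w \<noteq> 0) \<Longrightarrow> vol (K + zsum ws + seg v) = vol (K + zsum ws) + (vol (K + seg v) - vol K)
    + 4 * (\<Sum>w\<leftarrow>ws. width (w \<times> v) K) + 8 * pair_det_sum v ws"
proof (induction ws)
  case (Cons w ws)
  let ?K = "K + zsum ws"
  have K': "convex_body ?K" by (intro convex_body_plus K convex_body_zsum)
  have eq: "K + zsum (w # ws) = ?K + seg w" by (simp add: ac_simps)
  have "v \<times> w \<noteq> 0" using Cons.prems by simp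
  then have "vol (K + zsum (w # ws) + seg v) = vol (K + zsum (w # ws)) + (vol (?K + seg v) - vol ?K) + 4 * width (w \<times> v) ?K"
    unfolding eq by (rule vol_plus_seg_twice[OF K'])
  then show ?case using Cons.IH Cons.prems by (simp add: width_plus_zsum[OF K] del: zsum_simps)
qed simp

text \<open>The hypothesis on widths holds for a ball of radius \<open>r\<close> and, with
  \<open>r = 0\<close>, for a point. One formula thus covers the zonotope and its sum with a
  ball.\<close>

lemma vol_plus_zsum:
  assumes K: "convex_body K"
  shows "pairwise_independent vs \<Longrightarrow> (\<And>c. width c K = 2 * r * norm c) \<Longrightarrow>
    vol (K + zsum vs) = vol K + (\<Sum>v\<leftarrow>vs. vol (K + seg v) - vol K) + 8 * r * cross_sum vs + 8 * det_sum vs"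
proof (induction vs)
  case (Cons v vs)
  have "K + zsum (v # vs) = K + zsum vs + seg v" by (simp add: ac_simps)
  moreover have "(\<Sum>w\<leftarrow>vs. width (w \<times> v) K) = 2 * r * (\<Sum>w\<leftarrow>vs. norm (w \<times> v))"
    unfolding Cons.prems(2) by (simp add: sum_list_const_mult)
  ultimately show ?case using Cons.IH Cons.prems vol_plus_zsum_seg[OF K, of vs v]
    by (simp add: algebra_simps del: zsum_simps)
qed simp

lemma width_cball:
  assumes "0 \<le> r" shows "width c (cball 0 r) = 2 * r * norm c"
proof -
  have "(\<lambda>x. x \<bullet> c) ` cball 0 r = {- (r * norm c)..r * norm c}"
  proof (intro equalityI subsetI)
    fix y assume "y \<in> (\<lambda>x. x \<bullet> c) ` cball 0 r"
    then obtain x where x: "norm x \<le> r" "y = x \<bullet> c" by auto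
    have "\<bar>x \<bullet> c\<bar> \<le> norm x * norm c" by (rule Cauchy_Schwarz_ineq2)
    also have "\<dots> \<le> r * norm c" using x(1) by (intro mult_right_mono) auto
    finally show "y \<in> {- (r * norm c)..r * norm c}" using x(2) by auto
  next
    fix y assume y: "y \<in> {- (r * norm c)..r * norm c}"
    show "y \<in> (\<lambda>x. x \<bullet> c) ` cball 0 r"
    proof (cases "c = 0")
      case False
      have "\<bar>y\<bar> / norm c \<le> r" using y False by (simp add: divide_le_eq abs_le_iff)
      then have "(y / (norm c)\<^sup>2) *\<^sub>R c \<in> cball 0 r" using False by (simp add: power2_eq_square)
      moreover have "y = ((y / (norm c)\<^sup>2) *\<^sub>R c) \<bullet> c" using False by (simp add: dot_square_norm)
      ultimately show ?thesis by blast
    qed (use y assms in \<open>auto intro!: image_eqI[of _ _ 0]\<close>)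
  qed
  then show ?thesis using assms by (simp add: width_def)
qed

lemma pairwise_independent_scaleR:
  "t \<noteq> 0 \<Longrightarrow> pairwise_independent vs \<Longrightarrow> pairwise_independent (map ((*\<^sub>R) t) vs)"
  by (induction vs) (simp_all add: cross_mult_left cross_mult_right)

lemma cross_sum_scaleR: "cross_sum (map ((*\<^sub>R) t) vs) = t\<^sup>2 * cross_sum vs"
  by (induction vs)
     (simp_all add: cross_mult_left cross_mult_right o_def sum_list_const_mult distrib_left power2_eq_square mult.assoc[symmetric])

lemma det_sum_scaleR: "0 \<le> t \<Longrightarrow> det_sum (map ((*\<^sub>R) t) vs) = t ^ 3 * det_sum vs"
proof (induction vs)
  case (Cons v vs)
  have "pair_det_sum (t *\<^sub>R v) (map ((*\<^sub>R) t) ws) = t ^ 3 * pair_det_sum v ws" for ws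
    using Cons.prems
    by (induction ws) (simp_all add: cross_mult_left cross_mult_right o_def sum_list_const_mult distrib_left
        abs_mult power3_eq_cube mult.assoc[symmetric])
  with Cons show ?case by (simp add: distrib_left)
qed simp

text \<open>The factors 8 are there because \<open>seg v\<close> is a segment of length $2|v|$.\<close>

lemma vol_cball_plus_zsum:
  assumes r: "0 \<le> r" and t: "0 < t" and vs: "pairwise_independent vs"
  shows "vol (cball 0 r + zsum (map ((*\<^sub>R) t) vs)) = vol (cball (0::real^3) r)
    + t * (\<Sum>v\<leftarrow>vs. vol (cball 0 r + seg v) - vol (cball (0::real^3) r)) + 8 * r * t\<^sup>2 * cross_sum vs + 8 * t ^ 3 * det_sum vs"
proof -
  have cb: "convex_body (cball (0::real^3) r)" by (rule convex_body_cball[OF r])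
  have "(\<Sum>v\<leftarrow>vs. vol (cball 0 r + seg (t *\<^sub>R v)) - vol (cball (0::real^3) r)) = t * (\<Sum>v\<leftarrow>vs. vol (cball 0 r + seg v) - vol (cball (0::real^3) r))"
    using vs
  proof (induction vs)
    case (Cons v vs)
    then have "v \<noteq> 0" "pairwise_independent vs" by simp_all
    then show ?case using Cons.IH t vol_plus_scaled_seg[OF cb \<open>v \<noteq> 0\<close>, of t] by (simp add: algebra_simps)
  qed simp
  then show ?thesis
    using vol_plus_zsum[OF cb pairwise_independent_scaleR[OF _ vs] width_cball[OF r], of t] t
    by (simp add: cross_sum_scaleR det_sum_scaleR o_def mult_ac)
qed

lemma vol_seg: "vol (seg (v :: real^3)) = 0"
proof -
  have eq: "seg v = frame 0 0 v ` seg (0, 1)"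
    unfolding linear_image_seg[OF linear_frame] by (simp add: frame_def)
  show ?thesis unfolding eq vol_frame[OF convex_body_seg] by simp
qed

text \<open>The case of radius 0: the quadratic term carries the factor \<open>r\<close>, and the
  linear one vanishes because segments are null sets.\<close>

lemma vol_zsum:
  assumes t: "0 < t" and vs: "pairwise_independent vs"
  shows "vol (zsum (map ((*\<^sub>R) t) vs)) = 8 * t ^ 3 * det_sum vs"
proof -
  have 0: "cball (0::real^3) 0 = 0" "vol (0 :: (real^3) set) = 0" by (simp_all add: set_zero)
  then have "vol (cball 0 0 + seg v) - vol (cball (0::real^3) 0) = 0" for v :: "real^3"
    using vol_seg[of v] by simp
  then show ?thesis using vol_cball_plus_zsum[OF order_refl t vs] 0 by simp
qed

text \<open>
  Compare the coefficients of $t^5$ in the cubes of both sides of the inequality.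
\<close>

lemma steiner_violation:
  fixes \<kappa> V W S a a' :: real
  assumes pos: "0 < \<kappa>" "0 < V" "0 < W" "0 < S" "0 \<le> a" "0 \<le> a'" and gap: "64 * S ^ 3 < 27 * \<kappa> * V * W"
    and X: "\<And>t. 0 < t \<Longrightarrow> 8 * t ^ 3 * W \<le> X t"
    and Y: "\<And>t. 0 < t \<Longrightarrow> 0 \<le> Y t \<and> Y t \<le> \<kappa> + t * a + 8 * t\<^sup>2 * S + 8 * t ^ 3 * V"
    and Y': "\<And>t. 0 < t \<Longrightarrow> 0 \<le> Y' t \<and> Y' t \<le> \<kappa> + t * a' + 8 * t\<^sup>2 * S + 8 * t ^ 3 * V"
  shows "\<forall>\<^sub>F t in at_top. \<not> root 3 ((8 * t ^ 3 * V) * (8 * t ^ 3 * V)) + root 3 (\<kappa> * X t) \<le> root 3 (Y t) * root 3 (Y' t)"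
proof -
  \<comment> \<open>The cube roots of the volumes are \<open>t * \<alpha>\<close>, and
    \<open>t * \<beta>\<close> bounds the second term of the inequality from below.\<close>
  define \<alpha> where "\<alpha> = root 3 (8 * V)"
  define \<beta> where "\<beta> = root 3 (8 * \<kappa> * W)"
  have \<alpha>: "0 < \<alpha>" "\<alpha> ^ 3 = 8 * V" and \<beta>: "0 < \<beta>" "\<beta> ^ 3 = 8 * \<kappa> * W"
    using pos by (simp_all add: \<alpha>_def \<beta>_def)
  \<comment> \<open>For \<open>t \<ge> 1\<close> the number \<open>t * c\<close> dominates the
    constant and linear parts of both volumes, and \<open>E * t ^ 4\<close> then dominates all
    orders below the fifth.\<close>
  define c where "c = \<kappa> + a + a'"
  define E where "E = 64 * S\<^sup>2 + 16 * V * c + 16 * S * c + c\<^sup>2"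
  \<comment> \<open>The difference of the coefficients of t^5: 3 \<alpha>^4 \<beta> with \<alpha>^3
    = 8 V, against 2 * 8 V * 8 S.\<close>
  define \<delta> where "\<delta> = 24 * V * \<alpha> * \<beta> - 128 * V * S"
  \<comment> \<open>This is the gap hypothesis, since (\<alpha> \<beta>)^3 = 64 kappa V W and
    (16/3)^3 = 4096/27.\<close>
  have "(16 / 3 * S) ^ 3 < (\<alpha> * \<beta>) ^ 3"
    unfolding power_mult_distrib \<alpha>(2) \<beta>(2) using gap by (simp add: power3_eq_cube mult_ac)
  then have "16 / 3 * S < \<alpha> * \<beta>" by (rule power_less_imp_less_base) (use \<alpha>(1) \<beta>(1) in simp)
  then have "24 * V * (16 / 3 * S) < 24 * V * (\<alpha> * \<beta>)" using pos(2) by (intro mult_strict_left_mono) auto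
  then have \<delta>: "0 < \<delta>" by (simp add: \<delta>_def mult_ac)
  have c: "0 < c" using pos by (simp add: c_def)
  have "\<not> root 3 ((8 * t ^ 3 * V) * (8 * t ^ 3 * V)) + root 3 (\<kappa> * X t) \<le> root 3 (Y t) * root 3 (Y' t)"
    if t: "1 \<le> t" "E / \<delta> < t" for t
  proof
    assume le: "root 3 ((8 * t ^ 3 * V) * (8 * t ^ 3 * V)) + root 3 (\<kappa> * X t) \<le> root 3 (Y t) * root 3 (Y' t)"
    have t0: "0 < t" using t by simp
    have "root 3 (8 * t ^ 3 * V) = t * \<alpha>"
      using t0 by (simp add: \<alpha>_def real_root_mult real_root_power_cancel)
    then have 1: "root 3 ((8 * t ^ 3 * V) * (8 * t ^ 3 * V)) = (t * \<alpha>)\<^sup>2"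
      unfolding real_root_mult[of 3 "8 * t ^ 3 * V"] by (simp only: power2_eq_square)
    have "t * \<beta> = root 3 (\<kappa> * (8 * t ^ 3 * W))"
      using t0 by (simp add: \<beta>_def real_root_mult real_root_power_cancel)
    also have "\<dots> \<le> root 3 (\<kappa> * X t)" using X[OF t0] pos(1) by simp
    finally have "(t * \<alpha>)\<^sup>2 + t * \<beta> \<le> root 3 (Y t * Y' t)" using le 1 by (simp add: real_root_mult)
    then have "((t * \<alpha>)\<^sup>2 + t * \<beta>) ^ 3 \<le> root 3 (Y t * Y' t) ^ 3"
      using t0 \<alpha>(1) \<beta>(1) by (intro power_mono) auto
    also have "\<dots> = Y t * Y' t" using Y[OF t0] Y'[OF t0] by simp
    also have "\<dots> \<le> (8 * t ^ 3 * V + 8 * t\<^sup>2 * S + t * c) * (8 * t ^ 3 * V + 8 * t\<^sup>2 * S + t * c)"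
    proof -
      have "\<kappa> \<le> t * \<kappa>" using t(1) pos(1) by simp
      moreover have "0 \<le> t * a" "0 \<le> t * a'" using t0 pos by simp_all
      ultimately have "Y t \<le> 8 * t ^ 3 * V + 8 * t\<^sup>2 * S + t * c" "Y' t \<le> 8 * t ^ 3 * V + 8 * t\<^sup>2 * S + t * c"
        using Y[OF t0] Y'[OF t0] by (simp_all add: c_def distrib_left)
      then show ?thesis using Y[OF t0] Y'[OF t0] by (intro mult_mono) auto
    qed
    also have "\<dots> = 64 * V\<^sup>2 * t ^ 6 + 128 * V * S * t ^ 5 + (64 * S\<^sup>2 + 16 * V * c) * t ^ 4 + 16 * S * c * t ^ 3 + c\<^sup>2 * t\<^sup>2"
      by (simp add: eval_nat_numeral algebra_simps)
    also have "\<dots> \<le> 64 * V\<^sup>2 * t ^ 6 + 128 * V * S * t ^ 5 + E * t ^ 4"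
    proof -
      have "t ^ 3 \<le> t ^ 4" "t\<^sup>2 \<le> t ^ 4" using t(1) by (intro power_increasing; simp)+
      then have "16 * S * c * t ^ 3 \<le> 16 * S * c * t ^ 4" "c\<^sup>2 * t\<^sup>2 \<le> c\<^sup>2 * t ^ 4"
        using pos c by (intro mult_left_mono; simp)+
      then show ?thesis unfolding E_def by (simp add: distrib_right)
    qed
    finally have up: "((t * \<alpha>)\<^sup>2 + t * \<beta>) ^ 3 \<le> 64 * V\<^sup>2 * t ^ 6 + 128 * V * S * t ^ 5 + E * t ^ 4" .
    have "((t * \<alpha>)\<^sup>2 + t * \<beta>) ^ 3
        = t ^ 6 * (\<alpha> ^ 3)\<^sup>2 + 3 * (\<alpha> ^ 3 * \<alpha> * \<beta>) * t ^ 5 + 3 * t ^ 4 * \<alpha>\<^sup>2 * \<beta>\<^sup>2 + t ^ 3 * \<beta> ^ 3"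
      by (simp add: eval_nat_numeral algebra_simps)
    moreover have "0 \<le> 3 * t ^ 4 * \<alpha>\<^sup>2 * \<beta>\<^sup>2" "0 \<le> t ^ 3 * \<beta> ^ 3" using t0 \<beta>(1) by simp_all
    ultimately have "64 * V\<^sup>2 * t ^ 6 + 24 * V * \<alpha> * \<beta> * t ^ 5 \<le> ((t * \<alpha>)\<^sup>2 + t * \<beta>) ^ 3"
      unfolding \<alpha>(2) by (simp add: power_mult_distrib algebra_simps)
    with up have "\<delta> * t ^ 5 \<le> E * t ^ 4" by (simp add: \<delta>_def algebra_simps)
    then have "\<delta> * t \<le> E" using t0 by (simp add: eval_nat_numeral)
    then show False using t(2) \<delta> by (simp add: divide_less_eq mult.commute)
  qed
  then show ?thesis
    using eventually_conj[OF eventually_ge_at_top[of 1] eventually_gt_at_top[of "E / \<delta>"]]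
    by (elim eventually_mono) blast
qed

section \<open>The explicit zonotope with six generators\<close>

lemma vector3_simps:
  fixes a b c :: real
  shows "vector [a, b, c] \<times> vector [a', b', c'] = vector [b * c' - b' * c, c * a' - c' * a, a * b' - a' * b]"
    "(vector [a, b, c] :: real^3) \<bullet> vector [a', b', c'] = a * a' + b * b' + c * c'"
    "(vector [a, b, c] :: real^3) = 0 \<longleftrightarrow> a = 0 \<and> b = 0 \<and> c = 0"
    "norm (vector [a, b, c] :: real^3) = sqrt (a\<^sup>2 + b\<^sup>2 + c\<^sup>2)"
    "- (vector [a, b, c] :: real^3) = vector [- a, - b, - c]"
    "s *\<^sub>R (vector [a, b, c] :: real^3) = vector [s * a, s * b, s * c]"
    "(vector [a, b, c] :: real^3) - vector [a', b', c'] = vector [a - a', b - b', c - c']"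
  by (simp_all add: vec_eq_iff forall_3 cross_components inner_vec_def sum_3 norm_eq_sqrt_inner power2_eq_square)

text \<open>
  The generators come from a numerical search; for them $27 \kappa V W / (64 S^3)$, the ratio of the two sides
  of the gap condition above, is about $1.006$.
\<close>

definition generators :: "(real^3) list" where
  "generators = [vector [6, 2, 2], vector [6, -2, 2], vector [6, 2, -2], vector [6, -2, -2], vector [5, 0, 3], vector [5, 0, -3]]"

definition turn :: "real^3 \<Rightarrow> real^3" where
  "turn = plane_rotation 1 2 (pi / 2)"

lemma turn_vector: "turn (vector [a, b, c]) = vector [- b, a, c]"
  by (simp add: turn_def plane_rotation_def vec_eq_iff forall_3)

lemma linear_turn: "linear turn"
  by (intro linearI) (simp_all add: turn_def plane_rotation_def vec_eq_iff forall_3 algebra_simps)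

text \<open>Independence of all twelve vectors serves the sum of the two zonotopes and, by
  restriction, each of them.\<close>

lemma independent_generators: "pairwise_independent (generators @ map turn generators)"
  by (simp add: generators_def turn_vector vector3_simps)

lemma pairwise_independent_append:
  "pairwise_independent (vs @ ws) \<Longrightarrow> pairwise_independent vs \<and> pairwise_independent ws"
  by (induction vs) auto

lemma det_sum_generators: "det_sum generators = 1360"
  by (simp add: generators_def vector3_simps)

lemma det_sum_turned: "det_sum (map turn generators) = 1360"
  by (simp add: generators_def turn_vector vector3_simps)

lemma det_sum_both: "det_sum (generators @ map turn generators) = 22424"
  by (simp add: generators_def turn_vector vector3_simps)

lemma cross_sum_generators: "cross_sum generators \<le> 377" "cross_sum (map turn generators) \<le> 377"
proof -
  \<comment> \<open>The sum is about 376.97. It enters cubed against a margin of roughly half a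
    percent, so the roots are bounded to three decimals.\<close>
  have s: "sqrt 640 \<le> 25299 / 1000" "sqrt 1152 \<le> 33942 / 1000" "sqrt 200 \<le> 14143 / 1000" "sqrt 920 \<le> 30332 / 1000"
    by (rule real_le_lsqrt; simp add: power2_eq_square)+
  have "cross_sum generators = 4 * sqrt 640 + 2 * sqrt 1152 + 4 * sqrt 200 + 4 * sqrt 920 + sqrt 900"
    by (simp add: generators_def vector3_simps power2_eq_square del: real_sqrt_eq_iff)
  moreover have "cross_sum (map turn generators) = 4 * sqrt 640 + 2 * sqrt 1152 + 4 * sqrt 200 + 4 * sqrt 920 + sqrt 900"
    by (simp add: generators_def turn_vector vector3_simps power2_eq_square)
  moreover have "sqrt (900::real) = 30" by (rule real_sqrt_unique) simp_all
  ultimately show "cross_sum generators \<le> 377" "cross_sum (map turn generators) \<le> 377"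
    using s by simp_all
qed

text \<open>The recursive predicate compares an entry only with later ones; antisymmetry of the
  cross product gives the other order.\<close>

lemma pairwise_independent_nth:
  assumes "pairwise_independent vs" "i < length vs"
  shows "vs ! i \<noteq> 0" and "j < length vs \<Longrightarrow> i \<noteq> j \<Longrightarrow> vs ! i \<times> vs ! j \<noteq> 0"
proof -
  have "vs ! i \<noteq> 0 \<and> (\<forall>j<length vs. i \<noteq> j \<longrightarrow> vs ! i \<times> vs ! j \<noteq> 0)"
    using assms
  proof (induction vs arbitrary: i)
    case (Cons v vs)
    have *: "w \<times> v \<noteq> 0" if "w \<in> set vs" for w using that Cons.prems(1) cross_skew[of w v] by auto
    show ?case
    proof (cases i)
      case 0
      then show ?thesis using Cons.prems by (auto simp: nth_Cons split: nat.splits)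
    next
      case (Suc i')
      then show ?thesis using Cons.prems Cons.IH[of i'] * by (auto simp: nth_Cons split: nat.splits)
    qed
  qed simp
  then show "vs ! i \<noteq> 0" "j < length vs \<Longrightarrow> i \<noteq> j \<Longrightarrow> vs ! i \<times> vs ! j \<noteq> 0" by auto
qed

lemma zonotope_with_generators_zsum:
  assumes "pairwise_independent vs"
  shows "zonotope_with_generators (length vs) (zsum vs)"
  unfolding zonotope_with_generators_def
proof (intro exI conjI allI impI)
  fix i assume i: "i < length vs"
  show "- vs ! i \<noteq> vs ! i"
  proof
    assume "- vs ! i = vs ! i"
    then have "2 *\<^sub>R vs ! i = 0" by (simp only: scaleR_2) (metis add.left_inverse)
    then show False using pairwise_independent_nth(1)[OF assms i] by simp
  qed
  fix j assume j: "j < length vs" "i \<noteq> j"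
  have "vs ! k - - vs ! k = 2 *\<^sub>R vs ! k" for k by (simp add: scaleR_2)
  then show "\<not> collinear {0, vs ! i - - vs ! i, vs ! j - - vs ! j}"
    using pairwise_independent_nth(2)[OF assms i j] by (simp only: cross_eq_0[symmetric] cross_mult_left cross_mult_right) simp
next
  show "zsum vs = (\<Sum>i<length vs. closed_segment (- vs ! i) (vs ! i))"
    by (simp add: zsum_def sum_list_sum_nth atLeast0LessThan)
qed

text \<open>Every coordinate reflection permutes the six generators up to sign, and a centred
  segment does not change with the sign of its generator.\<close>

lemma unconditional_generators: "unconditional (zsum generators)"
  unfolding unconditional_def
proof
  fix i :: 3
  have lin: "linear (coord_reflection i)"
    by (intro linearI) (simp_all add: coord_reflection_def vec_eq_iff)
  have refl: "coord_reflection 1 (vector [a, b, c]) = (vector [- a, b, c] :: real^3)"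
    "coord_reflection 2 (vector [a, b, c]) = (vector [a, - b, c] :: real^3)"
    "coord_reflection 3 (vector [a, b, c]) = (vector [a, b, - c] :: real^3)" for a b c
    by (simp_all add: coord_reflection_def vec_eq_iff forall_3)
  \<comment> \<open>Orients every segment so that the endpoint with negative first coordinate comes
    second; both sides then differ only in the order of summands.\<close>
  have comm: "closed_segment (vector [-6, b, c]) x = closed_segment x (vector [-6, b, c])"
    "closed_segment (vector [-5, b, c]) x = closed_segment x (vector [-5, b, c])" for b c and x :: "real^3"
    by (rule closed_segment_commute)+
  show "coord_reflection i ` zsum generators = zsum generators"
    unfolding linear_image_zsum[OF lin]
    using exhaust_3[of i] by (elim disjE) (simp_all add: generators_def refl vector3_simps(5) comm ac_simps)
qed

lemma vol_cball_plus_seg_ge: "vol (cball (0::real^3) r) \<le> vol (cball (0::real^3) r + seg v)" if "0 \<le> r"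
proof (rule measure_mono_fmeasurable)
  have "x + 0 \<in> cball 0 r + seg v" if "x \<in> cball 0 r" for x :: "real^3"
    using that by (intro set_plus_intro) (auto simp: seg_iff intro: bexI[of _ 0])
  then show "cball (0::real^3) r \<subseteq> cball 0 r + seg v" by auto
  show "cball 0 r + seg v \<in> lmeasurable"
    using that by (intro convex_body_lmeasurable convex_body_plus convex_body_cball convex_body_seg)
qed simp

lemma eventually_violated_generators:
  "\<forall>\<^sub>F t in at_top. \<not> volume_ineq ((*\<^sub>R) t ` zsum generators) ((*\<^sub>R) t ` turn ` zsum generators)"
proof -
  let ?A = "\<lambda>vs. \<Sum>v\<leftarrow>vs. vol (cball (0::real^3) 1 + seg v) - vol (cball (0::real^3) 1)"
  let ?Z = "\<lambda>t vs. zsum (map ((*\<^sub>R) t) vs)"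
  let ?gs = "map turn generators"
  have ind: "pairwise_independent generators" "pairwise_independent ?gs"
    using pairwise_independent_append[OF independent_generators] by auto
  have A: "0 \<le> ?A vs" for vs :: "(real^3) list"
  proof (rule sum_list_nonneg)
    fix x assume "x \<in> set (map (\<lambda>v. vol (cball (0::real^3) 1 + seg v) - vol (cball (0::real^3) 1)) vs)"
    then obtain v where "x = vol (cball (0::real^3) 1 + seg v) - vol (cball (0::real^3) 1)" by (auto simp del: measure_completion)
    then show "0 \<le> x" using vol_cball_plus_seg_ge[OF zero_le_one, of v] by (simp only: diff_ge_0_iff_ge)
  qed
  have ball: "vol (cball (0::real^3) 1) = 4 / 3 * pi"
    using content_cball[of 1 "0::real^3"] by (simp add: measure_completion unit_ball_vol_3)
  have scale: "(*\<^sub>R) t ` zsum vs = ?Z t vs" for t vs by (rule linear_image_zsum) (rule linear_scale_self)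
  have "\<forall>\<^sub>F t in at_top. \<not> root 3 ((8 * t ^ 3 * 1360) * (8 * t ^ 3 * 1360)) + root 3 ((4 / 3 * pi) * vol (cball 0 1 + ?Z t generators + ?Z t ?gs))
     \<le> root 3 (vol (cball 0 1 + ?Z t generators)) * root 3 (vol (cball 0 1 + ?Z t ?gs))"
  proof (rule steiner_violation[where W = 22424 and S = 377])
    have "3.141 \<le> pi" using pi_approx(1) by simp
    then show "64 * 377 ^ 3 < 27 * (4 / 3 * pi) * 1360 * (22424::real)" by simp
    show "0 \<le> ?A generators" "0 \<le> ?A ?gs" by (rule A)+
    fix t :: real assume t: "0 < t"
    \<comment> \<open>The full sum is a ball plus a single zonotope with all twelve generators,
      whose volume is at least its cubic term.\<close>
    have eq: "cball 0 1 + ?Z t generators + ?Z t ?gs = cball 0 1 + ?Z t (generators @ ?gs)"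
      by (simp only: zsum_append map_append add.assoc)
    have "0 \<le> cross_sum vs" for vs by (induction vs) (auto intro!: add_nonneg_nonneg sum_list_nonneg)
    then have "0 \<le> 8 * 1 * t\<^sup>2 * cross_sum (generators @ ?gs)" by (intro mult_nonneg_nonneg) simp_all
    moreover have "0 \<le> t * ?A (generators @ ?gs)" using t by (intro mult_nonneg_nonneg A) simp
    moreover have "0 \<le> 4 / 3 * pi" by simp
    ultimately show "8 * t ^ 3 * 22424 \<le> vol (cball 0 1 + ?Z t generators + ?Z t ?gs)"
      unfolding eq vol_cball_plus_zsum[OF zero_le_one t independent_generators] ball det_sum_both by linarith
    have "vol (cball 0 1 + ?Z t vs) \<le> 4 / 3 * pi + t * ?A vs + 8 * t\<^sup>2 * 377 + 8 * t ^ 3 * 1360"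
      if "pairwise_independent vs" "cross_sum vs \<le> 377" "det_sum vs = 1360" for vs
    proof -
      have "8 * t\<^sup>2 * cross_sum vs \<le> 8 * t\<^sup>2 * 377" using that(2) by (intro mult_left_mono) auto
      then show ?thesis unfolding vol_cball_plus_zsum[OF zero_le_one t that(1)] ball that(3) by simp
    qed
    from this[OF ind(1) cross_sum_generators(1) det_sum_generators] this[OF ind(2) cross_sum_generators(2) det_sum_turned]
    show "0 \<le> vol (cball 0 1 + ?Z t generators) \<and> vol (cball 0 1 + ?Z t generators) \<le> 4 / 3 * pi + t * ?A generators + 8 * t\<^sup>2 * 377 + 8 * t ^ 3 * 1360"
      "0 \<le> vol (cball 0 1 + ?Z t ?gs) \<and> vol (cball 0 1 + ?Z t ?gs) \<le> 4 / 3 * pi + t * ?A ?gs + 8 * t\<^sup>2 * 377 + 8 * t ^ 3 * 1360"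
      by simp_all
  qed simp_all
  then show ?thesis
    using eventually_gt_at_top[of 0]
  proof eventually_elim
    case (elim t)
    then show ?case
      unfolding volume_ineq_def linear_image_zsum[OF linear_turn] scale ball
        vol_zsum[OF elim(2) ind(1)] vol_zsum[OF elim(2) ind(2)] det_sum_generators det_sum_turned by simp
  qed
qed

theorem theorem11:
  shows "(3 \<le> CARD('n::finite) \<longrightarrow>
            (\<exists>B C :: (real ^ 'n) set. zonoid B \<and> zonoid C \<and> \<not> volume_ineq B C)) \<and>
         (\<exists>(B :: (real ^ 3) set) R.
            unconditional B \<and> zonotope_with_generators 6 B \<and> quarter_turn R \<and>
            (\<forall>\<^sub>F t in at_top. \<not> volume_ineq ((*\<^sub>R) t ` B) ((*\<^sub>R) t ` R ` B))) \<and>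
         (4 \<le> CARD('n) \<longrightarrow>
            (\<exists>B C :: (real ^ 'n) set. zonoid B \<and> zonoid C \<and>
               B + C = (*\<^sub>R) 2 ` cball 0 1 \<and>
               (\<forall>\<^sub>F t in at_top. \<not> volume_ineq ((*\<^sub>R) t ` B) ((*\<^sub>R) t ` C))))"
proof -
  have pair: "\<exists>B C :: (real ^ 'n) set. (\<forall>t>0. zonoid ((*\<^sub>R) t ` B) \<and> zonoid ((*\<^sub>R) t ` C)) \<and>
      B + C = (*\<^sub>R) 2 ` cball 0 1 \<and> (\<forall>\<^sub>F t in at_top. \<not> volume_ineq ((*\<^sub>R) t ` B) ((*\<^sub>R) t ` C))"
    if "3 \<le> CARD('n)"
  proof -
    \<comment> \<open>An arbitrary coordinate axis; the index type has no distinguished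
      element.\<close>
    let ?e = "axis undefined 1 :: real ^ 'n"
    have "unit_axis ?e" by standard simp
    then show ?thesis
      by (rule unit_axis.eventually_violated) (use that in \<open>simp_all add: axis_in_Basis_iff\<close>)
  qed
  have "\<exists>B C :: (real ^ 'n) set. zonoid B \<and> zonoid C \<and> \<not> volume_ineq B C" if n: "3 \<le> CARD('n)"
  proof -
    obtain B C :: "(real ^ 'n) set" where zon: "\<forall>t>0. zonoid ((*\<^sub>R) t ` B) \<and> zonoid ((*\<^sub>R) t ` C)"
      and "\<forall>\<^sub>F t in at_top. \<not> volume_ineq ((*\<^sub>R) t ` B) ((*\<^sub>R) t ` C)" using pair[OF n] by blast
    then have "\<forall>\<^sub>F t in at_top. 0 < t \<and> \<not> volume_ineq ((*\<^sub>R) t ` B) ((*\<^sub>R) t ` C)"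
      using eventually_gt_at_top[of "0::real"] by (simp add: eventually_conj_iff)
    \<comment> \<open>Any such \<open>t\<close> gives a violating pair, because every positive
      dilate is a zonoid.\<close>
    from eventually_happens'[OF trivial_limit_at_top_linorder this]
    obtain t :: real where "0 < t" "\<not> volume_ineq ((*\<^sub>R) t ` B) ((*\<^sub>R) t ` C)" by (elim exE conjE)
    with zon show ?thesis by blast
  qed
  moreover have "\<exists>B C :: (real ^ 'n) set. zonoid B \<and> zonoid C \<and> B + C = (*\<^sub>R) 2 ` cball 0 1 \<and>
      (\<forall>\<^sub>F t in at_top. \<not> volume_ineq ((*\<^sub>R) t ` B) ((*\<^sub>R) t ` C))" if n: "4 \<le> CARD('n)"
  proof -
    from n have "3 \<le> CARD('n)" by simp
    from pair[OF this] obtain B C :: "(real ^ 'n) set" where zon: "\<forall>t>0. zonoid ((*\<^sub>R) t ` B) \<and> zonoid ((*\<^sub>R) t ` C)"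
      and BC: "B + C = (*\<^sub>R) 2 ` cball 0 1" "\<forall>\<^sub>F t in at_top. \<not> volume_ineq ((*\<^sub>R) t ` B) ((*\<^sub>R) t ` C)"
      by blast
    have "zonoid B" "zonoid C" using zon[rule_format, OF zero_less_one] by simp_all
    with BC show ?thesis by blast
  qed
  moreover have "zonotope_with_generators 6 (zsum generators)"
  proof -
    have "length generators = 6" by (simp add: generators_def)
    then show ?thesis
      using zonotope_with_generators_zsum[OF conjunct1[OF pairwise_independent_append[OF independent_generators]]]
      by (simp only:)
  qed
  moreover have "quarter_turn turn" unfolding quarter_turn_def turn_def
    by (intro exI[of _ 1] exI[of _ 2]) simp
  ultimately show ?thesis using unconditional_generators eventually_violated_generators by blast
qed

end
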